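(* Let $\mathfrak m$ be a discrete $l\times l$ matrix-valued $m$-function and let $M(z)=-\mathfrak m(z+z^{-1})$. The following are equivalent: (I) The block Jacobi matrices $\{A_n,B_n\}_{n=1}^\infty$ corresponding to $\mathfrak m$ satisfy $$\|B_n\|+\|\mathbf 1-A_nA_n^*\|=0\quad\text{for all large }n.$$ (II) All of the following hold: (A) $M$ is a rational matrix function. (B) $M$ has no poles on $\partial\mathbb D\setminus\{\pm1\}$, and at most simple poles at $\pm1$. (C) $(M(z)-M^\sharp(z))^{-1}$ has no poles in $\mathbb C\setminus\{0\}$ except at $z=\pm1$, where there might be simple poles. (D) If $M$ has a pole at some $z_j\in\mathbb D$ and also at $z_j^{-1}$, then $$\operatorname{Ran}\operatorname*{Res}_{z=z_j}M(z)\subseteq\ker\,(M(z_j^{-1})-M^\sharp(z_j^{-1}))^{-1},$$ $$\operatorname{Ran}\operatorname*{Res}_{z=z_j}M(z)\subseteq\Bigl(\operatorname{Ran}\,(M(z_j^{-1})-M^\sharp(z_j^{-1}))^{-1}M(z_j^{-1})\Bigr)^\perp .$$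
   Context: Notation: $\mathbb{D}$ is the open unit disk; $\mathbf 1,\mathbf 0$ are the $l\times l$ identity and zero matrices; ${}^*$ is Hermitian conjugation; $M^\sharp(z)=M(\bar z^{-1})^*$. A simple pole is a pole of order $1$. Meromorphic matrix functions whose inverse is taken are assumed to have determinant not identically zero. An $l\times l$ matrix-valued function $m$ analytic in $\mathbb C_+=\{\operatorname{Im}z>0\}$ is Herglotz if $\operatorname{Im}m(z)=\frac1{2i}(m(z)-m(z)^* )\ge\mathbf 0$ on $\mathbb C_+$ (standing assumption: $\det\operatorname{Im}m\not\equiv0$); it is extended to $\mathbb C_-$ by $m(z)=m(\bar z)^*$. A discrete $m$-function is a Herglotz function having an analytic continuation from $\mathbb C_+$ to $\mathbb C\setminus I$ for some bounded interval $I\subset\mathbb R$ with $\operatorname{Im}m=\mathbf 0$ on $\mathbb R\setminus I$ and $m(z)=-z^{-1}\mathbf 1+O(z^{-2})$ at $\infty$; equivalently $m(z)=\int\frac{d\mu(x)}{x-z}$ for an $l\times l$ positive semidefinite matrix-valued measure $\mu$ on $\mathbb R$ of bounded support with $\mu(\mathbb R)=\mathbf 1$. The measure is assumed non-trivial: $\bigl\|\int f(x)^*d\mu(x)f(x)\bigr\|>0$ for all nonzero matrix polynomials $f$. A block Jacobi matrix $\{A_n,B_n\}_{n\ge1}$ ($A_n$ invertible, $B_n$ Hermitian $l\times l$ matrices, bounded) is the semi-infinite block tridiagonal matrix $\mathcal J$ with diagonal blocks $B_n$, superdiagonal blocks $A_n$, subdiagonal blocks $A_n^*$; it corresponds to $\mathfrak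 m$ if $\mathfrak m(E)$ is the upper-left $l\times l$ block of $(\mathcal J-E)^{-1}$. The matrices corresponding to the same $\mathfrak m$ are related by $\widetilde A_n=\sigma_n^*A_n\sigma_{n+1}$, $\widetilde B_n=\sigma_n^*B_n\sigma_n$ with unitary $\sigma_n$, $\sigma_1=\mathbf 1$, so condition (I) does not depend on the choice. In (D), $(M(z_j^{-1})-M^\sharp(z_j^{-1}))^{-1}$ denotes the value at $z=z_j^{-1}$ of the function $(M(z)-M^\sharp(z))^{-1}$ (analytic there by (C)), and $(M(z_j^{-1})-M^\sharp(z_j^{-1}))^{-1}M(z_j^{-1})$ denotes the value at $z=z_j^{-1}$ of $(M(z)-M^\sharp(z))^{-1}M(z)$, which is analytic there by the first inclusion in (D). *)

theory Defs
  imports "HOL-Complex_Analysis.Complex_Analysis" "HOL-Library.Landau_Symbols"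
begin

section \<open>Complex matrices\<close>

definition hconj :: "complex^'n^'m \<Rightarrow> complex^'m^'n" where
  "hconj M = (\<chi> i j. cnj (M $ j $ i))"

definition cinner :: "complex^'n \<Rightarrow> complex^'n \<Rightarrow> complex" where
  "cinner v w = (\<Sum>i\<in>UNIV. cnj (v $ i) * w $ i)"

definition hermitian :: "complex^'n^'n \<Rightarrow> bool" where
  "hermitian M \<longleftrightarrow> hconj M = M"

definition psd :: "complex^'n^'n \<Rightarrow> bool" where
  "psd M \<longleftrightarrow> hermitian M \<and> (\<forall>v. 0 \<le> Re (cinner v (M *v v)))"

definition matrix_Im :: "complex^'n^'n \<Rightarrow> complex^'n^'n" where
  "matrix_Im M = (\<chi> i j. (M - hconj M) $ i $ j / (2 * \<i>))"

definition matrix_ran :: "complex^'n^'m \<Rightarrow> (complex^'m) set" where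
  "matrix_ran M = range (\<lambda>v. M *v v)"

definition matrix_ker :: "complex^'n^'m \<Rightarrow> (complex^'n) set" where
  "matrix_ker M = {v. M *v v = 0}"

definition cperp :: "(complex^'n) set \<Rightarrow> (complex^'n) set" where
  "cperp S = {v. \<forall>w\<in>S. cinner w v = 0}"


section \<open>Herglotz functions and discrete m-functions\<close>

definition matrix_holomorphic_on :: "(complex \<Rightarrow> complex^'n^'m) \<Rightarrow> complex set \<Rightarrow> bool" where
  "matrix_holomorphic_on F S \<longleftrightarrow> (\<forall>i j. (\<lambda>z. F z $ i $ j) holomorphic_on S)"

definition herglotz :: "(complex \<Rightarrow> complex^'l^'l) \<Rightarrow> bool" where
  "herglotz m \<longleftrightarrow>
     matrix_holomorphic_on m {z. Im z > 0} \<and>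
     (\<forall>z. Im z > 0 \<longrightarrow> psd (matrix_Im (m z))) \<and>
     (\<exists>z. Im z > 0 \<and> det (matrix_Im (m z)) \<noteq> 0) \<and>
     (\<forall>z. Im z < 0 \<longrightarrow> m z = hconj (m (cnj z)))"

text \<open>Enlarging the bounded interval, one may take it compact. The values of \<open>m\<close> on that
  interval carry no information.\<close>

definition discrete_m_function :: "(complex \<Rightarrow> complex^'l^'l) \<Rightarrow> bool" where
  "discrete_m_function m \<longleftrightarrow>
     herglotz m \<and>
     (\<exists>a b :: real.
        matrix_holomorphic_on m (- (complex_of_real ` {a..b})) \<and>
        (\<forall>x. x \<notin> {a..b} \<longrightarrow> matrix_Im (m (complex_of_real x)) = 0)) \<and>
     (\<lambda>z. norm (m z + mat (1 / z))) \<in> O[at_infinity](\<lambda>z. 1 / norm z ^ 2)"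


section \<open>Matrix-valued measures\<close>

definition psd_matrix_measure :: "(real set \<Rightarrow> complex^'l^'l) \<Rightarrow> bool" where
  "psd_matrix_measure \<mu> \<longleftrightarrow>
     (\<forall>S\<in>sets borel. psd (\<mu> S)) \<and>
     (\<forall>F :: nat \<Rightarrow> real set. range F \<subseteq> sets borel \<longrightarrow> disjoint_family F \<longrightarrow>
        (\<lambda>n. \<mu> (F n)) sums \<mu> (\<Union>n. F n))"

definition quad_measure :: "(real set \<Rightarrow> complex^'l^'l) \<Rightarrow> complex^'l \<Rightarrow> real measure" where
  "quad_measure \<mu> v =
     measure_of UNIV (sets borel) (\<lambda>S. ennreal (Re (cinner v (\<mu> S *v v))))"

text \<open>The integral of \<open>\<phi>\<close> against the complex measure \<open>S \<mapsto> \<mu> S $ j $ k\<close>. Since \<open>cinner\<close> is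
  conjugate-linear in its first argument, polarization gives
  \<open>4 * \<mu> S $ j $ k = (\<Sum>p<4. (-\<i>)^p * cinner v\<^sub>p (\<mu> S *v v\<^sub>p))\<close> for
  \<open>v\<^sub>p = axis j 1 + \<i>^p *s axis k 1\<close>.\<close>

definition entry_integral ::
  "(real set \<Rightarrow> complex^'l^'l) \<Rightarrow> 'l \<Rightarrow> 'l \<Rightarrow> (real \<Rightarrow> complex) \<Rightarrow> complex" where
  "entry_integral \<mu> j k \<phi> =
     (\<Sum>p<4. (-\<i>)^p * (\<integral>x. \<phi> x \<partial>quad_measure \<mu> (axis j 1 + \<i>^p *s axis k 1))) / 4"

text \<open>\<open>form_integral \<mu> f g\<close> is the matrix \<open>\<integral> f(x)\<^sup>* d\<mu>(x) g(x)\<close>.\<close>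

definition form_integral ::
  "(real set \<Rightarrow> complex^'l^'l) \<Rightarrow> (real \<Rightarrow> complex^'l^'l) \<Rightarrow> (real \<Rightarrow> complex^'l^'l)
     \<Rightarrow> complex^'l^'l" where
  "form_integral \<mu> f g =
     (\<chi> a b. \<Sum>j\<in>UNIV. \<Sum>k\<in>UNIV.
        entry_integral \<mu> j k (\<lambda>x. cnj (f x $ j $ a) * g x $ k $ b))"

definition is_representing_measure ::
  "(real set \<Rightarrow> complex^'l^'l) \<Rightarrow> (complex \<Rightarrow> complex^'l^'l) \<Rightarrow> bool" where
  "is_representing_measure \<mu> m \<longleftrightarrow>
     psd_matrix_measure \<mu> \<and>
     (\<exists>a b. \<mu> (- {a..b}) = 0) \<and>
     \<mu> UNIV = mat 1 \<and>
     (\<forall>z. Im z \<noteq> 0 \<longrightarrow>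
        m z = form_integral \<mu> (\<lambda>x. mat 1) (\<lambda>x. mat (1 / (complex_of_real x - z))))"

definition matrix_poly :: "complex poly^'l^'l \<Rightarrow> real \<Rightarrow> complex^'l^'l" where
  "matrix_poly P x = (\<chi> i j. poly (P $ i $ j) (complex_of_real x))"

definition nontrivial_measure :: "(real set \<Rightarrow> complex^'l^'l) \<Rightarrow> bool" where
  "nontrivial_measure \<mu> \<longleftrightarrow>
     (\<forall>P. P \<noteq> 0 \<longrightarrow> norm (form_integral \<mu> (matrix_poly P) (matrix_poly P)) > 0)"


section \<open>Block Jacobi matrices\<close>

text \<open>Block indices start at 0, so \<open>A n\<close> and \<open>B n\<close> stand for $A_{n+1}$ and $B_{n+1}$. Below,
  \<open>norm\<close> on matrices is the Frobenius norm; only boundedness and vanishing of norms matter, and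
  these do not depend on the choice of the norm.\<close>

definition block_jacobi :: "(nat \<Rightarrow> complex^'l^'l) \<Rightarrow> (nat \<Rightarrow> complex^'l^'l) \<Rightarrow> bool" where
  "block_jacobi A B \<longleftrightarrow>
     (\<forall>n. invertible (A n)) \<and> (\<forall>n. hermitian (B n)) \<and>
     bounded (range A) \<and> bounded (range B)"

definition ell2 :: "(nat \<Rightarrow> complex^'l) set" where
  "ell2 = {\<psi>. summable (\<lambda>n. (norm (\<psi> n))\<^sup>2)}"

definition jacobi_op ::
  "(nat \<Rightarrow> complex^'l^'l) \<Rightarrow> (nat \<Rightarrow> complex^'l^'l) \<Rightarrow> (nat \<Rightarrow> complex^'l) \<Rightarrow> nat \<Rightarrow> complex^'l" where
  "jacobi_op A B \<psi> n =
     (if n = 0 then 0 else hconj (A (n - 1)) *v \<psi> (n - 1)) + B n *v \<psi> n + A n *v \<psi> (n + 1)"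

text \<open>The upper-left block of the inverse of $\mathcal{J} - E$ on \<open>ell2\<close>. The operator
  $\mathcal{J}$ is bounded and self-adjoint, so the inverse exists for nonreal \<open>E\<close>.\<close>

definition resolvent_block ::
  "(nat \<Rightarrow> complex^'l^'l) \<Rightarrow> (nat \<Rightarrow> complex^'l^'l) \<Rightarrow> complex \<Rightarrow> complex^'l^'l" where
  "resolvent_block A B E =
     (\<chi> i j. inv_into ell2 (\<lambda>\<psi> n. jacobi_op A B \<psi> n - E *s \<psi> n)
               (\<lambda>n. if n = 0 then axis j 1 else 0) 0 $ i)"

definition corresponds ::
  "(nat \<Rightarrow> complex^'l^'l) \<Rightarrow> (nat \<Rightarrow> complex^'l^'l) \<Rightarrow> (complex \<Rightarrow> complex^'l^'l) \<Rightarrow> bool" where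
  "corresponds A B m \<longleftrightarrow>
     block_jacobi A B \<and> (\<forall>E. Im E \<noteq> 0 \<longrightarrow> m E = resolvent_block A B E)"


section \<open>Meromorphic matrix functions\<close>

text \<open>A meromorphic matrix function is given by a total function on the complex plane whose
  values at finitely many points (poles, removable singularities) are arbitrary. Poles,
  residues and \<open>mero_value\<close> depend only on punctured neighbourhoods. \<open>is_pole F a\<close>, i.e. the norm of \<open>F\<close>
  tends to infinity at \<open>a\<close>, says that some entry of \<open>F\<close> has a pole at \<open>a\<close>.\<close>

definition rational_matrix :: "(complex \<Rightarrow> complex^'l^'l) \<Rightarrow> bool" where
  "rational_matrix R \<longleftrightarrow>
     (\<forall>i j. \<exists>p q. q \<noteq> 0 \<and> (\<forall>z. R z $ i $ j = poly p z / poly q z))"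

text \<open>The function \<open>z \<mapsto> - m (z + 1/z)\<close> on the open unit disk is a rational matrix function;
  \<open>R\<close> is this rational function on the whole plane. (Outside the disk \<open>R\<close> is in general not
  given by the same formula.) For nonreal \<open>z\<close> in the disk \<open>z + 1/z\<close> is nonreal, and these \<open>z\<close>
  determine \<open>R\<close>.\<close>

definition is_rational_extension ::
  "(complex \<Rightarrow> complex^'l^'l) \<Rightarrow> (complex \<Rightarrow> complex^'l^'l) \<Rightarrow> bool" where
  "is_rational_extension R m \<longleftrightarrow>
     rational_matrix R \<and> (\<forall>z\<in>ball 0 1. Im z \<noteq> 0 \<longrightarrow> R z = - m (z + inverse z))"

definition sharp :: "(complex \<Rightarrow> complex^'l^'l) \<Rightarrow> complex \<Rightarrow> complex^'l^'l" where
  "sharp F z = hconj (F (inverse (cnj z)))"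

definition at_most_simple_pole :: "(complex \<Rightarrow> complex^'l^'l) \<Rightarrow> complex \<Rightarrow> bool" where
  "at_most_simple_pole F a \<longleftrightarrow>
     (\<forall>i j. is_pole (\<lambda>z. F z $ i $ j) a \<longrightarrow> zorder (\<lambda>z. F z $ i $ j) a = -1)"

definition matrix_residue :: "(complex \<Rightarrow> complex^'l^'l) \<Rightarrow> complex \<Rightarrow> complex^'l^'l" where
  "matrix_residue F a = (\<chi> i j. residue (\<lambda>z. F z $ i $ j) a)"

definition mero_value :: "(complex \<Rightarrow> complex^'l^'l) \<Rightarrow> complex \<Rightarrow> complex^'l^'l" where
  "mero_value F a = Lim (at a) F"

text \<open>\<open>matrix_inv\<close> is unspecified at singular matrices. This is harmless in \<open>jump_inv\<close> when the
  determinant of \<open>R - sharp R\<close> is not identically zero, as it then vanishes at finitely many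
  points only. \<open>jump_nondegenerate\<close> expresses this for a rational \<open>R\<close> by ``infinitely many''
  in order to ignore the points where the values of \<open>R\<close> or \<open>sharp R\<close> are arbitrary.\<close>

definition jump_nondegenerate :: "(complex \<Rightarrow> complex^'l^'l) \<Rightarrow> bool" where
  "jump_nondegenerate R \<longleftrightarrow> infinite {z. det (R z - sharp R z) \<noteq> 0}"

definition jump_inv :: "(complex \<Rightarrow> complex^'l^'l) \<Rightarrow> complex \<Rightarrow> complex^'l^'l" where
  "jump_inv R z = matrix_inv (R z - sharp R z)"

definition cond_B :: "(complex \<Rightarrow> complex^'l^'l) \<Rightarrow> bool" where
  "cond_B R \<longleftrightarrow>
     (\<forall>z\<in>sphere 0 1 - {1, -1}. \<not> is_pole R z) \<and>
     at_most_simple_pole R 1 \<and> at_most_simple_pole R (-1)"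

definition cond_C :: "(complex \<Rightarrow> complex^'l^'l) \<Rightarrow> bool" where
  "cond_C R \<longleftrightarrow>
     jump_nondegenerate R \<and>
     (\<forall>z. z \<notin> {0, 1, -1} \<longrightarrow> \<not> is_pole (jump_inv R) z) \<and>
     at_most_simple_pole (jump_inv R) 1 \<and> at_most_simple_pole (jump_inv R) (-1)"

definition cond_D :: "(complex \<Rightarrow> complex^'l^'l) \<Rightarrow> bool" where
  "cond_D R \<longleftrightarrow>
     (\<forall>w\<in>ball 0 1 - {0}. is_pole R w \<longrightarrow> is_pole R (inverse w) \<longrightarrow>
        matrix_ran (matrix_residue R w) \<subseteq> matrix_ker (mero_value (jump_inv R) (inverse w)) \<and>
        matrix_ran (matrix_residue R w) \<subseteq>
          cperp (matrix_ran (mero_value (\<lambda>z. jump_inv R z ** R z) (inverse w))))"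

end

theory Submission
  imports Defs "HOL-Computational_Algebra.Fundamental_Theorem_Algebra"
begin

text \<open>
  Throughout, \<open>E = z + 1/z\<close>. If the block Jacobi matrix is free from some index on, the Jost solution
  \<open>f\<close> (square summable for \<open>|z| < 1\<close>) is a Laurent polynomial in \<open>z\<close>, and \<open>M = f\<^sub>0 f\<^sub>-\<^sub>1\<^sup>-\<^sup>1\<close>. The Wronskian
  of \<open>f\<close> and its reflection gives \<open>(M - M\<^sup>#)\<^sup>-\<^sup>1 = f\<^sub>-\<^sub>1 f\<^sub>-\<^sub>1\<^sup># / (z - 1/z)\<close>, from which (B), (C) and (D)
  can be read off. That some block Jacobi matrix corresponds to \<open>m\<close> follows by orthonormalizing matrix
  polynomials with respect to the measure.

  Conversely, put \<open>Q = (z - 1/z) (M - M\<^sup>#)\<^sup>-\<^sup>1\<close>. Conditions (B), (C) and (D) imply that \<open>Q\<close>, \<open>Q M\<close>, \<open>M Q\<close> and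
  \<open>M Q M\<^sup>#\<close> have no poles outside the origin; at \<open>1\<close> and \<open>-1\<close> this uses their behaviour under
  \<open>z \<mapsto> 1/z\<close>. The Weyl solution is \<open>psi\<^sub>n = alpha\<^sub>n M + beta\<^sub>n\<close> with polynomials \<open>alpha\<^sub>n\<close> and \<open>beta\<^sub>n\<close> in
  \<open>E\<close>, hence \<open>psi\<^sub>k Q psi\<^sub>j\<^sup>#\<close> has no poles outside the origin either. Since
  \<open>psi\<^sub>n = O(z\<^sup>n\<^sup>+\<^sup>1)\<close> at the origin, Liouville's theorem determines these functions for large \<open>k\<close> and
  \<open>j \<in> {k - 1, k}\<close>, and this gives \<open>psi\<^sub>k\<^sub>+\<^sub>1 = z A\<^sub>k\<^sup>-\<^sup>1 psi\<^sub>k\<close> with \<open>A\<^sub>k\<close> unitary.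
\<close>

section \<open>Complex matrices\<close>

text \<open>The factor z - 1/z is the Wronskian of the free solutions z^n and z^(-n); it also
  cancels the simple poles that (C) allows at 1 and -1. At a pole of M whose reflection is a pole
  too, the first inclusion of (D) makes Q M regular and the second one M Q M^#. Liouville's theorem
  needs data at the origin alone: z -> 1/z changes psi_k Q psi_j^# by z - 1/z times a Wronskian
  built from alpha and beta, so the limit at infinity follows from the one at 0. Q may have a pole
  of order q at the origin; the zeros of the two Weyl solutions absorb it once q < 2 k + 2, which is
  why the matrix is free only from some index on.

  Rational functions carry arbitrary values at finitely many points. Identities are therefore stated
  for all but finitely many z, and regularity means existence of a limit. Integrals against the
  measure are defined by polarization, which hides linearity and positivity; both are recovered from
  Riemann sums with positive semidefinite weights. Self-adjointness of the Jacobi operator enters as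
  a truncated Green identity.\<close>

definition cscale :: "complex \<Rightarrow> complex^'n^'m \<Rightarrow> complex^'n^'m" where
  "cscale c M = (\<chi> i j. c * M $ i $ j)"

lemma cscale_nth [simp]: "cscale c M $ i $ j = c * M $ i $ j"
  by (simp add: cscale_def)

lemma matrix_eqI:
  fixes A B :: "'a^'n^'m"
  shows "(\<And>i j. A $ i $ j = B $ i $ j) \<Longrightarrow> A = B"
  by (simp add: vec_eq_iff)

lemma cscale_mult_left: "cscale c A ** B = cscale c (A ** B)"
  by (rule matrix_eqI) (simp add: matrix_matrix_mult_def sum_distrib_left mult.assoc)

lemma cscale_mult_right: "A ** cscale c B = cscale c (A ** B)"
  by (rule matrix_eqI) (simp add: matrix_matrix_mult_def sum_distrib_left mult_ac)

lemma cscale_cscale [simp]: "cscale a (cscale b M) = cscale (a * b) M"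
  by (rule matrix_eqI) (simp add: mult.assoc)

lemma cscale_1 [simp]: "cscale 1 M = M"
  by (rule matrix_eqI) simp

lemma cscale_0 [simp]: "cscale 0 M = 0"
  by (rule matrix_eqI) simp

lemma cscale_zero_right [simp]: "cscale c 0 = 0"
  by (rule matrix_eqI) simp

lemma cscale_add: "cscale c (A + B) = cscale c A + cscale c B"
  by (rule matrix_eqI) (simp add: algebra_simps)

lemma cscale_diff: "cscale c (A - B) = cscale c A - cscale c B"
  by (rule matrix_eqI) (simp add: algebra_simps)

lemma cscale_minus: "cscale c (- A) = cscale (- c) A"
  by (rule matrix_eqI) simp

lemma cscale_minus_left: "cscale (- c) A = - cscale c A"
  by (rule matrix_eqI) simp

lemma cscale_add_left: "cscale (a + b) A = cscale a A + cscale b A"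
  by (rule matrix_eqI) (simp add: algebra_simps)

lemma cscale_diff_left: "cscale (a - b) A = cscale a A - cscale b A"
  by (rule matrix_eqI) (simp add: algebra_simps)

lemma cscale_eq_0_iff: "cscale c A = 0 \<longleftrightarrow> c = 0 \<or> A = 0"
  by (auto simp: vec_eq_iff)

lemma cscale_mat: "cscale c (mat d) = mat (c * d)"
  by (rule matrix_eqI) (simp add: mat_def)

lemma cscale_sum: "cscale c (\<Sum>k\<in>K. F k) = (\<Sum>k\<in>K. cscale c (F k))"
  by (rule matrix_eqI) (simp add: sum_component sum_distrib_left)

lemma cscale_vec: "cscale c A *v v = c *s (A *v v)"
  by (simp add: vec_eq_iff matrix_vector_mult_def sum_distrib_left mult.assoc)

lemma matrix_sub_ldistrib': "A ** (B - C) = A ** B - A ** (C :: complex^'n^'m)"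
  by (rule matrix_eqI) (simp add: matrix_matrix_mult_def sum_subtractf algebra_simps)

lemma matrix_sub_rdistrib': "(B - C) ** A = B ** A - C ** (A :: complex^'n^'m)"
  by (rule matrix_eqI) (simp add: matrix_matrix_mult_def sum_subtractf algebra_simps)

lemma matrix_add_rdistrib: "(B + C) ** A = B ** A + C ** (A :: complex^'n^'m)"
  by (rule matrix_eqI) (simp add: matrix_matrix_mult_def sum.distrib algebra_simps)

lemma matrix_neg_left: "(- B) ** A = - (B ** (A :: complex^'n^'m))"
  by (rule matrix_eqI) (simp add: matrix_matrix_mult_def sum_negf)

lemma matrix_neg_right: "B ** (- A) = - (B ** (A :: complex^'n^'m))"
  by (rule matrix_eqI) (simp add: matrix_matrix_mult_def sum_negf)

lemma matrix_zero_left [simp]: "0 ** (A :: complex^'n^'m) = 0"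
  by (rule matrix_eqI) (simp add: matrix_matrix_mult_def)

lemma matrix_zero_right [simp]: "(A :: complex^'n^'m) ** 0 = 0"
  by (rule matrix_eqI) (simp add: matrix_matrix_mult_def)

lemma matrix_sum_left: "(\<Sum>k\<in>K. F k) ** (A :: complex^'n^'m) = (\<Sum>k\<in>K. F k ** A)"
  by (induction K rule: infinite_finite_induct) (auto simp: matrix_add_rdistrib)

lemmas matrix_distribs = matrix_add_ldistrib matrix_add_rdistrib matrix_sub_ldistrib'
  matrix_sub_rdistrib' matrix_neg_left matrix_neg_right cscale_mult_left cscale_mult_right
  cscale_add cscale_diff cscale_minus

lemma mult_axis: "(M *v axis j 1) $ i = (M :: complex^'n^'m) $ i $ j"
  by (simp add: matrix_vector_mult_def axis_def if_distrib cong: if_cong)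

lemma mult_vec_sum: "(M :: complex^'n^'m) *v (\<Sum>k\<in>K. f k) = (\<Sum>k\<in>K. M *v f k)"
  by (induction K rule: infinite_finite_induct) (auto simp: matrix_vector_right_distrib)

lemma mat_eq_of_vec: "(\<And>v. A *v v = B *v v) \<Longrightarrow> A = (B :: complex^'n^'m)"
  by (simp add: matrix_eq)

lemma hconj_nth [simp]: "hconj M $ i $ j = cnj (M $ j $ i)"
  by (simp add: hconj_def)

lemma hconj_hconj [simp]: "hconj (hconj M) = M"
  by (rule matrix_eqI) simp

lemma hconj_mult: "hconj (A ** B) = hconj B ** hconj A"
  by (rule matrix_eqI) (simp add: matrix_matrix_mult_def mult.commute)

lemma hconj_add: "hconj (A + B) = hconj A + hconj B"
  by (rule matrix_eqI) simp

lemma hconj_diff: "hconj (A - B) = hconj A - hconj B"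
  by (rule matrix_eqI) simp

lemma hconj_minus: "hconj (- A) = - hconj A"
  by (rule matrix_eqI) simp

lemma hconj_0 [simp]: "hconj 0 = 0"
  by (rule matrix_eqI) simp

lemma hconj_mat [simp]: "hconj (mat c) = mat (cnj c)"
  by (rule matrix_eqI) (auto simp: mat_def)

lemma hconj_cscale: "hconj (cscale c A) = cscale (cnj c) (hconj A)"
  by (rule matrix_eqI) simp

lemma hconj_sum: "hconj (\<Sum>k\<in>K. F k) = (\<Sum>k\<in>K. hconj (F k))"
  by (rule matrix_eqI) (simp add: sum_component)

lemmas hconj_simps = hconj_mult hconj_add hconj_diff hconj_minus hconj_cscale

lemma matrix_inv_mult:
  fixes A :: "complex^'n^'n"
  assumes "invertible A"
  shows "A ** matrix_inv A = mat 1" "matrix_inv A ** A = mat 1"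
  using assms someI_ex[of "\<lambda>A'. A ** A' = mat 1 \<and> A' ** A = mat 1"]
  unfolding invertible_def matrix_inv_def by auto

lemma matrix_inv_unique:
  fixes A :: "complex^'n^'n"
  assumes "B ** A = mat 1"
  shows "matrix_inv A = B"
proof -
  have "invertible A" using assms invertible_left_inverse by blast
  then have "B ** (A ** matrix_inv A) = B" by (simp add: matrix_inv_mult)
  then show ?thesis using assms by (simp add: matrix_mul_assoc)
qed

lemma matrix_mult_1_commute: "A ** B = mat (1::complex) \<Longrightarrow> B ** A = mat 1"
  for A B :: "complex^'n^'n"
  by (simp add: matrix_left_right_inverse)

lemma invertible_hconj: "invertible A \<Longrightarrow> invertible (hconj (A :: complex^'n^'n))"
  unfolding invertible_def by (metis hconj_mult hconj_mat complex_cnj_one)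

lemma not_invertible_vec:
  "\<not> invertible (A :: complex^'n^'n) \<Longrightarrow> \<exists>v. v \<noteq> 0 \<and> A *v v = 0"
  by (metis invertible_left_inverse matrix_left_invertible_ker)

section \<open>The sesquilinear form\<close>

lemma cinner_adjoint: "cinner v (M *v w) = cinner (hconj M *v v) w"
  unfolding cinner_def matrix_vector_mult_def
  by (simp add: sum_distrib_left sum_distrib_right mult_ac) (rule sum.swap)

lemma cinner_commute: "cnj (cinner v w) = cinner w v"
  by (simp add: cinner_def mult.commute)

lemma cinner_add_right: "cinner v (w + u) = cinner v w + cinner v u"
  by (simp add: cinner_def sum.distrib algebra_simps)

lemma cinner_diff_right: "cinner v (w - u) = cinner v w - cinner v u"
  by (simp add: cinner_def sum_subtractf algebra_simps)

lemma cinner_scale_right: "cinner v (c *s w) = c * cinner v w"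
  by (simp add: cinner_def sum_distrib_left mult_ac)

lemma cinner_zero_right [simp]: "cinner v 0 = 0"
  by (simp add: cinner_def)

lemma cinner_zero_left [simp]: "cinner 0 v = 0"
  by (simp add: cinner_def)

lemma cinner_add_left: "cinner (w + u) v = cinner w v + cinner u v"
  by (simp add: cinner_def sum.distrib algebra_simps)

lemma cinner_scale_left: "cinner (c *s w) v = cnj c * cinner w v"
  by (simp add: cinner_def sum_distrib_left mult_ac)

lemma cinner_sum_right: "cinner v (\<Sum>k\<in>K. f k) = (\<Sum>k\<in>K. cinner v (f k))"
  by (induction K rule: infinite_finite_induct) (auto simp: cinner_add_right)

lemma cinner_axis_left: "cinner (axis i 1) w = w $ i"
  by (simp add: cinner_def axis_def if_distrib if_distribR cong: if_cong)

lemma cinner_axis_matrix: "cinner (axis i 1) (M *v axis j 1) = M $ i $ j"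
  by (simp add: cinner_axis_left mult_axis)

lemma cinner_self: "cinner v v = of_real ((norm v)\<^sup>2)"
proof -
  have "(norm v)\<^sup>2 = (\<Sum>i\<in>UNIV. (cmod (v $ i))\<^sup>2)"
    by (simp add: norm_vec_def L2_set_def sum_nonneg)
  then show ?thesis
    by (simp add: cinner_def complex_norm_square mult.commute flip: of_real_power)
qed

lemma cinner_self_eq_0: "cinner v v = 0 \<longleftrightarrow> v = 0"
  by (simp add: cinner_self)

lemma norm_cinner_le: "cmod (cinner v w) \<le> norm v * norm w"
proof -
  have "cmod (cinner v w) \<le> (\<Sum>i\<in>UNIV. \<bar>cmod (v $ i)\<bar> * \<bar>cmod (w $ i)\<bar>)"
    unfolding cinner_def by (rule order_trans[OF norm_sum]) (simp add: norm_mult)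
  also have "\<dots> \<le> norm v * norm w"
    unfolding norm_vec_def by (rule L2_set_mult_ineq)
  finally show ?thesis .
qed

lemma norm_mult_vec_le: "norm (M *v v) \<le> norm (M :: complex^'n^'m) * norm v"
proof -
  have "norm (M *v v) = L2_set (\<lambda>i. cmod ((M *v v) $ i)) UNIV"
    by (simp add: norm_vec_def)
  also have "\<dots> \<le> L2_set (\<lambda>i. norm v * norm (M $ i)) UNIV"
  proof (rule L2_set_mono)
    fix i
    have "(M *v v) $ i = cinner (\<chi> j. cnj (M $ i $ j)) v"
      by (simp add: matrix_vector_mult_def cinner_def)
    then show "cmod ((M *v v) $ i) \<le> norm v * norm (M $ i)"
      using norm_cinner_le[of "\<chi> j. cnj (M $ i $ j)" v]
      by (simp add: norm_vec_def mult.commute)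
  qed auto
  also have "\<dots> = norm v * L2_set (\<lambda>i. norm (M $ i)) UNIV"
    by (simp add: L2_set_right_distrib)
  finally show ?thesis by (simp add: norm_vec_def mult.commute)
qed

lemma norm_entry_le: "cmod (M $ i $ j) \<le> norm (M :: complex^'n^'m)"
  using Finite_Cartesian_Product.norm_nth_le[of M i] Finite_Cartesian_Product.norm_nth_le[of "M $ i" j]
  by linarith

lemma norm_matrix_eq: "norm (A :: complex^'n^'m) = sqrt (\<Sum>i\<in>UNIV. \<Sum>j\<in>UNIV. (cmod (A $ i $ j))\<^sup>2)"
  by (simp add: norm_vec_def L2_set_def sum_nonneg)

lemma norm_hconj: "norm (hconj (M :: complex^'n^'m)) = norm M"
  unfolding norm_matrix_eq hconj_nth complex_mod_cnj by (subst sum.swap) simp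

section \<open>Orthonormalizing a positive definite matrix\<close>

text \<open>Gram-Schmidt for the inner product \<open>cinner v (G *v w)\<close>, by induction over
  the set \<open>K\<close> of columns that are already orthonormal. Injectivity of \<open>S\<close>
  is carried along because it keeps the next vector nonzero before it is normalized.\<close>

lemma positive_definite_partial_normalizer:
  fixes G :: "complex^'n^'n" and K :: "'n set"
  assumes herm: "hermitian G" and pos: "\<And>v. v \<noteq> 0 \<Longrightarrow> 0 < Re (cinner v (G *v v))" and "finite K"
  shows "\<exists>S. (\<forall>v. S *v v = 0 \<longrightarrow> v = 0) \<and>
    (\<forall>i\<in>K. \<forall>j\<in>K. cinner (S *v axis i 1) (G *v (S *v axis j 1)) = (if i = j then 1 else 0))"
  using \<open>finite K\<close>
proof (induction K rule: finite_induct)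
  case empty
  show ?case by (intro exI[of _ "mat 1"]) auto
next
  case (insert k K)
  then obtain S where S: "\<And>v. S *v v = 0 \<Longrightarrow> v = 0"
    and ortho: "\<And>i j. i \<in> K \<Longrightarrow> j \<in> K \<Longrightarrow>
      cinner (S *v axis i 1) (G *v (S *v axis j 1)) = (if i = j then 1 else 0)" by blast
  define g where "g v w = cinner v (G *v w)" for v w
  define s where "s j = S *v axis j 1" for j
  have gsym: "g w v = cnj (g v w)" for v w
    unfolding g_def cinner_commute cinner_adjoint[of w] using herm by (simp add: hermitian_def)
  have gs: "g (s i) (s j) = (if i = j then 1 else 0)" if "i \<in> K" "j \<in> K" for i j
    using ortho[OF that] by (simp add: g_def s_def)
  \<comment> \<open>The projection is subtracted in coordinates, before \<open>S\<close> is applied: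
    \<open>x $ k = 1\<close> then shows both that \<open>u\<close> is nonzero and that
    \<open>E\<close> below is injective.\<close>
  define x where "x = axis k 1 - (\<Sum>i\<in>K. g (s i) (s k) *s axis i (1::complex))"
  define u where "u = S *v x"
  have xk: "x $ k = 1"
    using insert.hyps by (simp add: x_def axis_def sum_component)
      (rule sum.neutral, auto)
  then have "u \<noteq> 0" using S[of x] zero_neq_one unfolding u_def by (metis zero_index)
  have u: "u = s k - (\<Sum>i\<in>K. g (s i) (s k) *s s i)"
    unfolding u_def x_def s_def
    by (simp add: matrix_vector_mult_diff_distrib mult_vec_sum vector_scalar_commute)
  define r where "r = Re (g u u)"
  have "r > 0" unfolding r_def g_def by (rule pos) fact
  have "g u u \<in> \<real>" using gsym[of u u] by (simp add: Reals_cnj_iff)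
  then have guu: "g u u = of_real r" unfolding r_def by simp
  have gsu: "g (s i) u = 0" if "i \<in> K" for i
  proof -
    have "g (s i) u = g (s i) (s k) - (\<Sum>j\<in>K. g (s j) (s k) * g (s i) (s j))"
      unfolding u g_def
      by (simp add: matrix_vector_mult_diff_distrib mult_vec_sum
          vector_scalar_commute cinner_diff_right cinner_sum_right cinner_scale_right)
    also have "(\<Sum>j\<in>K. g (s j) (s k) * g (s i) (s j)) = g (s i) (s k)"
      using that \<open>finite K\<close> by (simp add: gs if_distrib cong: if_cong)
    finally show ?thesis by simp
  qed
  define q where "q = complex_of_real (1 / sqrt r)"
  have q: "q \<noteq> 0" "cnj q * (q * of_real r) = 1"
  proof -
    have "1 / sqrt r * (1 / sqrt r * r) = 1" using \<open>r > 0\<close> by (simp add: field_simps)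
    then show "cnj q * (q * of_real r) = 1"
      unfolding q_def complex_cnj_complex_of_real by (metis of_real_1 of_real_mult)
  qed (use \<open>r > 0\<close> in \<open>simp add: q_def\<close>)
  \<comment> \<open>Elementary matrix that puts the normalized \<open>x\<close> into column
    \<open>k\<close> and fixes every other column, so the columns of \<open>S\<close> indexed by
    \<open>K\<close> survive in \<open>S ** E\<close>.\<close>
  define E where "E = (\<chi> i j. if j = k then q * x $ i else (if i = j then 1 else 0))"
  have Ej: "E *v axis j 1 = axis j 1" if "j \<noteq> k" for j
    unfolding vec_eq_iff mult_axis using that by (auto simp: E_def axis_def)
  have Ek: "E *v axis k 1 = q *s x"
    unfolding vec_eq_iff mult_axis by (simp add: E_def)
  have SEj: "(S ** E) *v axis j 1 = s j" if "j \<noteq> k" for j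
    using that by (simp add: Ej s_def flip: matrix_vector_mul_assoc)
  have SEk: "(S ** E) *v axis k 1 = q *s u"
    by (simp add: Ek u_def vector_scalar_commute flip: matrix_vector_mul_assoc)
  have inj: "v = 0" if "(S ** E) *v v = 0" for v
  proof -
    have "S *v (E *v v) = 0" using that by (simp only: matrix_vector_mul_assoc)
    then have Ev: "E *v v = 0" by (rule S)
    have comp: "(E *v v) $ i = q * x $ i * v $ k + (if i = k then 0 else v $ i)" for i
    proof -
      have "(E *v v) $ i = (\<Sum>j\<in>UNIV. (if j = k then q * x $ i * v $ k else 0)
              + (if j = i then (if i = k then 0 else v $ i) else 0))"
        unfolding matrix_vector_mult_def E_def vec_lambda_beta by (rule sum.cong) auto
      also have "\<dots> = q * x $ i * v $ k + (if i = k then 0 else v $ i)"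
        by (simp only: sum.distrib sum.delta finite UNIV_I if_True)
      finally show ?thesis .
    qed
    have "v $ k = 0" using comp[of k] Ev q(1) xk by simp
    then have "v $ i = 0" for i using comp[of i] Ev by (auto split: if_splits)
    then show ?thesis by (simp add: vec_eq_iff)
  qed
  have orth: "g ((S ** E) *v axis i 1) ((S ** E) *v axis j 1) = (if i = j then 1 else 0)"
    if ij: "i \<in> insert k K" "j \<in> insert k K" for i j
  proof -
    have qq: "g (q *s u) (q *s u) = 1"
      using q(2) guu unfolding g_def
      by (simp add: vector_scalar_commute cinner_scale_left cinner_scale_right mult_ac)
    have qr: "g (s i) (q *s u) = 0" if "i \<in> K"
      using gsu[OF that] unfolding g_def
      by (simp add: vector_scalar_commute cinner_scale_right)
    have ql: "g (q *s u) (s j) = 0" if "j \<in> K"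
      using gsu[OF that] gsym[of "s j" u] unfolding g_def
      by (simp add: cinner_scale_left)
    consider "i = k" "j = k" | "i = k" "j \<in> K" "j \<noteq> k" | "i \<in> K" "i \<noteq> k" "j = k"
      | "i \<in> K" "i \<noteq> k" "j \<in> K" "j \<noteq> k"
      using ij by blast
    then show ?thesis
    proof cases
      case 1
      then show ?thesis unfolding 1 SEk qq by simp
    next
      case 2
      then show ?thesis unfolding 2(1) SEk SEj[OF 2(3)] ql[OF 2(2)] by simp
    next
      case 3
      then show ?thesis unfolding 3(3) SEk SEj[OF 3(2)] qr[OF 3(1)] by simp
    next
      case 4
      then show ?thesis unfolding SEj[OF 4(2)] SEj[OF 4(4)] gs[OF 4(1,3)] by simp
    qed
  qed
  show ?case
  proof (rule exI[of _ "S ** E"], rule conjI)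
    show "\<forall>v. (S ** E) *v v = 0 \<longrightarrow> v = 0"
      by (rule allI, rule impI, rule inj)
    show "\<forall>i\<in>insert k K. \<forall>j\<in>insert k K. cinner ((S ** E) *v axis i 1)
        (G *v ((S ** E) *v axis j 1)) = (if i = j then 1 else 0)"
      using orth unfolding g_def by (intro ballI)
  qed
qed

lemma positive_definite_normalizer:
  fixes G :: "complex^'n^'n"
  assumes "hermitian G" and "\<And>v. v \<noteq> 0 \<Longrightarrow> 0 < Re (cinner v (G *v v))"
  shows "\<exists>S :: complex^'n^'n. hconj S ** G ** S = mat 1"
proof -
  have "\<exists>S :: complex^'n^'n. (\<forall>v. S *v v = 0 \<longrightarrow> v = 0) \<and>
    (\<forall>i\<in>UNIV. \<forall>j\<in>UNIV. cinner (S *v axis i 1) (G *v (S *v axis j 1)) = (if i = j then 1 else 0))"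
    by (rule positive_definite_partial_normalizer) (use assms in auto)
  then obtain S :: "complex^'n^'n"
    where S: "\<And>i j. cinner (S *v axis i 1) (G *v (S *v axis j 1)) = (if i = j then 1 else 0)"
    by auto
  have "(hconj S ** G ** S) $ i $ j = (if i = j then 1 else 0)" for i j
  proof -
    have "(hconj S ** G ** S) $ i $ j = cinner (axis i 1) (hconj S *v (G *v (S *v axis j 1)))"
      by (simp add: matrix_vector_mul_assoc matrix_mul_assoc flip: cinner_axis_matrix)
    also have "\<dots> = (if i = j then 1 else 0)"
      unfolding cinner_adjoint[of _ "hconj S"] using S[of i j] by simp
    finally show ?thesis .
  qed
  then show ?thesis by (intro exI[of _ S] matrix_eqI) (simp add: mat_def)
qed

section \<open>Rational functions up to finitely many values\<close>

text \<open>Equality is asked for off a finite set only: values at poles are arbitrary, and the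
  class becomes closed under inversion and under z -> 1/z without side conditions.\<close>

definition ratfun :: "(complex \<Rightarrow> complex) \<Rightarrow> bool" where
  "ratfun f \<longleftrightarrow> (\<exists>p q. q \<noteq> 0 \<and> (\<forall>\<^sub>F z in cofinite. f z = poly p z / poly q z))"

text \<open>Identities are collected for all but finitely many points; this brings them into a
  punctured neighbourhood, where limits are taken.\<close>

lemma eventually_cofinite_at:
  fixes a :: "'a::t1_space"
  assumes "\<forall>\<^sub>F z in cofinite. P z"
  shows "\<forall>\<^sub>F z in at a. P z"
proof -
  have "finite ({z. \<not> P z} - {a})" using assms by (simp add: eventually_cofinite)
  then have "open (- ({z. \<not> P z} - {a}))" by (intro open_Compl finite_imp_closed)
  then show ?thesis unfolding eventually_at_topological
    by (intro exI[of _ "- ({z. \<not> P z} - {a})"]) auto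
qed

lemma tendsto_eventually_eq:
  assumes "(f \<longlongrightarrow> L) F" "\<forall>\<^sub>F z in F. g z = f z"
  shows "(g \<longlongrightarrow> L) F"
  using assms(1) tendsto_cong[OF assms(2)] by simp

lemma tendsto_eventually_eq':
  assumes "(f \<longlongrightarrow> L) F" "\<forall>\<^sub>F z in F. f z = g z"
  shows "(g \<longlongrightarrow> L) F"
  using assms(1) tendsto_cong[OF assms(2)] by simp

lemma eventually_neq_cofinite: "\<forall>\<^sub>F z in cofinite. z \<noteq> a"
  by (simp add: eventually_cofinite)

lemma eventually_poly_nonzero: "q \<noteq> 0 \<Longrightarrow> \<forall>\<^sub>F z in cofinite. poly q (z :: complex) \<noteq> 0"
  by (simp add: eventually_cofinite poly_roots_finite)

text \<open>Covers \<open>inverse\<close> too, which is an involution of the whole plane because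
  \<open>inverse 0 = 0\<close>.\<close>

lemma eventually_cofinite_involution:
  assumes "\<forall>\<^sub>F z in cofinite. P z" and "\<And>z. g (g z) = z"
  shows "\<forall>\<^sub>F z in cofinite. P (g z)"
proof -
  have "{z. \<not> P (g z)} \<subseteq> g ` {z. \<not> P z}"
    using assms(2) by (metis (mono_tags, lifting) image_iff mem_Collect_eq subsetI)
  then show ?thesis using assms(1) unfolding eventually_cofinite
    by (meson finite_imageI finite_subset)
qed

lemmas eventually_cofinite_inverse =
  eventually_cofinite_involution[where g = "inverse :: complex \<Rightarrow> complex", simplified]
lemmas eventually_cofinite_cnj = eventually_cofinite_involution[where g = cnj, simplified]

lemma ratfun_cong:
  assumes "ratfun f" "\<forall>\<^sub>F z in cofinite. f z = g z"
  shows "ratfun g"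
proof -
  obtain p q where "q \<noteq> 0" and f: "\<forall>\<^sub>F z in cofinite. f z = poly p z / poly q z"
    using assms(1) unfolding ratfun_def by blast
  have "\<forall>\<^sub>F z in cofinite. g z = poly p z / poly q z"
    using f assms(2) by eventually_elim simp
  then show ?thesis unfolding ratfun_def using \<open>q \<noteq> 0\<close> by blast
qed

lemma ratfun_poly_quotient: "q \<noteq> 0 \<Longrightarrow> ratfun (\<lambda>z. poly p z / poly q z)"
  unfolding ratfun_def by (intro exI[of _ p] exI[of _ q]) simp

lemma ratfun_const [intro, simp]: "ratfun (\<lambda>_. c)"
  using ratfun_poly_quotient[of 1 "[:c:]"] by simp

lemma ratfun_id [intro, simp]: "ratfun (\<lambda>z. z)"
  using ratfun_poly_quotient[of 1 "[:0, 1:]"] by simp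

lemma ratfun_add [intro]:
  assumes "ratfun f" "ratfun g" shows "ratfun (\<lambda>z. f z + g z)"
proof -
  obtain p q where pq: "q \<noteq> 0" "\<forall>\<^sub>F z in cofinite. f z = poly p z / poly q z"
    using assms(1) unfolding ratfun_def by blast
  obtain r s where rs: "s \<noteq> 0" "\<forall>\<^sub>F z in cofinite. g z = poly r z / poly s z"
    using assms(2) unfolding ratfun_def by blast
  have "\<forall>\<^sub>F z in cofinite. f z + g z = poly (p * s + r * q) z / poly (q * s) z"
    using pq(2) rs(2) eventually_poly_nonzero[OF pq(1)] eventually_poly_nonzero[OF rs(1)]
    by eventually_elim (simp add: field_simps)
  then show ?thesis unfolding ratfun_def using pq(1) rs(1)
    by (intro exI[of _ "p * s + r * q"] exI[of _ "q * s"]) simp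
qed

lemma ratfun_mult [intro]:
  assumes "ratfun f" "ratfun g" shows "ratfun (\<lambda>z. f z * g z)"
proof -
  obtain p q where pq: "q \<noteq> 0" "\<forall>\<^sub>F z in cofinite. f z = poly p z / poly q z"
    using assms(1) unfolding ratfun_def by blast
  obtain r s where rs: "s \<noteq> 0" "\<forall>\<^sub>F z in cofinite. g z = poly r z / poly s z"
    using assms(2) unfolding ratfun_def by blast
  have "\<forall>\<^sub>F z in cofinite. f z * g z = poly (p * r) z / poly (q * s) z"
    using pq(2) rs(2) by eventually_elim simp
  then show ?thesis unfolding ratfun_def using pq(1) rs(1)
    by (intro exI[of _ "p * r"] exI[of _ "q * s"]) simp
qed

lemma ratfun_inverse [intro]:
  assumes "ratfun f" shows "ratfun (\<lambda>z. inverse (f z))"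
proof -
  obtain p q where pq: "q \<noteq> 0" "\<forall>\<^sub>F z in cofinite. f z = poly p z / poly q z"
    using assms(1) unfolding ratfun_def by blast
  have "\<forall>\<^sub>F z in cofinite. inverse (f z) = poly q z / poly p z"
    using pq(2) by eventually_elim simp
  \<comment> \<open>If \<open>p = 0\<close>, division by zero makes the quotient the zero
    function.\<close>
  moreover have "ratfun (\<lambda>z. poly q z / poly p z)"
    by (cases "p = 0") (auto intro: ratfun_poly_quotient)
  ultimately show ?thesis by (rule_tac ratfun_cong) (auto elim: eventually_mono)
qed

lemma ratfun_minus [intro]: "ratfun f \<Longrightarrow> ratfun (\<lambda>z. - f z)"
  using ratfun_mult[of "\<lambda>_. -1" f] by simp

lemma ratfun_diff [intro]: "ratfun f \<Longrightarrow> ratfun g \<Longrightarrow> ratfun (\<lambda>z. f z - g z)"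
  using ratfun_add[of f "\<lambda>z. - g z"] by auto

lemma ratfun_divide [intro]: "ratfun f \<Longrightarrow> ratfun g \<Longrightarrow> ratfun (\<lambda>z. f z / g z)"
  using ratfun_mult[of f "\<lambda>z. inverse (g z)"] by (auto simp: divide_inverse)

lemma ratfun_power [intro]: "ratfun f \<Longrightarrow> ratfun (\<lambda>z. f z ^ n)"
  by (induction n) auto

lemma ratfun_sum [intro]: "(\<And>i. i \<in> I \<Longrightarrow> ratfun (f i)) \<Longrightarrow> ratfun (\<lambda>z. \<Sum>i\<in>I. f i z)"
  by (induction I rule: infinite_finite_induct) auto

lemma ratfun_prod [intro]: "(\<And>i. i \<in> I \<Longrightarrow> ratfun (f i)) \<Longrightarrow> ratfun (\<lambda>z. \<Prod>i\<in>I. f i z)"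
  by (induction I rule: infinite_finite_induct) auto

lemma ratfun_compose_inverse:
  assumes "ratfun f" shows "ratfun (\<lambda>z. f (inverse z))"
proof -
  have poly: "ratfun (\<lambda>z. poly p (inverse z))" for p
    by (induction p) (auto intro!: ratfun_add ratfun_mult ratfun_inverse)
  obtain p q where pq: "q \<noteq> 0" "\<forall>\<^sub>F z in cofinite. f z = poly p z / poly q z"
    using assms(1) unfolding ratfun_def by blast
  have "\<forall>\<^sub>F z in cofinite. poly p (inverse z) / poly q (inverse z) = f (inverse z)"
    using eventually_cofinite_inverse[OF pq(2)] by eventually_elim simp
  then show ?thesis by (rule ratfun_cong[OF ratfun_divide[OF poly poly]])
qed

lemma ratfun_compose_cnj:
  assumes "ratfun f" shows "ratfun (\<lambda>z. cnj (f (cnj z)))"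
proof -
  have poly: "ratfun (\<lambda>z. cnj (poly p (cnj z)))" for p
    by (induction p) (auto intro!: ratfun_add ratfun_mult ratfun_inverse)
  obtain p q where pq: "q \<noteq> 0" "\<forall>\<^sub>F z in cofinite. f z = poly p z / poly q z"
    using assms(1) unfolding ratfun_def by blast
  have "\<forall>\<^sub>F z in cofinite. cnj (poly p (cnj z)) / cnj (poly q (cnj z)) = cnj (f (cnj z))"
    using eventually_cofinite_cnj[OF pq(2)] by eventually_elim simp
  then show ?thesis by (rule ratfun_cong[OF ratfun_divide[OF poly poly]])
qed

text \<open>Take a denominator of least degree: a common zero of numerator and denominator would
  split off a linear factor from both and lower that degree.\<close>

lemma ratfun_reduced:
  assumes "ratfun f"
  shows "\<exists>p q. q \<noteq> 0 \<and> (\<forall>\<^sub>F z in cofinite. f z = poly p z / poly q z) \<and>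
    (\<forall>a. poly q a = 0 \<longrightarrow> poly p a \<noteq> 0)"
proof -
  define Q where "Q n \<longleftrightarrow> (\<exists>p q. q \<noteq> 0 \<and> degree q = n \<and>
    (\<forall>\<^sub>F z in cofinite. f z = poly p z / poly q z))" for n
  have "\<exists>n. Q n" using assms unfolding ratfun_def Q_def by blast
  then have least: "Q (Least Q)" by (meson LeastI_ex)
  then obtain p q where pq: "q \<noteq> 0" "degree q = Least Q"
    "\<forall>\<^sub>F z in cofinite. f z = poly p z / poly q z" unfolding Q_def by blast
  have "poly p a \<noteq> 0" if qa: "poly q a = 0" for a
  proof
    assume "poly p a = 0"
    then obtain p' q' where p': "p = [:-a, 1:] * p'" and q': "q = [:-a, 1:] * q'"
      using qa unfolding poly_eq_0_iff_dvd dvd_def by blast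
    have "q' \<noteq> 0" using q' pq(1) by auto
    then have "degree q' < degree q" unfolding q' by (subst degree_mult_eq) auto
    have "poly p z / poly q z = poly p' z / poly q' z" if "z \<noteq> a" for z
    proof -
      have "poly p z = (z - a) * poly p' z" "poly q z = (z - a) * poly q' z"
        by (simp_all add: p' q' algebra_simps)
      then show ?thesis using that by simp
    qed
    note quot = this
    have "\<forall>\<^sub>F z in cofinite. f z = poly p' z / poly q' z"
      using pq(3) eventually_neq_cofinite[of a] by eventually_elim (simp add: quot)
    then have "Q (degree q')" unfolding Q_def using \<open>q' \<noteq> 0\<close> by blast
    then show False using \<open>degree q' < degree q\<close> pq(2) not_less_Least by metis
  qed
  then show ?thesis using pq by blast
qed

text \<open>In lowest terms either the denominator does not vanish at \<open>a\<close>, or it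
  vanishes while the numerator does not. This excludes essential singularities.\<close>

lemma ratfun_tendsto_or_pole:
  assumes "ratfun f"
  shows "(\<exists>L. (f \<longlongrightarrow> L) (at a)) \<or> is_pole f a"
proof -
  obtain p q where pq: "q \<noteq> 0" "\<forall>\<^sub>F z in cofinite. f z = poly p z / poly q z"
    "\<And>a. poly q a = 0 \<Longrightarrow> poly p a \<noteq> 0" using ratfun_reduced[OF assms] by blast
  have ev: "\<forall>\<^sub>F z in at a. f z = poly p z / poly q z" using pq(2) by (rule eventually_cofinite_at)
  have p: "(poly p \<longlongrightarrow> poly p a) (at a)" and q: "(poly q \<longlongrightarrow> poly q a) (at a)"
    using poly_isCont unfolding isCont_def by blast+
  show ?thesis
  proof (cases "poly q a = 0")
    case False
    then have "((\<lambda>z. poly p z / poly q z) \<longlongrightarrow> poly p a / poly q a) (at a)"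
      by (intro tendsto_divide p q)
    then show ?thesis using tendsto_cong[OF ev] by blast
  next
    case True
    have "filterlim (poly q) (at 0) (at a)"
      unfolding filterlim_at using q True eventually_cofinite_at[OF eventually_poly_nonzero[OF pq(1)]]
      by auto
    then have "filterlim (\<lambda>z. poly p z / poly q z) at_infinity (at a)"
      using p pq(3)[OF True] by (intro filterlim_divide_at_infinity) auto
    then show ?thesis unfolding is_pole_def using filterlim_cong[OF refl refl ev] by blast
  qed
qed

lemma not_tendsto_pole: "is_pole f a \<Longrightarrow> \<not> (f \<longlongrightarrow> L) (at (a::complex))"
  using not_tendsto_and_filterlim_at_infinity[of "at a" f L] unfolding is_pole_def by auto

text \<open>Identity theorem: \<open>frequently\<close> along \<open>cofinite\<close> means
  infinitely many zeros, and these force the numerator to be the zero polynomial.\<close>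

lemma ratfun_eventually_0:
  assumes "ratfun f" "\<exists>\<^sub>F z in cofinite. f z = 0"
  shows "\<forall>\<^sub>F z in cofinite. f z = 0"
proof -
  obtain p q where pq: "q \<noteq> 0" "\<forall>\<^sub>F z in cofinite. f z = poly p z / poly q z"
    using assms(1) unfolding ratfun_def by blast
  have "p = 0"
  proof (rule ccontr)
    assume "p \<noteq> 0"
    have "\<forall>\<^sub>F z in cofinite. f z \<noteq> 0"
      using pq(2) eventually_poly_nonzero[OF pq(1)] eventually_poly_nonzero[OF \<open>p \<noteq> 0\<close>]
      by eventually_elim simp
    then show False using assms(2) by (simp add: frequently_def)
  qed
  then show ?thesis using pq(2) by simp
qed

text \<open>Since \<open>f - L\<close> tends to 0, its reduced numerator vanishes at
  \<open>a\<close> and its denominator does not, so a linear factor can be divided out. This is what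
  makes a singularity with vanishing residue removable.\<close>

lemma ratfun_difference_quotient:
  assumes "ratfun f" "(f \<longlongrightarrow> L) (at a)"
  shows "\<exists>K. ((\<lambda>z. (f z - L) / (z - a)) \<longlongrightarrow> K) (at a)"
proof -
  obtain p q where pq: "q \<noteq> 0" "\<forall>\<^sub>F z in cofinite. f z - L = poly p z / poly q z"
    "\<And>a. poly q a = 0 \<Longrightarrow> poly p a \<noteq> 0"
    using ratfun_reduced[OF ratfun_diff[OF assms(1) ratfun_const[of L]]] by blast
  have ev: "\<forall>\<^sub>F z in at a. f z - L = poly p z / poly q z" using pq(2) by (rule eventually_cofinite_at)
  have p: "(poly p \<longlongrightarrow> poly p a) (at a)" and q: "(poly q \<longlongrightarrow> poly q a) (at a)" for p q
    using poly_isCont unfolding isCont_def by blast+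
  have "((\<lambda>z. f z - L) \<longlongrightarrow> L - L) (at a)" by (intro tendsto_intros assms)
  then have lim: "((\<lambda>z. poly p z / poly q z) \<longlongrightarrow> 0) (at a)" using tendsto_cong[OF ev] by simp
  have "((\<lambda>z. poly p z / poly q z * poly q z) \<longlongrightarrow> 0 * poly q a) (at a)"
    by (intro tendsto_mult lim q)
  moreover have "\<forall>\<^sub>F z in at a. poly p z / poly q z * poly q z = poly p z"
    using eventually_cofinite_at[OF eventually_poly_nonzero[OF pq(1)]] by eventually_elim simp
  ultimately have "(poly p \<longlongrightarrow> 0 * poly q a) (at a)" by (rule tendsto_eventually_eq')
  then have "(poly p \<longlongrightarrow> 0) (at a)" by simp
  then have pa: "poly p a = 0" using tendsto_unique[OF _ p] by auto
  then have qa: "poly q a \<noteq> 0" using pq(3) by blast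
  obtain p' where p': "p = [:-a, 1:] * p'" using pa unfolding poly_eq_0_iff_dvd dvd_def by blast
  have "((\<lambda>z. poly p' z / poly q z) \<longlongrightarrow> poly p' a / poly q a) (at a)"
    by (intro tendsto_divide p q qa)
  note lim' = this
  have pz: "poly p z = (z - a) * poly p' z" for z by (simp add: p' algebra_simps)
  have ev': "\<forall>\<^sub>F z in at a. (f z - L) / (z - a) = poly p' z / poly q z"
    using ev eventually_neq_at_within[of a]
  proof eventually_elim
    case (elim z)
    show ?case unfolding elim(1) pz using elim(2) by simp
  qed
  show ?thesis using tendsto_cong[OF ev'] lim' by blast
qed

text \<open>The exponent is the multiplicity of \<open>a\<close> as a root of the denominator; it
  may exceed the order of the pole if the fraction is not reduced.\<close>

lemma ratfun_power_mult_tendsto: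
  assumes "ratfun f"
  shows "\<exists>k L. ((\<lambda>z. (z - a) ^ k * f z) \<longlongrightarrow> L) (at a)"
proof -
  obtain p q where pq: "q \<noteq> 0" "\<forall>\<^sub>F z in cofinite. f z = poly p z / poly q z"
    using assms unfolding ratfun_def by blast
  obtain r where r: "q = [:-a, 1:] ^ order a q * r" and nd: "\<not> [:-a, 1:] dvd r"
    using order_decomp[OF pq(1)] by blast
  define k where "k = order a q"
  have ra: "poly r a \<noteq> 0" using nd poly_eq_0_iff_dvd by blast
  have q: "poly q z = (z - a) ^ k * poly r z" for z
    by (subst r) (simp add: k_def poly_power)
  have lim: "(poly p \<longlongrightarrow> poly p a) (at a)" for p using poly_isCont unfolding isCont_def by blast
  have "((\<lambda>z. poly p z / poly r z) \<longlongrightarrow> poly p a / poly r a) (at a)"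
    by (intro tendsto_divide lim ra)
  moreover have "\<forall>\<^sub>F z in at a. (z - a) ^ k * f z = poly p z / poly r z"
    using eventually_cofinite_at[OF pq(2)] eventually_neq_at_within[of a]
    by eventually_elim (simp add: q)
  ultimately show ?thesis by (blast intro: tendsto_eventually_eq)
qed

lemma ratfun_holomorphic_punctured:
  assumes "ratfun f"
  obtains r where "r > 0" "f holomorphic_on (ball a r - {a})"
proof -
  obtain p q where pq: "q \<noteq> 0" "\<forall>\<^sub>F z in cofinite. f z = poly p z / poly q z"
    using assms unfolding ratfun_def by blast
  have "\<forall>\<^sub>F z in at a. f z = poly p z / poly q z \<and> poly q z \<noteq> 0"
    using eventually_cofinite_at[OF pq(2)]
      eventually_cofinite_at[OF eventually_poly_nonzero[OF pq(1)]] by eventually_elim simp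
  then obtain r where r: "r > 0"
    "\<And>z. z \<noteq> a \<Longrightarrow> dist z a < r \<Longrightarrow> f z = poly p z / poly q z \<and> poly q z \<noteq> 0"
    unfolding eventually_at by blast
  have "(\<lambda>z. poly p z / poly q z) holomorphic_on (ball a r - {a})"
    using r(2) by (intro holomorphic_intros) (auto simp: dist_commute)
  then have "f holomorphic_on (ball a r - {a})"
    by (rule holomorphic_transform) (use r(2) in \<open>auto simp: dist_commute\<close>)
  then show ?thesis using r(1) that by blast
qed

text \<open>Replaces the condition on \<open>zorder\<close> by the existence of a limit, which
  passes through sums and products of matrix functions.\<close>

lemma ratfun_simple_pole_iff:
  assumes "ratfun f"
  shows "(is_pole f a \<longrightarrow> zorder f a = -1) \<longleftrightarrow> (\<exists>L. ((\<lambda>z. (z - a) * f z) \<longlongrightarrow> L) (at a))"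
proof -
  obtain r where r: "r > 0" "f holomorphic_on (ball a r - {a})"
    using ratfun_holomorphic_punctured[OF assms] .
  show ?thesis
  proof
    assume order: "is_pole f a \<longrightarrow> zorder f a = -1"
    show "\<exists>L. ((\<lambda>z. (z - a) * f z) \<longlongrightarrow> L) (at a)"
    proof (cases "is_pole f a")
      case True
      with order have "zorder f a = -1" by blast
      obtain s where s: "0 < s" "zor_poly f a holomorphic_on cball a s"
        "\<forall>w\<in>cball a s - {a}. f w = zor_poly f a w / (w - a) ^ nat (- zorder f a) \<and> zor_poly f a w \<noteq> 0"
        using zorder_exist_pole[OF r(2) open_ball _ True] \<open>r > 0\<close> by (metis centre_in_ball)
      have "zor_poly f a holomorphic_on ball a s"
        using s(2) ball_subset_cball by (rule holomorphic_on_subset)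
      then have "continuous_on (ball a s) (zor_poly f a)" by (rule holomorphic_on_imp_continuous_on)
      then have "isCont (zor_poly f a) a"
        using s(1) by (simp add: continuous_on_eq_continuous_at)
      then have "(zor_poly f a \<longlongrightarrow> zor_poly f a a) (at a)" by (simp add: isCont_def)
      moreover have "\<forall>\<^sub>F z in at a. (z - a) * f z = zor_poly f a z"
        unfolding eventually_at using s \<open>zorder f a = -1\<close>
        by (intro exI[of _ s]) (auto simp: dist_commute)
      ultimately show ?thesis by (blast intro: tendsto_eventually_eq)
    next
      case False
      then obtain L where "(f \<longlongrightarrow> L) (at a)" using ratfun_tendsto_or_pole[OF assms] by blast
      then have "((\<lambda>z. (z - a) * f z) \<longlongrightarrow> (a - a) * L) (at a)" by (intro tendsto_intros)
      then show ?thesis by blast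
    qed
  next
    assume "\<exists>L. ((\<lambda>z. (z - a) * f z) \<longlongrightarrow> L) (at a)"
    then obtain L where L: "((\<lambda>z. (z - a) * f z) \<longlongrightarrow> L) (at a)" by blast
    show "is_pole f a \<longrightarrow> zorder f a = -1"
    proof
      assume pole: "is_pole f a"
      \<comment> \<open>A zero limit would make \<open>f\<close> itself converge, against the pole.
        So \<open>L\<close> is the nonzero value at \<open>a\<close> that \<open>zorder_eqI\<close>
        asks for.\<close>
      have "L \<noteq> 0"
      proof
        assume "L = 0"
        have "ratfun (\<lambda>z. (z - a) * f z)"
          by (intro ratfun_mult ratfun_diff ratfun_id ratfun_const assms)
        then obtain K where "((\<lambda>z. ((z - a) * f z - 0) / (z - a)) \<longlongrightarrow> K) (at a)"
          using ratfun_difference_quotient L \<open>L = 0\<close> by blast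
        moreover have "\<forall>\<^sub>F z in at a. ((z - a) * f z - 0) / (z - a) = f z"
          using eventually_neq_at_within[of a] by eventually_elim simp
        ultimately have "(f \<longlongrightarrow> K) (at a)" by (rule tendsto_eventually_eq')
        then show False using pole not_tendsto_pole by blast
      qed
      define g where "g z = (if z = a then L else (z - a) * f z)" for z
      have "g holomorphic_on ball a r"
      proof (rule no_isolated_singularity'[of "{a}"])
        show "(g \<longlongrightarrow> g z) (at z within ball a r)" if "z \<in> {a}" for z
        proof -
          have "\<forall>\<^sub>F z in at a. (z - a) * f z = g z"
            using eventually_neq_at_within[of a] by eventually_elim (simp add: g_def)
          then have "(g \<longlongrightarrow> L) (at a)" by (rule tendsto_eventually_eq'[OF L])
          then show ?thesis using that by (auto simp: g_def intro: tendsto_within_subset)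
        qed
        have "(\<lambda>z. (z - a) * f z) holomorphic_on (ball a r - {a})"
          by (intro holomorphic_intros r)
        then show "g holomorphic_on (ball a r - {a})"
          by (rule holomorphic_transform) (simp add: g_def)
      qed auto
      then show "zorder f a = -1"
        using r(1) \<open>L \<noteq> 0\<close>
        by (intro zorder_eqI[of "ball a r" a g]) (auto simp: g_def power_int_minus field_simps)
    qed
  qed
qed

lemma ratfun_residue:
  assumes "ratfun f" "((\<lambda>z. (z - a) * f z) \<longlongrightarrow> L) (at a)"
  shows "residue f a = L"
proof -
  obtain r where r: "r > 0" "f holomorphic_on (ball a r - {a})"
    using ratfun_holomorphic_punctured[OF assms(1)] .
  then show ?thesis using assms(2)
    by (intro residue_simple'[of "ball a r" a f L]) (auto simp: mult.commute)
qed

lemma filterlim_inverse_at_0: "filterlim (inverse :: complex \<Rightarrow> complex) at_infinity (at 0)"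
  by (rule filterlim_inverse_at_infinity)

text \<open>Without poles the reduced denominator has no roots, so it is constant by the fundamental
  theorem of algebra; a polynomial with a finite limit at infinity is constant as well. Infinity is
  approached through \<open>inverse\<close> at 0.\<close>

lemma ratfun_liouville:
  assumes "ratfun f" and "\<And>a. \<exists>L. (f \<longlongrightarrow> L) (at a)"
    and "((\<lambda>z. f (inverse z)) \<longlongrightarrow> c) (at 0)"
  shows "\<forall>\<^sub>F z in cofinite. f z = c"
proof -
  obtain p q where pq: "q \<noteq> 0" "\<forall>\<^sub>F z in cofinite. f z = poly p z / poly q z"
    "\<And>a. poly q a = 0 \<Longrightarrow> poly p a \<noteq> 0" using ratfun_reduced[OF assms(1)] by blast
  have p: "(poly p \<longlongrightarrow> poly p a) (at a)" for p and a :: complex using poly_isCont unfolding isCont_def by blast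
  have "poly q a \<noteq> 0" for a
  proof
    assume qa: "poly q a = 0"
    obtain L where L: "(f \<longlongrightarrow> L) (at a)" using assms(2) by blast
    have "((\<lambda>z. f z * poly q z) \<longlongrightarrow> L * poly q a) (at a)" by (intro tendsto_mult L p)
    moreover have "\<forall>\<^sub>F z in at a. f z * poly q z = poly p z"
      using eventually_cofinite_at[OF pq(2)]
        eventually_cofinite_at[OF eventually_poly_nonzero[OF pq(1)]] by eventually_elim simp
    ultimately have "(poly p \<longlongrightarrow> L * poly q a) (at a)" by (rule tendsto_eventually_eq')
    then have "(poly p \<longlongrightarrow> 0) (at a)" using qa by simp
    then have "poly p a = 0" using tendsto_unique[OF _ p] by auto
    then show False using pq(3) qa by blast
  qed
  then have "constant (poly q)" using fundamental_theorem_of_algebra by blast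
  then have "degree q = 0" by (simp add: constant_degree)
  then obtain b where q: "q = [:b:]" "b \<noteq> 0" using pq(1) by (metis degree_eq_zeroE pCons_0_0)
  define r where "r = smult (inverse b) p"
  have r: "\<forall>\<^sub>F z in cofinite. f z = poly r z"
    using pq(2) by eventually_elim (simp add: q r_def divide_inverse mult.commute)
  have "\<forall>\<^sub>F z in at 0. f (inverse z) = poly r (inverse z)"
    by (rule eventually_cofinite_at[OF eventually_cofinite_inverse[OF r]])
  then have lim: "((\<lambda>z. poly r (inverse z)) \<longlongrightarrow> c) (at 0)" by (rule tendsto_eventually_eq'[OF assms(3)])
  have "degree r = 0"
  proof (rule ccontr)
    assume "degree r \<noteq> 0"
    then have "filterlim (poly r) at_infinity at_infinity" by (intro filterlim_poly_at_infinity) simp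
    then have "filterlim (\<lambda>z. poly r (inverse z)) at_infinity (at 0)"
      by (rule filterlim_compose[OF _ filterlim_inverse_at_0])
    then show False using not_tendsto_and_filterlim_at_infinity[OF _ lim] by simp
  qed
  then obtain d where d: "r = [:d:]" by (metis degree_eq_zeroE)
  then have "d = c" using lim tendsto_const_iff[of "at (0::complex)" d c] by simp
  then show ?thesis using r d by simp
qed

section \<open>Rational matrix functions\<close>

definition rmat :: "(complex \<Rightarrow> complex^'n^'m) \<Rightarrow> bool" where
  "rmat F \<longleftrightarrow> (\<forall>i j. ratfun (\<lambda>z. F z $ i $ j))"

text \<open>At most a removable singularity. A limit is used and not a value, since
  \<open>F a\<close> may be arbitrary.\<close>

definition reg :: "complex \<Rightarrow> (complex \<Rightarrow> complex^'n^'m) \<Rightarrow> bool" where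
  "reg a F \<longleftrightarrow> (\<exists>L. (F \<longlongrightarrow> L) (at a))"

lemma tendsto_matrix_iff:
  fixes F :: "'a \<Rightarrow> complex^'n^'m"
  shows "(F \<longlongrightarrow> L) net \<longleftrightarrow> (\<forall>i j. ((\<lambda>z. F z $ i $ j) \<longlongrightarrow> L $ i $ j) net)"
proof
  assume "(F \<longlongrightarrow> L) net"
  then show "\<forall>i j. ((\<lambda>z. F z $ i $ j) \<longlongrightarrow> L $ i $ j) net"
    by (intro allI tendsto_vec_nth)
next
  assume "\<forall>i j. ((\<lambda>z. F z $ i $ j) \<longlongrightarrow> L $ i $ j) net"
  then show "(F \<longlongrightarrow> L) net" by (intro vec_tendstoI) blast
qed

lemma tendsto_matrix_mult [tendsto_intros]:
  fixes F :: "'a \<Rightarrow> complex^'n^'m" and G :: "'a \<Rightarrow> complex^'k^'n"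
  assumes "(F \<longlongrightarrow> L) net" "(G \<longlongrightarrow> K) net"
  shows "((\<lambda>z. F z ** G z) \<longlongrightarrow> L ** K) net"
  unfolding tendsto_matrix_iff[of "\<lambda>z. F z ** G z"]
  by (auto intro!: tendsto_intros assms simp: matrix_matrix_mult_def)

lemma tendsto_hconj [tendsto_intros]:
  "(F \<longlongrightarrow> L) net \<Longrightarrow> ((\<lambda>z. hconj (F z)) \<longlongrightarrow> hconj L) net"
  unfolding tendsto_matrix_iff[of "\<lambda>z. hconj (F z)"] by (auto intro!: tendsto_intros)

lemma tendsto_cscale [tendsto_intros]:
  "(c \<longlongrightarrow> d) net \<Longrightarrow> (F \<longlongrightarrow> L) net \<Longrightarrow> ((\<lambda>z. cscale (c z) (F z)) \<longlongrightarrow> cscale d L) net"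
  unfolding tendsto_matrix_iff[of "\<lambda>z. cscale (c z) (F z)"] by (auto intro!: tendsto_intros)

lemma tendsto_mat [tendsto_intros]:
  "(c \<longlongrightarrow> d) net \<Longrightarrow> ((\<lambda>z. mat (c z) :: complex^'n^'n) \<longlongrightarrow> mat d) net"
  unfolding tendsto_matrix_iff mat_def by (auto intro!: tendsto_intros)

lemma regI: "(F \<longlongrightarrow> L) (at a) \<Longrightarrow> reg a F"
  unfolding reg_def by blast

lemma reg_const [simp, intro]: "reg a (\<lambda>_. C)"
  by (rule regI) (rule tendsto_const)

lemma reg_add [intro]: "reg a F \<Longrightarrow> reg a G \<Longrightarrow> reg a (\<lambda>z. F z + G z)"
  unfolding reg_def by (blast intro: tendsto_add)

lemma reg_diff [intro]: "reg a F \<Longrightarrow> reg a G \<Longrightarrow> reg a (\<lambda>z. F z - G z)"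
  unfolding reg_def by (blast intro: tendsto_diff)

lemma reg_mult [intro]: "reg a F \<Longrightarrow> reg a G \<Longrightarrow> reg a (\<lambda>z. F z ** G z)"
  unfolding reg_def by (blast intro: tendsto_matrix_mult)

lemma reg_cscale: "(c \<longlongrightarrow> d) (at a) \<Longrightarrow> reg a F \<Longrightarrow> reg a (\<lambda>z. cscale (c z) (F z))"
  unfolding reg_def by (blast intro: tendsto_cscale)

lemma reg_mat: "(c \<longlongrightarrow> d) (at a) \<Longrightarrow> reg a (\<lambda>z. mat (c z))"
  unfolding reg_def by (blast intro: tendsto_mat)

lemma reg_cong: "reg a F \<Longrightarrow> \<forall>\<^sub>F z in at a. F z = G z \<Longrightarrow> reg a G"
  unfolding reg_def by (blast intro: tendsto_eventually_eq')

lemma reg_cong_cofinite: "reg a F \<Longrightarrow> \<forall>\<^sub>F z in cofinite. F z = G z \<Longrightarrow> reg a G"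
  by (rule reg_cong[OF _ eventually_cofinite_at])

lemma filterlim_inverse_at: "a \<noteq> 0 \<Longrightarrow> filterlim inverse (at (inverse a)) (at (a::complex))"
  unfolding filterlim_at by (auto intro!: tendsto_intros simp: eventually_at_filter)

lemma filterlim_cnj_at: "filterlim cnj (at (cnj a)) (at a)"
  unfolding filterlim_at by (auto intro!: tendsto_intros simp: eventually_at_filter)

lemma tendsto_compose_inverse:
  assumes "(F \<longlongrightarrow> L) (at (inverse a))" "a \<noteq> (0::complex)"
  shows "((\<lambda>z. F (inverse z)) \<longlongrightarrow> L) (at a)"
  by (rule filterlim_compose[OF assms(1) filterlim_inverse_at[OF assms(2)]])

lemma tendsto_compose_cnj:
  assumes "(F \<longlongrightarrow> L) (at (cnj a))"
  shows "((\<lambda>z. F (cnj z)) \<longlongrightarrow> L) (at a)"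
  by (rule filterlim_compose[OF assms filterlim_cnj_at])

lemma reg_compose_inverse: "reg (inverse a) F \<Longrightarrow> a \<noteq> 0 \<Longrightarrow> reg a (\<lambda>z. F (inverse z))"
  unfolding reg_def by (blast intro: tendsto_compose_inverse)

lemma reg_hconj_cnj: "reg (cnj a) F \<Longrightarrow> reg a (\<lambda>z. hconj (F (cnj z)))"
  unfolding reg_def using tendsto_hconj tendsto_compose_cnj by fast

lemma rmatD: "rmat F \<Longrightarrow> ratfun (\<lambda>z. F z $ i $ j)"
  unfolding rmat_def by blast

lemma rmat_const [simp, intro]: "rmat (\<lambda>_. C)"
  unfolding rmat_def by auto

lemma rmat_add [intro]: "rmat F \<Longrightarrow> rmat G \<Longrightarrow> rmat (\<lambda>z. F z + G z)"
  unfolding rmat_def by (simp add: ratfun_add)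

lemma rmat_diff [intro]: "rmat F \<Longrightarrow> rmat G \<Longrightarrow> rmat (\<lambda>z. F z - G z)"
  unfolding rmat_def by (simp add: ratfun_diff)

lemma rmat_mult [intro]: "rmat F \<Longrightarrow> rmat G \<Longrightarrow> rmat (\<lambda>z. F z ** G z)"
  unfolding rmat_def matrix_matrix_mult_def by (simp add: ratfun_sum ratfun_mult)

lemma rmat_cscale [intro]: "ratfun c \<Longrightarrow> rmat F \<Longrightarrow> rmat (\<lambda>z. cscale (c z) (F z))"
  unfolding rmat_def by (simp add: ratfun_mult)

lemma rmat_mat: "ratfun c \<Longrightarrow> rmat (\<lambda>z. mat (c z))"
  unfolding rmat_def
proof (intro allI)
  fix i j :: 'a
  assume "ratfun c"
  then show "ratfun (\<lambda>z. mat (c z) $ i $ j)" by (cases "i = j") (simp_all add: mat_def)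
qed

lemma rmat_cong:
  assumes "rmat F" "\<forall>\<^sub>F z in cofinite. F z = G z"
  shows "rmat G"
  unfolding rmat_def
proof (intro allI)
  fix i j
  have "\<forall>\<^sub>F z in cofinite. F z $ i $ j = G z $ i $ j"
    using assms(2) by eventually_elim simp
  then show "ratfun (\<lambda>z. G z $ i $ j)" by (rule ratfun_cong[OF rmatD[OF assms(1)]])
qed

lemma rmat_compose_inverse: "rmat F \<Longrightarrow> rmat (\<lambda>z. F (inverse z))"
  unfolding rmat_def using ratfun_compose_inverse by blast

lemma rmat_hconj_cnj: "rmat F \<Longrightarrow> rmat (\<lambda>z. hconj (F (cnj z)))"
  unfolding rmat_def hconj_nth using ratfun_compose_cnj by blast

lemma rmat_sharp: "rmat F \<Longrightarrow> rmat (sharp F)"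
  using rmat_compose_inverse[OF rmat_hconj_cnj[of F]] by (simp add: sharp_def[abs_def])

lemma ratfun_det: "rmat F \<Longrightarrow> ratfun (\<lambda>z. det (F z))"
  unfolding det_def rmat_def by (intro ratfun_sum ratfun_mult ratfun_prod ratfun_const) blast

lemma eventually_matrix_iff:
  fixes F G :: "'a \<Rightarrow> complex^'n^'m"
  shows "(\<forall>\<^sub>F z in net. F z = G z) \<longleftrightarrow> (\<forall>i j. \<forall>\<^sub>F z in net. F z $ i $ j = G z $ i $ j)"
proof
  assume *: "\<forall>i j. \<forall>\<^sub>F z in net. F z $ i $ j = G z $ i $ j"
  have "\<forall>\<^sub>F z in net. \<forall>i j. F z $ i $ j = G z $ i $ j"
    by (intro eventually_all_finite) (use * in blast)
  then show "\<forall>\<^sub>F z in net. F z = G z" by (simp add: vec_eq_iff)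
next
  assume *: "\<forall>\<^sub>F z in net. F z = G z"
  show "\<forall>i j. \<forall>\<^sub>F z in net. F z $ i $ j = G z $ i $ j"
    by (intro allI eventually_mono[OF *]) simp
qed

lemma rmat_eventually_eq:
  assumes "rmat F" "rmat G" "\<exists>\<^sub>F z in cofinite. F z = G z"
  shows "\<forall>\<^sub>F z in cofinite. F z = G z"
  unfolding eventually_matrix_iff
proof (intro allI)
  fix i j
  have "\<exists>\<^sub>F z in cofinite. F z $ i $ j - G z $ i $ j = 0"
    using assms(3) by (rule frequently_elim1) simp
  then have "\<forall>\<^sub>F z in cofinite. F z $ i $ j - G z $ i $ j = 0"
    by (rule ratfun_eventually_0[rotated]) (intro ratfun_diff rmatD assms)
  then show "\<forall>\<^sub>F z in cofinite. F z $ i $ j = G z $ i $ j" by simp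
qed

lemma frequently_at_cofinite: "\<exists>\<^sub>F z in at (a::complex). P z \<Longrightarrow> \<exists>\<^sub>F z in cofinite. P z"
  unfolding frequently_def by (erule contrapos_nn) (rule eventually_cofinite_at)

lemma rmat_eventually_invertible:
  assumes "rmat (F :: complex \<Rightarrow> complex^'n^'n)" "\<exists>\<^sub>F z in cofinite. invertible (F z)"
  shows "\<forall>\<^sub>F z in cofinite. invertible (F z)"
proof (rule ccontr)
  assume "\<not> ?thesis"
  then have "\<exists>\<^sub>F z in cofinite. det (F z) = 0"
    unfolding frequently_def invertible_det_nz by simp
  then have "\<forall>\<^sub>F z in cofinite. det (F z) = 0" by (rule ratfun_eventually_0[OF ratfun_det[OF assms(1)]])
  then show False using assms(2) unfolding frequently_def invertible_det_nz by simp
qed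

lemma rmat_matrix_inv:
  assumes "rmat (F :: complex \<Rightarrow> complex^'n^'n)" "\<forall>\<^sub>F z in cofinite. invertible (F z)"
  shows "rmat (\<lambda>z. matrix_inv (F z))"
proof -
  \<comment> \<open>Cramer's rule: entry (k, j) of the inverse is the determinant with column
    \<open>k\<close> replaced by \<open>axis j 1\<close>, divided by \<open>det (F z)\<close>. In
    this form it is visibly rational.\<close>
  define C where "C z = (\<chi> k j. det (\<chi> i l. if l = k then (if i = j then 1 else 0) else F z $ i $ l)
     / det (F z))" for z
  have "rmat C"
    unfolding rmat_def
  proof (intro allI)
    fix k j
    have "rmat (\<lambda>z. \<chi> i l. if l = k then (if i = j then 1 else 0) else F z $ i $ l)"
      unfolding rmat_def
    proof (intro allI)
      fix i l
      show "ratfun (\<lambda>z. (\<chi> i l. if l = k then (if i = j then 1 else 0) else F z $ i $ l) $ i $ l)"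
        using rmatD[OF assms(1), of i l] by (cases "l = k") simp_all
    qed
    then show "ratfun (\<lambda>z. C z $ k $ j)" unfolding C_def
      by (simp add: ratfun_divide ratfun_det assms(1))
  qed
  moreover have "C z = matrix_inv (F z)" if "invertible (F z)" for z
  proof -
    have d: "det (F z) \<noteq> 0" using that invertible_det_nz by blast
    have "F z *v (C z *v axis j 1) = axis j 1" for j
    proof -
      have ax: "axis j (1::complex) $ i = (if i = j then 1 else 0)" for i by (simp add: axis_def)
      have "C z *v axis j 1 = (\<chi> k. det (\<chi> i l. if l = k then axis j 1 $ i else F z $ i $ l) / det (F z))"
        unfolding vec_eq_iff mult_axis ax by (simp add: C_def)
      then show ?thesis using cramer[OF d] by blast
    qed
    then have "(F z ** C z) *v axis j 1 = mat 1 *v axis j 1" for j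
      by (simp add: matrix_vector_mul_assoc)
    then have "(F z ** C z) $ i $ j = mat 1 $ i $ j" for i j
      by (metis mult_axis)
    then have "F z ** C z = mat 1" by (rule matrix_eqI)
    then show ?thesis using matrix_inv_unique matrix_mult_1_commute by metis
  qed
  then have "\<forall>\<^sub>F z in cofinite. C z = matrix_inv (F z)"
    using assms(2) by (rule_tac eventually_mono)
  ultimately show ?thesis by (rule rmat_cong)
qed

lemma rmat_pole_entry:
  fixes F :: "complex \<Rightarrow> complex^'n^'m"
  assumes "rmat F" "\<not> reg a F"
  shows "\<exists>i j. is_pole (\<lambda>z. F z $ i $ j) a"
proof (rule ccontr)
  assume "\<not> ?thesis"
  then have "\<forall>i j. \<exists>L. ((\<lambda>z. F z $ i $ j) \<longlongrightarrow> L) (at a)"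
    using ratfun_tendsto_or_pole rmatD[OF assms(1)] by blast
  then obtain L where "\<And>i j. ((\<lambda>z. F z $ i $ j) \<longlongrightarrow> L i j) (at a)" by metis
  then have "(F \<longlongrightarrow> (\<chi> i j. L i j)) (at a)" unfolding tendsto_matrix_iff by simp
  then show False using assms(2) regI by blast
qed

text \<open>\<open>is_pole\<close> asks that the norm tends to infinity. The two notions are
  complementary because an entry without a limit has a pole, and a single entry bounds the norm from
  below.\<close>

lemma rmat_pole_iff:
  assumes "rmat F"
  shows "is_pole F a \<longleftrightarrow> \<not> reg a F"
proof
  assume "is_pole F a"
  then show "\<not> reg a F" unfolding reg_def is_pole_def
    using not_tendsto_and_filterlim_at_infinity[of "at a" F] by auto
next
  assume "\<not> reg a F"
  then obtain i j where "is_pole (\<lambda>z. F z $ i $ j) a" using rmat_pole_entry[OF assms] by blast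
  then have lim: "filterlim (\<lambda>z. cmod (F z $ i $ j)) at_top (at a)"
    unfolding is_pole_def by (rule filterlim_at_infinity_imp_norm_at_top)
  have "filterlim (\<lambda>z. norm (F z)) at_top (at a)"
    by (rule filterlim_at_top_mono[OF lim]) (simp add: norm_entry_le)
  then show "is_pole F a" unfolding is_pole_def by (rule filterlim_norm_at_top_imp_at_infinity)
qed

text \<open>A bound at some points arbitrarily close to \<open>a\<close> is enough, so one direction
  of approach decides regularity.\<close>

lemma rmat_bounded_imp_reg:
  assumes "rmat F" "\<exists>\<^sub>F z in at a. norm (F z) \<le> C"
  shows "reg a F"
proof (rule ccontr)
  assume "\<not> reg a F"
  then have "is_pole F a" using rmat_pole_iff[OF assms(1)] by blast
  then have "\<forall>\<^sub>F z in at a. norm (F z) > C"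
    unfolding is_pole_def
    using filterlim_at_infinity_imp_norm_at_top[of F "at a"] filterlim_at_top_dense[of "\<lambda>z. norm (F z)"]
    by blast
  then show False using assms(2) by (simp add: frequently_def not_le)
qed

lemma rmat_reg_iff:
  fixes F :: "complex \<Rightarrow> complex^'n^'m"
  assumes "rmat F"
  shows "reg a F \<longleftrightarrow> (\<forall>i j. \<exists>L. ((\<lambda>z. F z $ i $ j) \<longlongrightarrow> L) (at a))"
proof -
  show ?thesis
  proof
    assume "reg a F"
    then show "\<forall>i j. \<exists>L. ((\<lambda>z. F z $ i $ j) \<longlongrightarrow> L) (at a)"
      unfolding reg_def tendsto_matrix_iff by blast
  next
    assume "\<forall>i j. \<exists>L. ((\<lambda>z. F z $ i $ j) \<longlongrightarrow> L) (at a)"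
    then show "reg a F" using rmat_pole_entry[OF \<open>rmat F\<close>] not_tendsto_pole by blast
  qed
qed

lemma rmat_times_linear: "rmat F \<Longrightarrow> rmat (\<lambda>z. cscale (z - a) (F z))"
  by (intro rmat_cscale ratfun_diff ratfun_id ratfun_const)

lemma at_most_simple_pole_iff:
  assumes "rmat F"
  shows "at_most_simple_pole F a \<longleftrightarrow> reg a (\<lambda>z. cscale (z - a) (F z))"
  unfolding at_most_simple_pole_def rmat_reg_iff[OF rmat_times_linear[OF assms]]
  using ratfun_simple_pole_iff[OF rmatD[OF assms]] by simp

lemma rmat_residue:
  assumes "rmat F" "((\<lambda>z. cscale (z - a) (F z)) \<longlongrightarrow> P) (at a)"
  shows "matrix_residue F a = P"
proof (rule matrix_eqI)
  fix i j
  have "((\<lambda>z. (z - a) * F z $ i $ j) \<longlongrightarrow> P $ i $ j) (at a)"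
    using assms(2) unfolding tendsto_matrix_iff by simp
  then show "matrix_residue F a $ i $ j = P $ i $ j"
    unfolding matrix_residue_def using ratfun_residue[OF rmatD[OF assms(1)]] by simp
qed

lemma mero_value_eq: "(F \<longlongrightarrow> L) (at a) \<Longrightarrow> mero_value F a = L"
  unfolding mero_value_def by (rule tendsto_Lim) simp

lemma rmat_zero_residue:
  assumes "rmat F" "((\<lambda>z. cscale (z - a) (F z)) \<longlongrightarrow> 0) (at a)"
  shows "reg a F"
  unfolding rmat_reg_iff[OF assms(1)]
proof (intro allI)
  fix i j
  have lim: "((\<lambda>z. (z - a) * F z $ i $ j) \<longlongrightarrow> 0) (at a)"
    using assms(2) unfolding tendsto_matrix_iff by simp
  have "ratfun (\<lambda>z. (z - a) * F z $ i $ j)"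
    by (intro ratfun_mult ratfun_diff ratfun_id ratfun_const rmatD assms)
  then obtain K where "((\<lambda>z. ((z - a) * F z $ i $ j - 0) / (z - a)) \<longlongrightarrow> K) (at a)"
    using ratfun_difference_quotient[OF _ lim] by blast
  moreover have "\<forall>\<^sub>F z in at a. ((z - a) * F z $ i $ j - 0) / (z - a) = F z $ i $ j"
    using eventually_neq_at_within[of a] by eventually_elim simp
  ultimately have "((\<lambda>z. F z $ i $ j) \<longlongrightarrow> K) (at a)" by (rule tendsto_eventually_eq')
  then show "\<exists>L. ((\<lambda>z. F z $ i $ j) \<longlongrightarrow> L) (at a)" by blast
qed

lemma tendsto_linear_factor: "((\<lambda>z. z - a) \<longlongrightarrow> 0) (at (a::complex))"
  by (auto intro!: tendsto_eq_intros)

lemma reg_residue_zero: "reg a F \<Longrightarrow> ((\<lambda>z. cscale (z - a) (F z)) \<longlongrightarrow> 0) (at a)"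
  unfolding reg_def using tendsto_cscale[OF tendsto_linear_factor] by fastforce

text \<open>Turns regularity at a simple pole into an equation between a limit and a residue. One
  direction extracts the equations behind (D), the other uses them to remove poles.\<close>

lemma reg_mult_residue_iff:
  assumes "rmat G" "rmat F" "(G \<longlongrightarrow> L) (at a)" "((\<lambda>z. cscale (z - a) (F z)) \<longlongrightarrow> P) (at a)"
  shows "reg a (\<lambda>z. G z ** F z) \<longleftrightarrow> L ** P = 0"
proof -
  have lim: "((\<lambda>z. cscale (z - a) (G z ** F z)) \<longlongrightarrow> L ** P) (at a)"
    using tendsto_matrix_mult[OF assms(3,4)] by (simp add: cscale_mult_right)
  show ?thesis
  proof
    assume "reg a (\<lambda>z. G z ** F z)"
    then show "L ** P = 0" using reg_residue_zero tendsto_unique[OF _ lim] by fastforce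
  next
    assume "L ** P = 0"
    then show "reg a (\<lambda>z. G z ** F z)" using rmat_zero_residue[OF rmat_mult[OF assms(1,2)]] lim by simp
  qed
qed

lemma rmat_power_mult_reg:
  assumes "rmat (F :: complex \<Rightarrow> complex^'n^'m)"
  shows "\<exists>k. reg a (\<lambda>z. cscale ((z - a) ^ k) (F z))"
proof -
  have "\<forall>i j. \<exists>k L. ((\<lambda>z. (z - a) ^ k * F z $ i $ j) \<longlongrightarrow> L) (at a)"
    using ratfun_power_mult_tendsto[OF rmatD[OF assms]] by blast
  then obtain k L where k: "\<And>i j. ((\<lambda>z. (z - a) ^ k i j * F z $ i $ j) \<longlongrightarrow> L i j) (at a)" by metis
  \<comment> \<open>The entries come with different exponents; their sum is a common upper
    bound.\<close>
  define K where "K = (\<Sum>i\<in>UNIV. \<Sum>j\<in>UNIV. k i j)"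
  have le: "k i j \<le> K" for i j
  proof -
    have "k i j \<le> (\<Sum>j\<in>UNIV. k i j)" by (rule member_le_sum) auto
    also have "\<dots> \<le> K" unfolding K_def by (rule member_le_sum) auto
    finally show ?thesis .
  qed
  have lim: "((\<lambda>z. (z - a) ^ K * F z $ i $ j) \<longlongrightarrow> (a - a) ^ (K - k i j) * L i j) (at a)" for i j
  proof -
    have "((\<lambda>z. (z - a) ^ (K - k i j) * ((z - a) ^ k i j * F z $ i $ j)) \<longlongrightarrow>
      (a - a) ^ (K - k i j) * L i j) (at a)"
      by (intro tendsto_mult tendsto_power tendsto_diff tendsto_const tendsto_ident_at k)
    then show ?thesis using le by (simp add: mult.assoc[symmetric] power_add[symmetric])
  qed
  have "((\<lambda>z. cscale ((z - a) ^ K) (F z)) \<longlongrightarrow> (\<chi> i j. (a - a) ^ (K - k i j) * L i j)) (at a)"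
    unfolding tendsto_matrix_iff using lim by simp
  then show ?thesis using regI by blast
qed

lemma rmat_liouville:
  assumes "rmat F" "\<And>a. reg a F" "((\<lambda>z. F (inverse z)) \<longlongrightarrow> C) (at 0)"
  shows "\<forall>\<^sub>F z in cofinite. F z = C"
  unfolding eventually_matrix_iff
proof (intro allI)
  fix i j
  show "\<forall>\<^sub>F z in cofinite. F z $ i $ j = C $ i $ j"
  proof (rule ratfun_liouville[OF rmatD[OF assms(1)]])
    show "\<exists>L. ((\<lambda>z. F z $ i $ j) \<longlongrightarrow> L) (at a)" for a
      using assms(2)[of a] unfolding reg_def tendsto_matrix_iff by blast
    show "((\<lambda>z. F (inverse z) $ i $ j) \<longlongrightarrow> C $ i $ j) (at 0)"
      using assms(3) unfolding tendsto_matrix_iff by blast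
  qed
qed

lemma rational_matrix_imp_rmat: "rational_matrix R \<Longrightarrow> rmat R"
  unfolding rational_matrix_def rmat_def
  using ratfun_poly_quotient ratfun_cong[OF ratfun_poly_quotient] by (metis (mono_tags, lifting) always_eventually)

lemma ratfun_reduced_value:
  assumes "ratfun f"
  shows "\<exists>p q. q \<noteq> 0 \<and> (\<forall>\<^sub>F z in cofinite. f z = poly p z / poly q z) \<and>
    (\<forall>a L. (f \<longlongrightarrow> L) (at a) \<longrightarrow> poly p a / poly q a = L)"
proof -
  obtain p q where pq: "q \<noteq> 0" "\<forall>\<^sub>F z in cofinite. f z = poly p z / poly q z"
    "\<And>a. poly q a = 0 \<Longrightarrow> poly p a \<noteq> 0" using ratfun_reduced[OF assms] by blast
  have p: "(poly p \<longlongrightarrow> poly p a) (at a)" for p and a :: complex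
    using poly_isCont unfolding isCont_def by blast
  have "poly p a / poly q a = L" if L: "(f \<longlongrightarrow> L) (at a)" for a L
  proof -
    have "((\<lambda>z. f z * poly q z) \<longlongrightarrow> L * poly q a) (at a)" by (intro tendsto_mult L p)
    moreover have "\<forall>\<^sub>F z in at a. f z * poly q z = poly p z"
      using eventually_cofinite_at[OF pq(2)]
        eventually_cofinite_at[OF eventually_poly_nonzero[OF pq(1)]] by eventually_elim simp
    ultimately have "(poly p \<longlongrightarrow> L * poly q a) (at a)" by (rule tendsto_eventually_eq')
    then have pa: "poly p a = L * poly q a" using tendsto_unique[OF _ p] by auto
    then have "poly q a \<noteq> 0" using pq(3)[of a] by auto
    then show ?thesis using pa by simp
  qed
  then show ?thesis using pq(1,2) by blast
qed

text \<open>\<open>is_rational_extension\<close> demands equality at every nonreal point of the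
  disk, whereas \<open>rmat\<close> functions are known up to finitely many values. Reduced
  fractions take the right value wherever a limit exists.\<close>

lemma rmat_representative:
  assumes "rmat (F :: complex \<Rightarrow> complex^'n^'n)"
  shows "\<exists>R. rational_matrix R \<and> (\<forall>\<^sub>F z in cofinite. F z = R z) \<and>
    (\<forall>a L. (F \<longlongrightarrow> L) (at a) \<longrightarrow> R a = L)"
proof -
  define T where "T ij w \<longleftrightarrow> snd w \<noteq> 0 \<and>
    (\<forall>\<^sub>F z in cofinite. F z $ fst ij $ snd ij = poly (fst w) z / poly (snd w) z) \<and>
    (\<forall>a L. ((\<lambda>z. F z $ fst ij $ snd ij) \<longlongrightarrow> L) (at a) \<longrightarrow> poly (fst w) a / poly (snd w) a = L)"
    for ij and w :: "complex poly \<times> complex poly"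
  have "\<forall>ij. \<exists>w. T ij w"
    using ratfun_reduced_value[OF rmatD[OF assms]] unfolding T_def by simp
  then have "\<exists>w. \<forall>ij. T ij (w ij)" by (rule choice)
  then obtain w where w: "\<And>ij. T ij (w ij)" by blast
  define p q where "p i j = fst (w (i, j))" and "q i j = snd (w (i, j))" for i j
  have pq: "\<And>i j. q i j \<noteq> 0"
    "\<And>i j. \<forall>\<^sub>F z in cofinite. F z $ i $ j = poly (p i j) z / poly (q i j) z"
    "\<And>i j a L. ((\<lambda>z. F z $ i $ j) \<longlongrightarrow> L) (at a) \<Longrightarrow> poly (p i j) a / poly (q i j) a = L"
    using w[of "(i, j)" for i j] unfolding T_def p_def q_def by simp_all
  define R where "R z = (\<chi> i j. poly (p i j) z / poly (q i j) z)" for z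
  have "rational_matrix R" unfolding rational_matrix_def R_def using pq(1) by auto
  moreover have "\<forall>\<^sub>F z in cofinite. F z = R z"
    unfolding eventually_matrix_iff R_def using pq(2) by simp
  moreover have "R a = L" if "(F \<longlongrightarrow> L) (at a)" for a L
    by (rule matrix_eqI) (use that pq(3) in \<open>simp add: R_def tendsto_matrix_iff\<close>)
  ultimately show ?thesis by blast
qed

section \<open>Block Jacobi operators\<close>

lemma norm_matrix_columns: "(norm (M :: complex^'k^'m))\<^sup>2 = (\<Sum>j\<in>UNIV. (norm (M *v axis j 1))\<^sup>2)"
proof -
  have "(norm M)\<^sup>2 = (\<Sum>i\<in>UNIV. \<Sum>j\<in>UNIV. (cmod (M $ i $ j))\<^sup>2)"
    by (simp add: norm_matrix_eq sum_nonneg)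
  also have "\<dots> = (\<Sum>j\<in>UNIV. \<Sum>i\<in>UNIV. (cmod (M $ i $ j))\<^sup>2)" by (rule sum.swap)
  also have "\<dots> = (\<Sum>j\<in>UNIV. (norm (M *v axis j 1))\<^sup>2)"
  proof (rule sum.cong[OF refl])
    fix j
    have "(norm v)\<^sup>2 = (\<Sum>i\<in>UNIV. (cmod (v $ i))\<^sup>2)" for v :: "complex^'m"
      by (simp add: norm_vec_def L2_set_def sum_nonneg)
    then show "(\<Sum>i\<in>UNIV. (cmod (M $ i $ j))\<^sup>2) = (norm (M *v axis j 1))\<^sup>2"
      by (simp add: mult_axis)
  qed
  finally show ?thesis .
qed

lemma norm_matrix_mult_le: "norm (A ** B) \<le> norm (A :: complex^'n^'m) * norm (B :: complex^'k^'n)"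
proof -
  have "(norm (A ** B))\<^sup>2 = (\<Sum>j\<in>UNIV. (norm (A *v (B *v axis j 1)))\<^sup>2)"
    unfolding norm_matrix_columns[of "A ** B"] by (simp add: matrix_vector_mul_assoc)
  also have "\<dots> \<le> (\<Sum>j\<in>UNIV. (norm A * norm (B *v axis j 1))\<^sup>2)"
    by (intro sum_mono power_mono norm_mult_vec_le) simp
  also have "\<dots> = (norm A * norm B)\<^sup>2"
    by (simp add: power_mult_distrib norm_matrix_columns[of B] sum_distrib_left)
  finally show ?thesis by (rule power2_le_imp_le) simp
qed

text \<open>The Jacobi matrix acting on all columns of a matrix-valued sequence at once.\<close>

definition jacobi_mat ::
  "(nat \<Rightarrow> complex^'l^'l) \<Rightarrow> (nat \<Rightarrow> complex^'l^'l) \<Rightarrow> (nat \<Rightarrow> complex^'l^'l) \<Rightarrow> nat \<Rightarrow> complex^'l^'l" where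
  "jacobi_mat A B \<Psi> n =
     (if n = 0 then 0 else hconj (A (n - 1)) ** \<Psi> (n - 1)) + B n ** \<Psi> n + A n ** \<Psi> (n + 1)"

lemma jacobi_op_columns:
  "jacobi_op A B (\<lambda>n. \<Psi> n *v v) n = jacobi_mat A B \<Psi> n *v v"
  by (simp add: jacobi_op_def jacobi_mat_def matrix_vector_mult_add_rdistrib matrix_vector_mul_assoc)

lemma hermitian_cinner_Im: "hermitian B \<Longrightarrow> Im (cinner v (B *v v)) = 0"
proof -
  assume "hermitian B"
  then have "cnj (cinner v (B *v v)) = cinner v (B *v v)"
    unfolding cinner_commute cinner_adjoint[of v] by (simp add: hermitian_def)
  then show ?thesis by (simp add: complex_eq_iff)
qed

text \<open>Green's identity: the diagonal terms are real, and every off-diagonal term below the cut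
  meets its conjugate, so the imaginary parts cancel except at the cut.\<close>

lemma jacobi_green:
  assumes "\<And>n. hermitian (B n)"
  shows "(\<Sum>n\<le>K. Im (cinner (u n) (jacobi_op A B u n))) = Im (cinner (u K) (A K *v u (K + 1)))"
proof (induction K)
  case 0
  show ?case using hermitian_cinner_Im[OF assms, of "u 0" 0]
    by (simp add: jacobi_op_def cinner_add_right)
next
  case (Suc K)
  have "cinner (u (Suc K)) (hconj (A K) *v u K) = cnj (cinner (u K) (A K *v u (Suc K)))"
    unfolding cinner_commute cinner_adjoint[of "u (Suc K)"] by simp
  then show ?case using Suc.IH hermitian_cinner_Im[OF assms, of "u (Suc K)" "Suc K"]
    by (simp add: jacobi_op_def cinner_add_right)
qed

lemma summable_norm_power2_tendsto_0:
  fixes u :: "nat \<Rightarrow> 'a::real_normed_vector"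
  assumes "summable (\<lambda>n. (norm (u n))\<^sup>2)"
  shows "(\<lambda>n. norm (u n)) \<longlonglongrightarrow> 0"
proof -
  have "(\<lambda>n. sqrt ((norm (u n))\<^sup>2)) \<longlonglongrightarrow> sqrt 0"
    by (intro tendsto_real_sqrt summable_LIMSEQ_zero assms)
  then show ?thesis by simp
qed

text \<open>By Green's identity, Im E times the partial sum of squares equals a boundary term, and
  this tends to 0 because \<open>u\<close> is square summable and \<open>A\<close> is
  bounded.\<close>

lemma jacobi_no_nonreal_eigenvalue:
  assumes J: "block_jacobi A B" and E: "Im E \<noteq> 0"
    and u: "\<And>n. jacobi_op A B u n = E *s u n" and ell2: "summable (\<lambda>n. (norm (u n))\<^sup>2)"
  shows "u n = 0"
proof -
  obtain a where a: "\<And>n. norm (A n) \<le> a"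
    using J unfolding block_jacobi_def bounded_iff by auto
  have herm: "\<And>n. hermitian (B n)" using J unfolding block_jacobi_def by blast
  have lim: "(\<lambda>K. a * (norm (u K) * norm (u (Suc K)))) \<longlonglongrightarrow> 0"
    using summable_norm_power2_tendsto_0[OF ell2] LIMSEQ_Suc[OF summable_norm_power2_tendsto_0[OF ell2]]
    by (intro tendsto_mult_right_zero tendsto_mult_zero)
  have bound: "\<bar>Im E\<bar> * (norm (u n))\<^sup>2 \<le> a * (norm (u K) * norm (u (Suc K)))" if "K \<ge> n" for K
  proof -
    have "Im (cinner (u m) (jacobi_op A B u m)) = Im E * (norm (u m))\<^sup>2" for m
      by (simp add: u cinner_scale_right cinner_self)
    then have "Im E * (\<Sum>m\<le>K. (norm (u m))\<^sup>2) = Im (cinner (u K) (A K *v u (Suc K)))"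
      using jacobi_green[where u = u and A = A and K = K and B = B, OF herm] by (simp add: sum_distrib_left)
    then have "\<bar>Im E\<bar> * (\<Sum>m\<le>K. (norm (u m))\<^sup>2) = \<bar>Im (cinner (u K) (A K *v u (Suc K)))\<bar>"
      by (metis abs_mult abs_of_nonneg sum_nonneg zero_le_power2)
    also have "\<dots> \<le> norm (u K) * norm (A K *v u (Suc K))"
      using abs_Im_le_cmod norm_cinner_le order_trans by blast
    also have "\<dots> \<le> norm (u K) * (norm (A K) * norm (u (Suc K)))"
      by (intro mult_left_mono norm_mult_vec_le) simp
    also have "\<dots> \<le> norm (u K) * (a * norm (u (Suc K)))"
      by (intro mult_left_mono mult_right_mono a) simp_all
    also have "\<dots> = a * (norm (u K) * norm (u (Suc K)))" by simp
    finally have le: "\<bar>Im E\<bar> * (\<Sum>m\<le>K. (norm (u m))\<^sup>2) \<le> a * (norm (u K) * norm (u (Suc K)))" .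
    have "(norm (u n))\<^sup>2 \<le> (\<Sum>m\<le>K. (norm (u m))\<^sup>2)" using that by (intro member_le_sum) auto
    then have "\<bar>Im E\<bar> * (norm (u n))\<^sup>2 \<le> \<bar>Im E\<bar> * (\<Sum>m\<le>K. (norm (u m))\<^sup>2)"
      by (intro mult_left_mono) auto
    then show ?thesis using le by linarith
  qed
  have "\<bar>Im E\<bar> * (norm (u n))\<^sup>2 \<le> 0"
    by (rule LIMSEQ_le_const[OF lim]) (use bound in blast)
  then have "(norm (u n))\<^sup>2 \<le> 0" using E by (simp add: mult_le_0_iff)
  then show ?thesis by simp
qed

lemma summable_norm_power2_diff:
  fixes u v :: "nat \<Rightarrow> 'a::real_normed_vector"
  assumes "summable (\<lambda>n. (norm (u n))\<^sup>2)" "summable (\<lambda>n. (norm (v n))\<^sup>2)"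
  shows "summable (\<lambda>n. (norm (u n - v n))\<^sup>2)"
proof (rule summable_comparison_test')
  show "summable (\<lambda>n. 2 * (norm (u n))\<^sup>2 + 2 * (norm (v n))\<^sup>2)"
    by (intro summable_add summable_mult assms)
  fix n :: nat
  have "(norm (u n - v n))\<^sup>2 \<le> (norm (u n) + norm (v n))\<^sup>2"
    by (intro power_mono norm_triangle_ineq4) simp
  also have "\<dots> \<le> 2 * (norm (u n))\<^sup>2 + 2 * (norm (v n))\<^sup>2"
    using sum_squares_bound[of "norm (u n)" "norm (v n)"] by (simp add: power2_eq_square algebra_simps)
  finally show "norm ((norm (u n - v n))\<^sup>2) \<le> 2 * (norm (u n))\<^sup>2 + 2 * (norm (v n))\<^sup>2" by simp
qed

text \<open>The inverse in \<open>resolvent_block\<close> is an \<open>inv_into\<close>. Since J - E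
  is injective on \<open>ell2\<close>, it is evaluated by exhibiting one square summable preimage, a
  column of \<Psi>.\<close>

lemma resolvent_block_eq:
  assumes J: "block_jacobi A B" and E: "Im E \<noteq> 0"
    and eq: "\<And>n. jacobi_mat A B \<Psi> n - cscale E (\<Psi> n) = (if n = 0 then mat 1 else 0)"
    and ell2: "summable (\<lambda>n. (norm (\<Psi> n))\<^sup>2)"
  shows "resolvent_block A B E = \<Psi> 0"
proof (rule matrix_eqI)
  fix i j
  define T where "T = (\<lambda>\<psi> n. jacobi_op A B \<psi> n - E *s \<psi> n)"
  define u where "u = (\<lambda>n. \<Psi> n *v axis j 1)"
  have norm_u: "norm (u n) \<le> norm (\<Psi> n)" for n
  proof -
    have "norm (u n) \<le> norm (\<Psi> n) * norm (axis j (1::complex))"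
      unfolding u_def by (rule norm_mult_vec_le)
    then show ?thesis by simp
  qed
  have u: "u \<in> ell2" unfolding ell2_def
    using norm_u by (auto intro!: summable_comparison_test'[OF ell2] power_mono)
  have inj: "inj_on T ell2"
  proof (rule inj_onI)
    fix v w assume vw: "v \<in> ell2" "w \<in> ell2" "T v = T w"
    have "v n - w n = 0" for n
    proof (rule jacobi_no_nonreal_eigenvalue[OF J E])
      show "summable (\<lambda>n. (norm (v n - w n))\<^sup>2)"
        using vw unfolding ell2_def by (auto intro: summable_norm_power2_diff)
      fix n
      have "jacobi_op A B (\<lambda>n. v n - w n) n = jacobi_op A B v n - jacobi_op A B w n"
        by (simp add: jacobi_op_def matrix_vector_mult_diff_distrib)
      also have "\<dots> = E *s (v n - w n)"
        using fun_cong[OF vw(3), of n]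
        unfolding T_def by (simp add: vec_eq_iff algebra_simps)
      finally show "jacobi_op A B (\<lambda>n. v n - w n) n = E *s (v n - w n)" .
    qed
    then show "v = w" by auto
  qed
  have "T u = (\<lambda>n. if n = 0 then axis j 1 else 0)"
  proof
    fix n
    have "T u n = (jacobi_mat A B \<Psi> n - cscale E (\<Psi> n)) *v axis j 1"
      unfolding T_def u_def jacobi_op_columns
      by (simp add: matrix_vector_mult_diff_rdistrib cscale_vec)
    then show "T u n = (if n = 0 then axis j 1 else 0)" unfolding eq by simp
  qed
  then have "inv_into ell2 T (\<lambda>n. if n = 0 then axis j 1 else 0) = u"
    using inv_into_f_f[OF inj u] by simp
  then have "resolvent_block A B E $ i $ j = u 0 $ i"
    unfolding resolvent_block_def T_def by simp
  then show "resolvent_block A B E $ i $ j = \<Psi> 0 $ i $ j" by (simp add: u_def mult_axis)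
qed

section \<open>The Weyl solution near infinity\<close>

lemma bounded_linear_matrix_mult: "bounded_linear (\<lambda>X. (M :: complex^'n^'m) ** (X :: complex^'k^'n))"
proof (rule bounded_linear_intro)
  show "M ** (r *\<^sub>R x) = r *\<^sub>R (M ** x)" for r and x :: "complex^'k^'n"
    by (rule matrix_eqI) (simp add: matrix_matrix_mult_def scaleR_sum_right)
  show "norm (M ** x) \<le> norm x * norm M" for x :: "complex^'k^'n"
    using norm_matrix_mult_le[of M x] by (simp add: mult.commute)
qed (rule matrix_add_ldistrib)

lemma bounded_linear_cscale: "bounded_linear (cscale c :: complex^'n^'m \<Rightarrow> _)"
proof (rule bounded_linear_intro)
  show "cscale c (r *\<^sub>R x) = r *\<^sub>R cscale c x" for r and x :: "complex^'n^'m"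
    by (rule matrix_eqI) simp
  show "norm (cscale c x) \<le> norm x * cmod c" for x :: "complex^'n^'m"
    by (simp add: norm_matrix_eq norm_mult power_mult_distrib sum_distrib_left[symmetric] real_sqrt_mult)
qed (rule cscale_add)

lemma norm_cscale: "norm (cscale c M) = cmod c * norm M"
  by (simp add: norm_matrix_eq norm_mult power_mult_distrib sum_distrib_left[symmetric] real_sqrt_mult)

text \<open>First block column of the k-th power of the Jacobi matrix.\<close>

primrec jacobi_iterate ::
  "(nat \<Rightarrow> complex^'l^'l) \<Rightarrow> (nat \<Rightarrow> complex^'l^'l) \<Rightarrow> nat \<Rightarrow> nat \<Rightarrow> complex^'l^'l" where
  "jacobi_iterate A B 0 = (\<lambda>n. if n = 0 then mat 1 else 0)"
| "jacobi_iterate A B (Suc k) = jacobi_mat A B (jacobi_iterate A B k)"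

text \<open>Finite propagation: a tridiagonal matrix reaches one block further with each
  application. This is the source of the decay in \<open>n\<close> below.\<close>

lemma jacobi_iterate_support: "n > k \<Longrightarrow> jacobi_iterate A B k n = 0"
  by (induction k arbitrary: n) (auto simp: jacobi_mat_def)

lemma jacobi_mat_norm_le:
  fixes A B X :: "nat \<Rightarrow> complex^'l^'l"
  assumes a: "\<And>n. norm (A n) \<le> a" and b: "\<And>n. norm (B n) \<le> b"
    and X: "\<And>n. norm (X n) \<le> r"
  shows "norm (jacobi_mat A B X n) \<le> (2 * a + b) * r"
proof -
  have r: "r \<ge> 0" using norm_ge_zero X order_trans by blast
  have a0: "a \<ge> 0" using norm_ge_zero a order_trans by blast
  have prod: "norm (M ** X k) \<le> c * r" if "norm M \<le> c" for M :: "complex^'l^'l" and c k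
    using norm_matrix_mult_le[of M "X k"] mult_mono[OF that X[of k]] that r
    by (meson norm_ge_zero order_trans)
  have "norm (if n = 0 then 0 else hconj (A (n - 1)) ** X (n - 1)) \<le> a * r"
    using prod[of "hconj (A (n - 1))" a] a r a0 by (simp add: norm_hconj)
  moreover have "norm (B n ** X n) \<le> b * r" "norm (A n ** X (n + 1)) \<le> a * r"
    by (intro prod a b)+
  ultimately have "norm (jacobi_mat A B X n) \<le> a * r + b * r + a * r"
    unfolding jacobi_mat_def by (intro norm_triangle_mono)
  then show ?thesis by (simp add: algebra_simps)
qed

text \<open>Neumann series in powers of 1/E for the first block column of the resolvent. In row n it
  starts with the n-th power of the Jacobi matrix, whence the factor
  \<open>(c / cmod E) ^ n\<close>, which later becomes a zero of order n + 1 at z = 0.\<close>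

lemma jacobi_neumann_series:
  fixes A B :: "nat \<Rightarrow> complex^'l^'l"
  assumes J: "block_jacobi A B"
  shows "\<exists>c>0. \<exists>K. \<forall>E. cmod E > c \<longrightarrow> (\<exists>\<Psi>.
    (\<forall>n. jacobi_mat A B \<Psi> n - cscale E (\<Psi> n) = (if n = 0 then mat 1 else 0)) \<and>
    (\<forall>n. norm (\<Psi> n) \<le> K * (c / cmod E) ^ n / (cmod E - c)))"
proof -
  obtain a where a: "\<And>n. norm (A n) \<le> a"
    using J unfolding block_jacobi_def bounded_iff by auto
  obtain b where b: "\<And>n. norm (B n) \<le> b"
    using J unfolding block_jacobi_def bounded_iff by auto
  have ab: "a \<ge> 0" "b \<ge> 0" using a b norm_ge_zero order_trans by blast+
  \<comment> \<open>\<open>2 * a + b\<close> bounds the action of the Jacobi matrix in the supremum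
    norm; the 1 keeps \<open>c\<close> positive.\<close>
  define c where "c = 2 * a + b + 1"
  have c: "c > 0" "2 * a + b \<le> c" using ab by (simp_all add: c_def)
  define K where "K = norm (mat 1 :: complex^'l^'l)"
  define g where "g = jacobi_iterate A B"
  have g: "norm (g k n) \<le> c ^ k * K" for k n
  proof (induction k arbitrary: n)
    case 0
    show ?case by (simp add: g_def K_def)
  next
    case (Suc k)
    have "norm (g (Suc k) n) \<le> (2 * a + b) * (c ^ k * K)"
      unfolding g_def jacobi_iterate.simps by (rule jacobi_mat_norm_le[OF a b Suc[unfolded g_def]])
    also have "\<dots> \<le> c * (c ^ k * K)" using c by (intro mult_right_mono) (auto simp: K_def)
    finally show ?case by (simp add: mult.assoc)
  qed
  have "\<exists>\<Psi>. (\<forall>n. jacobi_mat A B \<Psi> n - cscale E (\<Psi> n) = (if n = 0 then mat 1 else 0)) \<and>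
    (\<forall>n. norm (\<Psi> n) \<le> K * (c / cmod E) ^ n / (cmod E - c))" if E: "cmod E > c" for E
  proof -
    have E0: "E \<noteq> 0" "cmod E > 0" using E c by auto
    define f where "f n k = cscale (1 / E ^ Suc k) (g k n)" for n k
    define q where "q = c / cmod E"
    have q: "0 \<le> q" "q < 1" using E c E0 by (simp_all add: q_def)
    have f: "norm (f n k) \<le> K / cmod E * q ^ k" for n k
    proof -
      have "norm (f n k) \<le> 1 / cmod E ^ Suc k * (c ^ k * K)"
        unfolding f_def norm_cscale using g[of k n]
        by (intro mult_mono) (simp_all add: norm_divide norm_power norm_mult)
      also have "\<dots> = K / cmod E * q ^ k" by (simp add: q_def power_divide)
      finally show ?thesis .
    qed
    have summ: "summable (f n)" for n
      by (rule summable_comparison_test'[OF summable_mult[OF summable_geometric[of q]], of 0 _ "K / cmod E"])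
        (use q f in auto)
    define S where "S n = suminf (f n)" for n
    have S: "f n sums S n" for n unfolding S_def by (rule summable_sums[OF summ])
    have mult: "(\<lambda>k. M ** f n k) sums (M ** S n)" for M :: "complex^'l^'l" and n
      by (rule bounded_linear.sums[OF bounded_linear_matrix_mult S])
    have "jacobi_mat A B S n = cscale E (S n - f n 0)" for n
    proof -
      have "(\<lambda>k. jacobi_mat A B (\<lambda>m. f m k) n) sums jacobi_mat A B S n"
        unfolding jacobi_mat_def by (cases "n = 0") (auto intro!: sums_add mult)
      moreover have "jacobi_mat A B (\<lambda>m. f m k) n = cscale E (f n (Suc k))" for k
      proof -
        have "jacobi_mat A B (\<lambda>m. f m k) n = cscale (1 / E ^ Suc k) (g (Suc k) n)"
          by (simp add: f_def g_def jacobi_mat_def cscale_mult_right cscale_add)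
        also have "\<dots> = cscale E (f n (Suc k))" using E0 by (simp add: f_def)
        finally show ?thesis .
      qed
      ultimately have "(\<lambda>k. cscale E (f n (Suc k))) sums jacobi_mat A B S n" by simp
      moreover have "(\<lambda>k. f n (Suc k)) sums (S n - f n 0)" using S[of n] by (simp add: sums_Suc_iff)
      then have "(\<lambda>k. cscale E (f n (Suc k))) sums cscale E (S n - f n 0)"
        by (rule bounded_linear.sums[OF bounded_linear_cscale])
      ultimately show ?thesis by (rule sums_unique2)
    qed
    note JS = this
    \<comment> \<open>The series \<open>S\<close> belongs to the inverse of E - J, hence the
      sign.\<close>
    have "jacobi_mat A B (\<lambda>n. - S n) n - cscale E (- S n) = (if n = 0 then mat 1 else 0)" for n
    proof -
      have "jacobi_mat A B (\<lambda>n. - S n) n = - jacobi_mat A B S n"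
        by (simp add: jacobi_mat_def matrix_neg_right)
      moreover have "cscale E (f n 0) = (if n = 0 then mat 1 else 0)"
        using E0 by (simp add: f_def g_def)
      ultimately show ?thesis by (simp add: JS cscale_diff cscale_minus cscale_minus_left)
    qed
    moreover have "norm (- S n) \<le> K * (c / cmod E) ^ n / (cmod E - c)" for n
    proof -
      \<comment> \<open>Finite propagation lets the geometric series start at the index
        \<open>n\<close>.\<close>
      have "f n k = 0" if "k < n" for k
        using that unfolding f_def g_def by (simp add: jacobi_iterate_support)
      then have "S n = (\<Sum>k. f n (k + n))"
        using suminf_split_initial_segment[OF summ, of n n] by (simp add: S_def)
      also have "norm \<dots> \<le> (\<Sum>k. K / cmod E * q ^ n * q ^ k)"
      proof (rule norm_suminf_le)
        show "norm (f n (k + n)) \<le> K / cmod E * q ^ n * q ^ k" for k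
          using f[of n "k + n"] by (simp add: power_add mult_ac)
        show "summable (\<lambda>k. K / cmod E * q ^ n * q ^ k)"
          using q by (intro summable_mult summable_geometric) simp
      qed
      also have "\<dots> = K / cmod E * q ^ n * (1 / (1 - q))"
        using q by (subst suminf_mult) (auto simp: suminf_geometric summable_geometric)
      also have "\<dots> = K * (c / cmod E) ^ n / (cmod E - c)"
        using E E0 unfolding q_def by (simp add: field_simps)
      finally show ?thesis by simp
    qed
    ultimately show ?thesis by blast
  qed
  then show ?thesis using c(1) by blast
qed

section \<open>Integrals against a matrix measure as limits of sums\<close>

lemma psd_matrix_measure_nonneg:
  "psd_matrix_measure \<mu> \<Longrightarrow> S \<in> sets borel \<Longrightarrow> 0 \<le> Re (cinner v (\<mu> S *v v))"
  unfolding psd_matrix_measure_def psd_def by blast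

lemma psd_cinner_real: "psd M \<Longrightarrow> complex_of_real (Re (cinner v (M *v v))) = cinner v (M *v v)"
  unfolding psd_def using hermitian_cinner_Im[of M v] by (simp add: complex_eq_iff)

text \<open>Carries convergence of matrix series and of matrix limits over to the quadratic
  forms.\<close>

lemma bounded_linear_cinner: "bounded_linear (\<lambda>M. Re (cinner v ((M :: complex^'n^'n) *v v)))"
proof (rule bounded_linear_intro)
  show "Re (cinner v ((x + y) *v v)) = Re (cinner v (x *v v)) + Re (cinner v (y *v v))"
    for x y :: "complex^'n^'n"
    by (simp add: matrix_vector_mult_add_rdistrib cinner_add_right)
  show "Re (cinner v ((r *\<^sub>R x) *v v)) = r *\<^sub>R Re (cinner v (x *v v))" for r and x :: "complex^'n^'n"
  proof -
    have "(r *\<^sub>R x) *v v = of_real r *s (x *v v)"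
      by (simp only: vec_eq_iff matrix_vector_mult_def vec_lambda_beta vector_scaleR_component
          vector_smult_component scaleR_conv_of_real[where 'a = complex] sum_distrib_left mult.assoc simp_thms)
    then show ?thesis by (simp add: cinner_scale_right)
  qed
  show "norm (Re (cinner v (x *v v))) \<le> norm x * (norm v * norm v)" for x :: "complex^'n^'n"
  proof -
    have "norm (Re (cinner v (x *v v))) \<le> norm v * norm (x *v v)"
      using abs_Re_le_cmod norm_cinner_le order_trans by fastforce
    also have "\<dots> \<le> norm v * (norm x * norm v)" by (intro mult_left_mono norm_mult_vec_le) simp
    finally show ?thesis by (simp add: mult_ac)
  qed
qed

text \<open>\<open>measure_of\<close> returns the prescribed values only for a countably additive
  set function. Additivity is inherited from the matrix series through the bounded linear map
  \<open>Re (cinner v (_ *v v))\<close>.\<close>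

lemma
  assumes \<mu>: "psd_matrix_measure \<mu>"
  shows sets_quad_measure [simp]: "sets (quad_measure \<mu> v) = sets borel"
    and space_quad_measure [simp]: "space (quad_measure \<mu> v) = UNIV"
    and emeasure_quad_measure:
      "S \<in> sets borel \<Longrightarrow> emeasure (quad_measure \<mu> v) S = ennreal (Re (cinner v (\<mu> S *v v)))"
proof -
  let ?e = "\<lambda>S. ennreal (Re (cinner v (\<mu> S *v v)))"
  have ss: "sigma_sets UNIV (sets borel) = (sets borel :: real set set)"
    using sets.sigma_sets_eq[of borel] by simp
  show "sets (quad_measure \<mu> v) = sets borel"
    unfolding quad_measure_def by (simp add: ss)
  show "space (quad_measure \<mu> v) = UNIV"
    unfolding quad_measure_def by (simp add: space_measure_of_conv)
  show "emeasure (quad_measure \<mu> v) S = ?e S" if S: "S \<in> sets borel"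
    unfolding quad_measure_def
  proof (rule emeasure_measure_of_sigma)
    show "sigma_algebra UNIV (sets (borel :: real measure))"
      using sets.sigma_algebra_axioms[of "borel :: real measure"] by simp
    have add: "(\<lambda>i. Re (cinner v (\<mu> (X i) *v v))) sums Re (cinner v (\<mu> (\<Union>i. X i) *v v))"
      if "range X \<subseteq> sets borel" "disjoint_family X" for X :: "nat \<Rightarrow> real set"
    proof -
      have "(\<lambda>n. \<mu> (X n)) sums \<mu> (\<Union>n. X n)"
        using \<mu> that unfolding psd_matrix_measure_def by blast
      then show ?thesis by (rule bounded_linear.sums[OF bounded_linear_cinner])
    qed
    have "Re (cinner v (\<mu> {} *v v)) = 0"
    proof -
      \<comment> \<open>Additivity for the constant family of empty sets: a summable constant series
        is zero.\<close>
      have "(\<lambda>i. Re (cinner v (\<mu> {} *v v))) sums Re (cinner v (\<mu> {} *v v))"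
        using add[of "\<lambda>_. {}"] by (simp add: disjoint_family_on_def)
      then show ?thesis using sums_summable summable_const_iff by blast
    qed
    then show "positive (sets borel) ?e" by (simp add: positive_def)
    show "countably_additive (sets borel) ?e"
    proof (rule countably_additiveI)
      fix X :: "nat \<Rightarrow> real set"
      assume X: "range X \<subseteq> sets borel" "disjoint_family X"
      have nn: "0 \<le> Re (cinner v (\<mu> (X i) *v v))" for i
        using X(1) psd_matrix_measure_nonneg[OF \<mu>] by blast
      show "(\<Sum>i. ?e (X i)) = ?e (\<Union>i. X i)"
        by (rule suminf_ennreal_eq[OF nn add[OF X]])
    qed
    show "S \<in> sets borel" by (rule S)
  qed
qed

lemma finite_measure_quad_measure:
  assumes "psd_matrix_measure \<mu>"
  shows "finite_measure (quad_measure \<mu> v)"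
  by (rule finite_measureI) (simp add: assms emeasure_quad_measure)

lemma measure_quad_measure:
  assumes "psd_matrix_measure \<mu>" "S \<in> sets borel"
  shows "measure (quad_measure \<mu> v) S = Re (cinner v (\<mu> S *v v))"
  unfolding measure_def emeasure_quad_measure[OF assms]
  using psd_matrix_measure_nonneg[OF assms] by simp

lemma cinner_polarization:
  "(\<Sum>p<4. (-\<i>)^p * cinner (axis j 1 + \<i>^p *s axis k 1) (M *v (axis j 1 + \<i>^p *s axis k 1))) / 4
     = (M :: complex^'n^'n) $ j $ k"
  by (simp add: eval_nat_numeral cinner_add_right cinner_add_left cinner_scale_left cinner_scale_right
      matrix_vector_right_distrib vector_scalar_commute cinner_axis_matrix algebra_simps)

lemma measure_polarization:
  assumes "psd_matrix_measure \<mu>" "S \<in> sets borel"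
  shows "(\<Sum>p<4. (-\<i>)^p * of_real (measure (quad_measure \<mu> (axis j 1 + \<i>^p *s axis k 1)) S)) / 4
    = \<mu> S $ j $ k"
proof -
  have "psd (\<mu> S)" using assms unfolding psd_matrix_measure_def by blast
  then show ?thesis
    unfolding measure_quad_measure[OF assms] psd_cinner_real[OF \<open>psd (\<mu> S)\<close>]
    by (rule_tac cinner_polarization)
qed

section \<open>Riemann sums over an equidistant partition\<close>

definition cell :: "real \<Rightarrow> nat \<Rightarrow> nat \<Rightarrow> real set" where
  "cell N n i = {- N + 2 * N * i / Suc n ..< - N + 2 * N * Suc i / Suc n}"

definition node :: "real \<Rightarrow> nat \<Rightarrow> nat \<Rightarrow> real" where
  "node N n i = - N + 2 * N * i / Suc n"

lemma cell_borel [simp]: "cell N n i \<in> sets borel"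
  by (simp add: cell_def)

lemma node_bound: "N \<ge> 0 \<Longrightarrow> i \<le> n \<Longrightarrow> \<bar>node N n i\<bar> \<le> N"
proof -
  assume N: "N \<ge> 0" and "i \<le> n"
  then have "real i / Suc n \<le> 1" by (simp add: divide_le_eq)
  then have "N * (real i / Suc n) \<le> N * 1" using N by (rule_tac mult_left_mono)
  moreover have "0 \<le> N * (real i / Suc n)" using N by simp
  ultimately show ?thesis unfolding node_def by (simp add: abs_le_iff)
qed

text \<open>For \<open>i \<le> n\<close> the half-open cells partition the window from
  \<open>- N\<close> (included) to \<open>N\<close> (excluded); dividing by \<open>Suc n\<close>
  keeps \<open>n = 0\<close> meaningful.\<close>

lemma cell_exists:
  assumes "N > 0" "- N \<le> x" "x < N"
  shows "\<exists>i\<le>n. x \<in> cell N n i"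
proof -
  define t where "t = (x + N) * Suc n / (2 * N)"
  have t: "0 \<le> t" "t < Suc n" using assms by (simp_all add: t_def divide_less_eq)
  define i where "i = nat \<lfloor>t\<rfloor>"
  have i: "real i \<le> t" "t < real i + 1" using t(1) by (simp_all add: i_def)
  then have "i \<le> n" using t(2) by linarith
  moreover have "2 * N * t = (x + N) * Suc n" using assms(1) by (simp add: t_def del: of_nat_Suc)
  then have x: "x = - N + 2 * N * t / Suc n" by (simp del: of_nat_Suc)
  have "2 * N * i / Suc n \<le> 2 * N * t / Suc n"
    using i assms(1) by (intro divide_right_mono mult_left_mono) auto
  moreover have "2 * N * t / Suc n < 2 * N * Suc i / Suc n"
    using i assms(1) by (intro divide_strict_right_mono mult_strict_left_mono) auto
  ultimately show ?thesis unfolding cell_def using x by (intro exI[of _ i]) auto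
qed

lemma cell_disjoint:
  assumes "N > 0" "x \<in> cell N n i" "x \<in> cell N n j"
  shows "i = j"
proof (rule ccontr)
  assume "i \<noteq> j"
  have *: False if "i < j" "x \<in> cell N n i" "x \<in> cell N n j" for i j
  proof -
    have "2 * N * Suc i / Suc n \<le> 2 * N * j / Suc n"
      using that(1) assms(1) by (intro divide_right_mono mult_left_mono) auto
    then show False using that(2,3) unfolding cell_def by (simp del: of_nat_Suc)
  qed
  then show False using \<open>i \<noteq> j\<close> assms(2,3) *[of i j] *[of j i] by linarith
qed

lemma cell_node_dist: "x \<in> cell N n i \<Longrightarrow> \<bar>node N n i - x\<bar> \<le> 2 * N / Suc n"
  unfolding cell_def node_def by (auto simp: abs_le_iff add_divide_distrib algebra_simps)

definition step :: "real \<Rightarrow> (real \<Rightarrow> complex) \<Rightarrow> nat \<Rightarrow> real \<Rightarrow> complex" where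
  "step N \<phi> n x = (\<Sum>i\<le>n. indicator (cell N n i) x *\<^sub>R \<phi> (node N n i))"

lemma step_eq:
  assumes "N > 0" "i \<le> n" "x \<in> cell N n i"
  shows "step N \<phi> n x = \<phi> (node N n i)"
proof -
  have "step N \<phi> n x = (\<Sum>j\<le>n. if j = i then \<phi> (node N n i) else 0)"
    unfolding step_def
  proof (rule sum.cong[OF refl])
    fix j
    show "indicator (cell N n j) x *\<^sub>R \<phi> (node N n j) = (if j = i then \<phi> (node N n i) else 0)"
    proof (cases "j = i")
      case False
      then have "x \<notin> cell N n j" using cell_disjoint[OF assms(1,3)] by blast
      then show ?thesis using False by simp
    qed (simp add: assms(3))
  qed
  then show ?thesis using assms(2) by simp
qed

lemma step_tendsto:
  assumes "N > 0" "- N \<le> x" "x < N" "continuous_on UNIV \<phi>"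
  shows "(\<lambda>n. step N \<phi> n x) \<longlonglongrightarrow> \<phi> x"
proof -
  have "\<forall>n. \<exists>i\<le>n. x \<in> cell N n i" using cell_exists assms by blast
  then obtain i where i: "\<And>n. i n \<le> n" "\<And>n. x \<in> cell N n (i n)" by metis
  have "(\<lambda>n. 2 * N / Suc n) \<longlonglongrightarrow> 0"
    using tendsto_mult_right_zero[OF LIMSEQ_inverse_real_of_nat, of "2 * N"] by (simp add: divide_inverse)
  then have "(\<lambda>n. node N n (i n) - x) \<longlonglongrightarrow> 0"
    by (rule Lim_null_comparison[rotated]) (simp add: cell_node_dist i del: of_nat_Suc)
  then have "(\<lambda>n. node N n (i n)) \<longlonglongrightarrow> x" using Lim_null by blast
  moreover have "isCont \<phi> x" using assms(4) continuous_on_eq_continuous_at open_UNIV by blast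
  ultimately have "(\<lambda>n. \<phi> (node N n (i n))) \<longlonglongrightarrow> \<phi> x" by (rule_tac isCont_tendsto_compose)
  then show ?thesis using step_eq[OF assms(1) i] by simp
qed

lemma step_bounded:
  assumes "N > 0" "continuous_on UNIV \<phi>"
  shows "\<exists>C. \<forall>n x. cmod (step N \<phi> n x) \<le> C"
proof -
  have "compact (\<phi> ` {-N..N})"
    by (intro compact_continuous_image continuous_on_subset[OF assms(2)]) auto
  then have "bounded (\<phi> ` {-N..N})" by (rule compact_imp_bounded)
  then obtain C where "\<forall>y\<in>\<phi> ` {-N..N}. cmod y \<le> C" unfolding bounded_iff by blast
  then have C: "cmod (\<phi> x) \<le> C" if "x \<in> {-N..N}" for x using that by blast
  have "cmod (\<phi> 0) \<le> C" using C[of 0] assms(1) by simp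
  then have C0: "C \<ge> 0" using norm_ge_zero[of "\<phi> 0"] by linarith
  have "cmod (step N \<phi> n x) \<le> C" for n x
  proof (cases "\<exists>i\<le>n. x \<in> cell N n i")
    case True
    then obtain i where i: "i \<le> n" "x \<in> cell N n i" by blast
    have "\<bar>node N n i\<bar> \<le> N" using node_bound[OF _ i(1)] assms(1) by simp
    then show ?thesis unfolding step_eq[OF assms(1) i] by (intro C) auto
  next
    case False
    then have "step N \<phi> n x = 0" unfolding step_def by (intro sum.neutral) auto
    then show ?thesis using C0 by simp
  qed
  then show ?thesis by blast
qed

text \<open>Dominated convergence for the step functions. They vanish outside the window, but the
  measure has no mass there; \<open>b < N\<close> is strict because the last cell omits its right
  end.\<close>

lemma quad_integral_limit:
  fixes \<phi> :: "real \<Rightarrow> complex"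
  assumes \<mu>: "psd_matrix_measure \<mu>" and supp: "\<mu> (- {a..b}) = 0"
    and N: "N > 0" "- N \<le> a" "b < N" and \<phi>: "continuous_on UNIV \<phi>"
  shows "(\<lambda>n. \<Sum>i\<le>n. \<phi> (node N n i) * of_real (measure (quad_measure \<mu> v) (cell N n i)))
    \<longlonglongrightarrow> (\<integral>x. \<phi> x \<partial>quad_measure \<mu> v)"
proof -
  let ?M = "quad_measure \<mu> v"
  interpret finite_measure ?M by (rule finite_measure_quad_measure[OF \<mu>])
  obtain C where C: "\<And>n x. cmod (step N \<phi> n x) \<le> C" using step_bounded[OF N(1) \<phi>] by blast
  have meas: "borel_measurable ?M = borel_measurable borel"
    by (rule measurable_cong_sets) (simp_all add: \<mu>)
  have "(\<lambda>n. \<integral>x. step N \<phi> n x \<partial>?M) \<longlonglongrightarrow> (\<integral>x. \<phi> x \<partial>?M)"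
  proof (rule integral_dominated_convergence[where w = "\<lambda>_. C"])
    show "\<phi> \<in> borel_measurable ?M" unfolding meas by (rule borel_measurable_continuous_onI[OF \<phi>])
    show "step N \<phi> n \<in> borel_measurable ?M" for n
      unfolding meas step_def
      by (intro borel_measurable_sum borel_measurable_scaleR borel_measurable_indicator
          borel_measurable_const cell_borel)
    show "integrable ?M (\<lambda>_. C)" by simp
    show "AE x in ?M. (\<lambda>n. step N \<phi> n x) \<longlonglongrightarrow> \<phi> x"
    proof (rule AE_I[where N = "- {a..b}"])
      show "{x \<in> space ?M. \<not> (\<lambda>n. step N \<phi> n x) \<longlonglongrightarrow> \<phi> x} \<subseteq> - {a..b}"
      proof (rule ccontr)
        assume "\<not> ?thesis"
        then obtain x where "a \<le> x" "x \<le> b" "\<not> (\<lambda>n. step N \<phi> n x) \<longlonglongrightarrow> \<phi> x" by auto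
        then show False using step_tendsto[OF N(1) _ _ \<phi>, of x] N by simp
      qed
      show "emeasure ?M (- {a..b}) = 0" by (simp add: emeasure_quad_measure[OF \<mu>] supp)
      show "- {a..b} \<in> sets ?M" by (simp add: \<mu>)
    qed
    show "AE x in ?M. norm (step N \<phi> n x) \<le> C" for n by (simp add: C)
  qed
  moreover have "(\<integral>x. step N \<phi> n x \<partial>?M) = (\<Sum>i\<le>n. \<phi> (node N n i) * of_real (measure ?M (cell N n i)))" for n
  proof -
    have int: "integrable ?M (indicator (cell N n i) :: real \<Rightarrow> real)" for i
      by (rule integrable_real_indicator) (simp_all add: \<mu> top.not_eq_extremum[symmetric])
    have "(\<integral>x. step N \<phi> n x \<partial>?M) = (\<Sum>i\<le>n. \<integral>x. indicator (cell N n i) x *\<^sub>R \<phi> (node N n i) \<partial>?M)"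
      unfolding step_def by (rule Bochner_Integration.integral_sum) (simp add: int)
    also have "\<dots> = (\<Sum>i\<le>n. measure ?M (cell N n i) *\<^sub>R \<phi> (node N n i))"
      by (intro sum.cong refl) (simp add: int \<mu>)
    finally show ?thesis by (simp add: scaleR_conv_of_real mult.commute)
  qed
  ultimately show ?thesis by simp
qed

text \<open>Summing over \<open>p\<close> inside the Riemann sum undoes the polarization, so the
  weights become entries of \<open>\<mu> (cell N n i)\<close>.\<close>

lemma entry_integral_limit:
  assumes \<mu>: "psd_matrix_measure \<mu>" and supp: "\<mu> (- {a..b}) = 0"
    and N: "N > 0" "- N \<le> a" "b < N" and \<phi>: "continuous_on UNIV \<phi>"
  shows "(\<lambda>n. \<Sum>i\<le>n. \<phi> (node N n i) * \<mu> (cell N n i) $ j $ k) \<longlonglongrightarrow> entry_integral \<mu> j k \<phi>"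
proof -
  let ?M = "\<lambda>p. quad_measure \<mu> (axis j 1 + \<i>^p *s axis k 1)"
  have "(\<lambda>n. (\<Sum>p<4. (-\<i>)^p * (\<Sum>i\<le>n. \<phi> (node N n i) * of_real (measure (?M p) (cell N n i)))) / 4)
    \<longlonglongrightarrow> entry_integral \<mu> j k \<phi>"
    unfolding entry_integral_def
    by (intro tendsto_divide tendsto_sum tendsto_mult tendsto_const
        quad_integral_limit[OF assms]) simp
  moreover have "(\<Sum>p<4. (-\<i>)^p * (\<Sum>i\<le>n. \<phi> (node N n i) * of_real (measure (?M p) (cell N n i)))) / 4
    = (\<Sum>i\<le>n. \<phi> (node N n i) * \<mu> (cell N n i) $ j $ k)" for n
  proof -
    have "(\<Sum>p<4. (-\<i>)^p * (\<Sum>i\<le>n. \<phi> (node N n i) * of_real (measure (?M p) (cell N n i)))) / 4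
      = (\<Sum>p<4. \<Sum>i\<le>n. \<phi> (node N n i) * ((-\<i>)^p * of_real (measure (?M p) (cell N n i)))) / 4"
      by (simp add: sum_distrib_left mult_ac)
    also have "\<dots> = (\<Sum>i\<le>n. \<Sum>p<4. \<phi> (node N n i) * ((-\<i>)^p * of_real (measure (?M p) (cell N n i)))) / 4"
      by (subst sum.swap) simp
    also have "\<dots> = (\<Sum>i\<le>n. \<phi> (node N n i) * ((\<Sum>p<4. (-\<i>)^p * of_real (measure (?M p) (cell N n i))) / 4))"
      by (simp add: sum_distrib_left sum_divide_distrib)
    also have "\<dots> = (\<Sum>i\<le>n. \<phi> (node N n i) * \<mu> (cell N n i) $ j $ k)"
      using measure_polarization[OF \<mu>] by simp
    finally show ?thesis .
  qed
  ultimately show ?thesis by simp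
qed

lemma entry_integral_const:
  assumes \<mu>: "psd_matrix_measure \<mu>"
  shows "entry_integral \<mu> j k (\<lambda>_. c) = c * \<mu> UNIV $ j $ k"
proof -
  have "entry_integral \<mu> j k (\<lambda>_. c) =
    c * ((\<Sum>p<4. (-\<i>)^p * of_real (measure (quad_measure \<mu> (axis j 1 + \<i>^p *s axis k 1)) UNIV)) / 4)"
    unfolding entry_integral_def
    by (simp add: sum_distrib_left \<mu> scaleR_conv_of_real mult_ac)
  then show ?thesis using measure_polarization[OF \<mu>, of UNIV] by simp
qed

text \<open>\<open>form_integral\<close> is assembled entry by entry through polarization, which
  hides its sesquilinearity and positivity; a limit of sums with positive semidefinite weights shows
  both.\<close>

lemma form_integral_limit:
  assumes \<mu>: "psd_matrix_measure \<mu>" and supp: "\<mu> (- {a..b}) = 0"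
    and N: "N > 0" "- N \<le> a" "b < N"
    and f: "continuous_on UNIV f" and g: "continuous_on UNIV g"
  shows "(\<lambda>n. \<Sum>i\<le>n. hconj (f (node N n i)) ** \<mu> (cell N n i) ** g (node N n i))
    \<longlonglongrightarrow> form_integral \<mu> f g"
  unfolding tendsto_matrix_iff
proof (intro allI)
  fix r s
  have "(\<Sum>i\<le>n. hconj (f (node N n i)) ** \<mu> (cell N n i) ** g (node N n i)) $ r $ s =
    (\<Sum>j\<in>UNIV. \<Sum>k\<in>UNIV. \<Sum>i\<le>n.
      (cnj (f (node N n i) $ j $ r) * g (node N n i) $ k $ s) * \<mu> (cell N n i) $ j $ k)" for n
  proof -
    have "(hconj X ** W ** Y) $ r $ s = (\<Sum>j\<in>UNIV. \<Sum>k\<in>UNIV. (cnj (X $ j $ r) * Y $ k $ s) * W $ j $ k)"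
      for X W Y :: "complex^'a^'a"
    proof -
      have "(hconj X ** W ** Y) $ r $ s = (\<Sum>k\<in>UNIV. \<Sum>j\<in>UNIV. (cnj (X $ j $ r) * Y $ k $ s) * W $ j $ k)"
        by (simp add: matrix_matrix_mult_def sum_distrib_left sum_distrib_right mult_ac)
      also have "\<dots> = (\<Sum>j\<in>UNIV. \<Sum>k\<in>UNIV. (cnj (X $ j $ r) * Y $ k $ s) * W $ j $ k)"
        by (rule sum.swap)
      finally show ?thesis .
    qed
    then have "(\<Sum>i\<le>n. hconj (f (node N n i)) ** \<mu> (cell N n i) ** g (node N n i)) $ r $ s =
      (\<Sum>i\<le>n. \<Sum>j\<in>UNIV. \<Sum>k\<in>UNIV.
        (cnj (f (node N n i) $ j $ r) * g (node N n i) $ k $ s) * \<mu> (cell N n i) $ j $ k)"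
      by (simp add: sum_component)
    also have "\<dots> = (\<Sum>j\<in>UNIV. \<Sum>i\<le>n. \<Sum>k\<in>UNIV.
        (cnj (f (node N n i) $ j $ r) * g (node N n i) $ k $ s) * \<mu> (cell N n i) $ j $ k)"
      by (rule sum.swap)
    also have "\<dots> = (\<Sum>j\<in>UNIV. \<Sum>k\<in>UNIV. \<Sum>i\<le>n.
        (cnj (f (node N n i) $ j $ r) * g (node N n i) $ k $ s) * \<mu> (cell N n i) $ j $ k)"
      by (intro sum.cong refl sum.swap)
    finally show ?thesis .
  qed
  moreover have "(\<lambda>n. \<Sum>j\<in>UNIV. \<Sum>k\<in>UNIV. \<Sum>i\<le>n.
      (cnj (f (node N n i) $ j $ r) * g (node N n i) $ k $ s) * \<mu> (cell N n i) $ j $ k)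
      \<longlonglongrightarrow> form_integral \<mu> f g $ r $ s"
    unfolding form_integral_def vec_lambda_beta
    by (intro tendsto_sum entry_integral_limit[OF \<mu> supp N, where \<phi> = "\<lambda>x. cnj (f x $ _ $ r) * g x $ _ $ s"]
        continuous_intros f g)
  ultimately show "(\<lambda>n. (\<Sum>i\<le>n. hconj (f (node N n i)) ** \<mu> (cell N n i) ** g (node N n i)) $ r $ s)
      \<longlonglongrightarrow> form_integral \<mu> f g $ r $ s" by simp
qed

text \<open>Turns \<open>\<mu> UNIV = mat 1\<close> into the normalization of the form, with which
  orthonormalization starts.\<close>

lemma form_integral_const:
  assumes "psd_matrix_measure \<mu>"
  shows "form_integral \<mu> (\<lambda>_. mat 1) (\<lambda>_. mat 1) = \<mu> UNIV"
proof (rule matrix_eqI)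
  fix a b
  have "form_integral \<mu> (\<lambda>_. mat 1) (\<lambda>_. mat 1) $ a $ b =
    (\<Sum>j\<in>UNIV. if j = a then (\<Sum>k\<in>UNIV. if k = b then \<mu> UNIV $ j $ k else 0) else 0)"
    unfolding form_integral_def vec_lambda_beta entry_integral_const[OF assms]
  proof (rule sum.cong[OF refl])
    fix j
    show "(\<Sum>k\<in>UNIV. cnj (mat 1 $ j $ a) * mat 1 $ k $ b * \<mu> UNIV $ j $ k) =
      (if j = a then (\<Sum>k\<in>UNIV. if k = b then \<mu> UNIV $ j $ k else 0) else 0)"
      by (cases "j = a") (auto simp: mat_def if_distrib if_distribR cong: if_cong)
  qed
  also have "\<dots> = \<mu> UNIV $ a $ b" by simp
  finally show "form_integral \<mu> (\<lambda>_. mat 1) (\<lambda>_. mat 1) $ a $ b = \<mu> UNIV $ a $ b" .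
qed

section \<open>Positive semidefinite forms on matrix functions\<close>

lemma psd_mult: "psd W \<Longrightarrow> psd (hconj X ** W ** X)"
  unfolding psd_def hermitian_def
proof safe
  assume W: "hconj W = W" "\<forall>v. 0 \<le> Re (cinner v (W *v v))"
  show "hconj (hconj X ** W ** X) = hconj X ** W ** X"
    by (simp add: hconj_mult W(1) matrix_mul_assoc)
  fix v
  have "cinner v ((hconj X ** W ** X) *v v) = cinner v (hconj X *v (W *v (X *v v)))"
    by (simp add: matrix_vector_mul_assoc matrix_mul_assoc)
  also have "\<dots> = cinner (X *v v) (W *v (X *v v))"
    unfolding cinner_adjoint[of v "hconj X"] by simp
  finally show "0 \<le> Re (cinner v ((hconj X ** W ** X) *v v))" using W(2) by simp
qed

lemma psd_sum: "(\<And>i. i \<in> I \<Longrightarrow> psd (W i)) \<Longrightarrow> psd (\<Sum>i\<in>I. W i)"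
  by (induction I rule: infinite_finite_induct)
    (auto simp: psd_def hermitian_def hconj_add matrix_vector_mult_add_rdistrib cinner_add_right)

lemma psd_limit:
  assumes "X \<longlonglongrightarrow> L" "\<And>n. psd (X n)"
  shows "psd L"
  unfolding psd_def hermitian_def
proof safe
  have "(\<lambda>n. hconj (X n)) \<longlonglongrightarrow> hconj L" by (rule tendsto_hconj[OF assms(1)])
  moreover have "hconj (X n) = X n" for n using assms(2) by (simp add: psd_def hermitian_def)
  ultimately have "X \<longlonglongrightarrow> hconj L" by simp
  then show "hconj L = L" by (rule LIMSEQ_unique[OF _ assms(1)])
  fix v
  have "(\<lambda>n. Re (cinner v (X n *v v))) \<longlonglongrightarrow> Re (cinner v (L *v v))"
    by (rule bounded_linear.tendsto[OF bounded_linear_cinner assms(1)])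
  then show "0 \<le> Re (cinner v (L *v v))"
    by (rule LIMSEQ_le_const) (use assms(2) in \<open>auto simp: psd_def\<close>)
qed

lemma psd_cscale: "psd W \<Longrightarrow> 0 \<le> r \<Longrightarrow> psd (cscale (of_real r) W)"
  by (auto simp: psd_def hermitian_def hconj_cscale cscale_vec cinner_scale_right)

lemma psd_diag_nonneg: "psd W \<Longrightarrow> 0 \<le> Re (W $ i $ i)"
  unfolding psd_def cinner_axis_matrix[symmetric] by blast

text \<open>Real part of the trace. It is additive and nonnegative on positive semidefinite
  matrices, so it turns matrix inequalities into bounds for the Frobenius norm.\<close>

definition retrace :: "complex^'n^'n \<Rightarrow> real" where
  "retrace M = (\<Sum>i\<in>UNIV. Re (M $ i $ i))"

lemma retrace_add: "retrace (A + B) = retrace A + retrace B"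
  by (simp add: retrace_def sum.distrib)

lemma retrace_diff: "retrace (A - B) = retrace A - retrace B"
  by (simp add: retrace_def sum_subtractf)

lemma retrace_sum: "retrace (\<Sum>i\<in>I. W i) = (\<Sum>i\<in>I. retrace (W i))"
  by (induction I rule: infinite_finite_induct) (auto simp: retrace_add retrace_def[of 0])

lemma retrace_psd: "psd W \<Longrightarrow> 0 \<le> retrace W"
  unfolding retrace_def by (intro sum_nonneg psd_diag_nonneg)

lemma retrace_hconj_mult: "retrace (hconj X ** X) = (norm X)\<^sup>2"
proof -
  have "(norm X)\<^sup>2 = (\<Sum>i\<in>UNIV. \<Sum>j\<in>UNIV. (cmod (X $ i $ j))\<^sup>2)"
    by (simp add: norm_matrix_eq sum_nonneg)
  also have "\<dots> = (\<Sum>j\<in>UNIV. \<Sum>i\<in>UNIV. (cmod (X $ i $ j))\<^sup>2)" by (rule sum.swap)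
  also have "\<dots> = retrace (hconj X ** X)"
    unfolding retrace_def matrix_matrix_mult_def
    by (simp add: cmod_power2) (simp add: power2_eq_square)
  finally show ?thesis by simp
qed

definition xmul :: "(real \<Rightarrow> complex^'l^'l) \<Rightarrow> real \<Rightarrow> complex^'l^'l" where
  "xmul f x = cscale (of_real x) (f x)"

lemma continuous_on_cscale [continuous_intros]:
  assumes "continuous_on S c" "continuous_on S f"
  shows "continuous_on S (\<lambda>x. cscale (c x) (f x))"
  using assms unfolding continuous_on_def by (blast intro: tendsto_cscale)

lemma continuous_on_matrix_mult [continuous_intros]:
  fixes f :: "_ \<Rightarrow> complex^'n^'m" and g :: "_ \<Rightarrow> complex^'k^'n"
  assumes "continuous_on S f" "continuous_on S g"
  shows "continuous_on S (\<lambda>x. f x ** g x)"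
  using assms unfolding continuous_on_def by (blast intro: tendsto_matrix_mult)

lemma continuous_on_xmul [continuous_intros]: "continuous_on S f \<Longrightarrow> continuous_on S (xmul f)"
  unfolding xmul_def[abs_def] by (intro continuous_intros)

abbreviation cont :: "(real \<Rightarrow> complex^'l^'l) \<Rightarrow> bool" where
  "cont f \<equiv> continuous_on UNIV f"

text \<open>The single property of the integral on which the algebra below rests. The bound
  \<open>N\<close> on the nodes stands for the bounded support.\<close>

locale psd_form =
  fixes F :: "(real \<Rightarrow> complex^'l^'l) \<Rightarrow> (real \<Rightarrow> complex^'l^'l) \<Rightarrow> complex^'l^'l" and N :: real
  assumes approx: "\<exists>x W. (\<forall>n i. psd (W n i)) \<and> (\<forall>n i. i \<le> n \<longrightarrow> \<bar>x n i\<bar> \<le> N) \<and>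
    (\<forall>f g. cont f \<longrightarrow> cont g \<longrightarrow>
      (\<lambda>n. \<Sum>i\<le>(n::nat). hconj (f (x n i)) ** W n i ** g (x n i)) \<longlonglongrightarrow> F f g)"
begin

definition nodes_weights ::
  "(nat \<Rightarrow> nat \<Rightarrow> real) \<times> (nat \<Rightarrow> nat \<Rightarrow> complex^'l^'l)" where
  "nodes_weights = (SOME xW. (\<forall>n i. psd (snd xW n i)) \<and> (\<forall>n i. i \<le> n \<longrightarrow> \<bar>fst xW n i\<bar> \<le> N) \<and>
    (\<forall>f g. cont f \<longrightarrow> cont g \<longrightarrow>
      (\<lambda>n. \<Sum>i\<le>(n::nat). hconj (f (fst xW n i)) ** snd xW n i ** g (fst xW n i)) \<longlonglongrightarrow> F f g))"

abbreviation "nd \<equiv> fst nodes_weights"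
abbreviation "wt \<equiv> snd nodes_weights"

lemma nodes_weights:
  "psd (wt n i)" "i \<le> n \<Longrightarrow> \<bar>nd n i\<bar> \<le> N"
  "cont f \<Longrightarrow> cont g \<Longrightarrow>
    (\<lambda>n. \<Sum>i\<le>n. hconj (f (nd n i)) ** wt n i ** g (nd n i)) \<longlonglongrightarrow> F f g"
proof -
  have "\<exists>xW. (\<forall>n i. psd (snd xW n i)) \<and> (\<forall>n i. i \<le> n \<longrightarrow> \<bar>fst xW n i\<bar> \<le> N) \<and>
    (\<forall>f g. cont f \<longrightarrow> cont g \<longrightarrow>
      (\<lambda>n. \<Sum>i\<le>(n::nat). hconj (f (fst xW n i)) ** snd xW n i ** g (fst xW n i)) \<longlonglongrightarrow> F f g)"
    using approx by simp
  note * = someI_ex[OF this, folded nodes_weights_def]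
  show "psd (wt n i)" using * by blast
  show "i \<le> n \<Longrightarrow> \<bar>nd n i\<bar> \<le> N" using * by blast
  show "cont f \<Longrightarrow> cont g \<Longrightarrow>
    (\<lambda>n. \<Sum>i\<le>n. hconj (f (nd n i)) ** wt n i ** g (nd n i)) \<longlonglongrightarrow> F f g" using * by blast
qed

lemma hconj_wt: "hconj (wt n i) = wt n i"
  using nodes_weights(1) by (simp add: psd_def hermitian_def)

lemma F_add_right: "cont f \<Longrightarrow> cont g \<Longrightarrow> cont h \<Longrightarrow> F f (\<lambda>x. g x + h x) = F f g + F f h"
proof -
  assume c: "cont f" "cont g" "cont h"
  have "(\<lambda>n. \<Sum>i\<le>n. hconj (f (nd n i)) ** wt n i ** (g (nd n i) + h (nd n i))) \<longlonglongrightarrow> F f g + F f h"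
    using tendsto_add[OF nodes_weights(3)[OF c(1,2)] nodes_weights(3)[OF c(1,3)]]
    by (simp add: matrix_add_ldistrib sum.distrib)
  then show ?thesis
    using LIMSEQ_unique nodes_weights(3)[OF c(1) continuous_on_add[OF c(2,3)]] by blast
qed

lemma F_mult_right: "cont f \<Longrightarrow> cont g \<Longrightarrow> F f (\<lambda>x. g x ** C) = F f g ** C"
proof -
  assume c: "cont f" "cont g"
  have "(\<lambda>n. \<Sum>i\<le>n. hconj (f (nd n i)) ** wt n i ** (g (nd n i) ** C)) \<longlonglongrightarrow> F f g ** C"
    using tendsto_matrix_mult[OF nodes_weights(3)[OF c] tendsto_const[of C]]
    by (simp add: matrix_sum_left matrix_mul_assoc)
  moreover have "cont (\<lambda>x. g x ** C)" by (intro continuous_intros c)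
  ultimately show ?thesis using LIMSEQ_unique nodes_weights(3)[OF c(1)] by blast
qed

lemma F_hconj: "cont f \<Longrightarrow> cont g \<Longrightarrow> hconj (F f g) = F g f"
proof -
  assume c: "cont f" "cont g"
  have "(\<lambda>n. \<Sum>i\<le>n. hconj (g (nd n i)) ** wt n i ** f (nd n i)) \<longlonglongrightarrow> hconj (F f g)"
    using tendsto_hconj[OF nodes_weights(3)[OF c]]
    by (simp add: hconj_sum hconj_mult hconj_wt matrix_mul_assoc)
  then show ?thesis using LIMSEQ_unique nodes_weights(3)[OF c(2,1)] by blast
qed

lemma F_scalar: "cont f \<Longrightarrow> cont g \<Longrightarrow> continuous_on UNIV s \<Longrightarrow>
  F (\<lambda>x. cscale (s x) (f x)) g = F f (\<lambda>x. cscale (cnj (s x)) (g x))"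
proof -
  assume c: "cont f" "cont g" "continuous_on UNIV s"
  have c2: "cont (\<lambda>x. cscale (s x) (f x))" "cont (\<lambda>x. cscale (cnj (s x)) (g x))"
    by (intro continuous_intros c)+
  have "(\<lambda>n. \<Sum>i\<le>n. hconj (f (nd n i)) ** wt n i ** cscale (cnj (s (nd n i))) (g (nd n i)))
     \<longlonglongrightarrow> F (\<lambda>x. cscale (s x) (f x)) g"
    using nodes_weights(3)[OF c2(1) c(2)]
    by (simp add: hconj_cscale cscale_mult_left cscale_mult_right)
  then show ?thesis using LIMSEQ_unique nodes_weights(3)[OF c(1) c2(2)] by blast
qed

lemma F_psd: "cont f \<Longrightarrow> psd (F f f)"
  by (rule psd_limit[OF nodes_weights(3)]) (auto intro!: psd_sum psd_mult nodes_weights(1))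

text \<open>N^2 - x^2 is nonnegative at every node x. Multiplication by x is thus bounded, and this
  will bound the Jacobi coefficients.\<close>

lemma F_xmul_bound: "cont f \<Longrightarrow> psd (cscale (of_real (N\<^sup>2)) (F f f) - F (xmul f) (xmul f))"
proof -
  assume f: "cont f"
  let ?X = "\<lambda>n. \<Sum>i\<le>n. cscale (of_real (N\<^sup>2 - (nd n i)\<^sup>2)) (hconj (f (nd n i)) ** wt n i ** f (nd n i))"
  have "(\<lambda>n. cscale (of_real (N\<^sup>2)) (\<Sum>i\<le>n. hconj (f (nd n i)) ** wt n i ** f (nd n i))
    - (\<Sum>i\<le>n. hconj (xmul f (nd n i)) ** wt n i ** xmul f (nd n i)))
    \<longlonglongrightarrow> cscale (of_real (N\<^sup>2)) (F f f) - F (xmul f) (xmul f)"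
    by (intro tendsto_diff tendsto_cscale tendsto_const nodes_weights(3) f continuous_on_xmul)
  moreover have "cscale (of_real (N\<^sup>2)) (\<Sum>i\<le>n. hconj (f (nd n i)) ** wt n i ** f (nd n i))
    - (\<Sum>i\<le>n. hconj (xmul f (nd n i)) ** wt n i ** xmul f (nd n i)) = ?X n" for n
    unfolding cscale_sum sum_subtractf[symmetric] xmul_def
    by (intro sum.cong refl)
      (simp add: hconj_cscale cscale_mult_left cscale_mult_right cscale_diff_left power2_eq_square)
  ultimately have "?X \<longlonglongrightarrow> cscale (of_real (N\<^sup>2)) (F f f) - F (xmul f) (xmul f)" by simp
  then show ?thesis
  proof (rule psd_limit)
    fix n
    show "psd (?X n)"
    proof (rule psd_sum)
      fix i assume "i \<in> {..n}"
      then have "(nd n i)\<^sup>2 \<le> N\<^sup>2" using nodes_weights(2)[of i n] by (simp add: abs_le_square_iff[symmetric])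
      then show "psd (cscale (of_real (N\<^sup>2 - (nd n i)\<^sup>2)) (hconj (f (nd n i)) ** wt n i ** f (nd n i)))"
        by (intro psd_cscale psd_mult nodes_weights(1)) simp
    qed
  qed
qed

lemma F_mult_left: "cont f \<Longrightarrow> cont g \<Longrightarrow> F (\<lambda>x. f x ** C) g = hconj C ** F f g"
proof -
  assume c: "cont f" "cont g"
  have "cont (\<lambda>x. f x ** C)" by (intro continuous_intros c)
  then have "F (\<lambda>x. f x ** C) g = hconj (F g (\<lambda>x. f x ** C))" using F_hconj c by simp
  then show ?thesis using F_mult_right[OF c(2,1)] F_hconj[OF c(2,1)] by (simp add: hconj_mult)
qed

lemma F_add_left: "cont f \<Longrightarrow> cont g \<Longrightarrow> cont h \<Longrightarrow> F (\<lambda>x. g x + h x) f = F g f + F h f"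
proof -
  assume c: "cont f" "cont g" "cont h"
  have "F (\<lambda>x. g x + h x) f = hconj (F f (\<lambda>x. g x + h x))"
    using F_hconj[OF c(1) continuous_on_add[OF c(2,3)]] by simp
  then show ?thesis by (simp add: F_add_right c hconj_add F_hconj)
qed

lemma F_minus_right: "cont f \<Longrightarrow> cont g \<Longrightarrow> F f (\<lambda>x. - g x) = - F f g"
proof -
  assume c: "cont f" "cont g"
  have "(\<lambda>x. - g x) = (\<lambda>x. g x ** (- mat 1))" by (simp add: matrix_neg_right)
  then show ?thesis using F_mult_right[OF c, of "- mat 1"] by (simp add: matrix_neg_right)
qed

lemma F_diff_right: "cont f \<Longrightarrow> cont g \<Longrightarrow> cont h \<Longrightarrow> F f (\<lambda>x. g x - h x) = F f g - F f h"
  using F_add_right[of f g "\<lambda>x. - h x"] F_minus_right[of f h] continuous_on_minus[of UNIV h]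
  by simp

lemma F_diff_left: "cont f \<Longrightarrow> cont g \<Longrightarrow> cont h \<Longrightarrow> F (\<lambda>x. g x - h x) f = F g f - F h f"
proof -
  assume c: "cont f" "cont g" "cont h"
  have "F (\<lambda>x. g x - h x) f = hconj (F f (\<lambda>x. g x - h x))"
    using F_hconj[OF c(1) continuous_on_diff[OF c(2,3)]] by simp
  then show ?thesis by (simp add: F_diff_right c hconj_diff F_hconj)
qed

lemma F_zero_right: "cont f \<Longrightarrow> F f (\<lambda>_. 0) = 0"
  using F_diff_right[of f f f] by simp

lemma F_sum_right:
  assumes "cont f" "\<And>k. k \<in> K \<Longrightarrow> cont (g k)"
  shows "F f (\<lambda>x. \<Sum>k\<in>K. g k x) = (\<Sum>k\<in>K. F f (g k))"
  using assms(2)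
proof (induction K rule: infinite_finite_induct)
  case (insert k K)
  have "F f (\<lambda>x. g k x + (\<Sum>k\<in>K. g k x)) = F f (g k) + F f (\<lambda>x. \<Sum>k\<in>K. g k x)"
    by (intro F_add_right assms(1) insert.prems continuous_on_sum) auto
  then show ?case using insert by simp
qed (simp_all add: F_zero_right assms(1))

lemma F_xmul: "cont f \<Longrightarrow> cont g \<Longrightarrow> F (xmul f) g = F f (xmul g)"
  unfolding xmul_def[abs_def] using F_scalar[of f g complex_of_real]
  by (simp add: continuous_on_of_real_id)

end

section \<open>Matrix polynomials with invertible leading coefficient\<close>

text \<open>Degree below \<open>n\<close>. In particular \<open>pol 0\<close> holds for the zero
  function alone, which serves as the polynomial of index -1.\<close>

definition pol :: "nat \<Rightarrow> (real \<Rightarrow> complex^'l^'l) \<Rightarrow> bool" where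
  "pol n f \<longleftrightarrow> (\<exists>C. f = (\<lambda>x. \<Sum>k<n. cscale (of_real x ^ k) (C k)))"

text \<open>Invertibility of the leading coefficient keeps \<open>f x ** M\<close> a nonzero
  polynomial for every \<open>M \<noteq> 0\<close>, so that nontriviality of the measure applies to
  it.\<close>

definition lead :: "nat \<Rightarrow> (real \<Rightarrow> complex^'l^'l) \<Rightarrow> bool" where
  "lead n f \<longleftrightarrow> (\<exists>L r. invertible L \<and> pol n r \<and> f = (\<lambda>x. cscale (of_real x ^ n) L + r x))"

lemma pol_0: "pol n (\<lambda>_. 0)"
  unfolding pol_def by (intro exI[of _ "\<lambda>_. 0"]) simp

lemma pol_add: "pol n f \<Longrightarrow> pol n g \<Longrightarrow> pol n (\<lambda>x. f x + g x)"
proof -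
  assume "pol n f" "pol n g"
  then obtain C D where "f = (\<lambda>x. \<Sum>k<n. cscale (of_real x ^ k) (C k))"
    "g = (\<lambda>x. \<Sum>k<n. cscale (of_real x ^ k) (D k))" unfolding pol_def by blast
  then show ?thesis unfolding pol_def
    by (intro exI[of _ "\<lambda>k. C k + D k"]) (simp add: cscale_add sum.distrib)
qed

lemma pol_mult: "pol n f \<Longrightarrow> pol n (\<lambda>x. f x ** M)"
proof -
  assume "pol n f"
  then obtain C where "f = (\<lambda>x. \<Sum>k<n. cscale (of_real x ^ k) (C k))" unfolding pol_def by blast
  then show ?thesis unfolding pol_def
    by (intro exI[of _ "\<lambda>k. C k ** M"]) (simp add: matrix_sum_left cscale_mult_left)
qed

lemma pol_diff: "pol n f \<Longrightarrow> pol n g \<Longrightarrow> pol n (\<lambda>x. f x - g x)"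
  using pol_add[of n f "\<lambda>x. g x ** (- mat 1)"] pol_mult[of n g "- mat 1"]
  by (simp add: matrix_neg_right)

lemma pol_mono: "pol n f \<Longrightarrow> n \<le> m \<Longrightarrow> pol m f"
proof -
  assume "pol n f" "n \<le> m"
  then obtain C where f: "f = (\<lambda>x. \<Sum>k<n. cscale (of_real x ^ k) (C k))" unfolding pol_def by blast
  have "f = (\<lambda>x. \<Sum>k<m. cscale (of_real x ^ k) (if k < n then C k else 0))"
    unfolding f using \<open>n \<le> m\<close>
    by (intro ext sum.mono_neutral_cong_left) auto
  then show ?thesis unfolding pol_def
    by (intro exI[of _ "\<lambda>k. if k < n then C k else 0"])
qed

lemma pol_xmul: "pol n f \<Longrightarrow> pol (Suc n) (xmul f)"
proof -
  assume "pol n f"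
  then obtain C where f: "f = (\<lambda>x. \<Sum>k<n. cscale (of_real x ^ k) (C k))" unfolding pol_def by blast
  define D where "D k = (case k of 0 \<Rightarrow> 0 | Suc j \<Rightarrow> C j)" for k
  have "xmul f = (\<lambda>x. \<Sum>k<Suc n. cscale (of_real x ^ k) (D k))"
    unfolding xmul_def[abs_def] f sum.lessThan_Suc_shift by (simp add: D_def cscale_sum)
  then show ?thesis unfolding pol_def by blast
qed

lemma lead_imp_pol: "lead n f \<Longrightarrow> pol (Suc n) f"
proof -
  assume "lead n f"
  then obtain L r where *: "pol n r" "f = (\<lambda>x. cscale (of_real x ^ n) L + r x)"
    unfolding lead_def by blast
  have "pol (Suc n) (\<lambda>x. cscale (of_real x ^ n) L)" unfolding pol_def
    by (intro exI[of _ "\<lambda>k. if k = n then L else 0"]) simp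
  then show ?thesis unfolding *(2) by (rule pol_add) (rule pol_mono[OF *(1)], simp)
qed

lemma lead_xmul: "lead n f \<Longrightarrow> lead (Suc n) (xmul f)"
proof -
  assume "lead n f"
  then obtain L r where *: "invertible L" "pol n r" "f = (\<lambda>x. cscale (of_real x ^ n) L + r x)"
    unfolding lead_def by blast
  have "xmul f = (\<lambda>x. cscale (of_real x ^ Suc n) L + xmul r x)"
    unfolding xmul_def[abs_def] *(3) by (simp add: cscale_add)
  then show ?thesis unfolding lead_def using *(1) pol_xmul[OF *(2)] by blast
qed

lemma lead_diff: "lead n f \<Longrightarrow> pol n g \<Longrightarrow> lead n (\<lambda>x. f x - g x)"
proof -
  assume "lead n f" "pol n g"
  then obtain L r where *: "invertible L" "pol n r" "f = (\<lambda>x. cscale (of_real x ^ n) L + r x)"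
    unfolding lead_def by blast
  have "(\<lambda>x. f x - g x) = (\<lambda>x. cscale (of_real x ^ n) L + (r x - g x))" unfolding *(3) by (simp add: add_diff_eq)
  then show ?thesis unfolding lead_def using *(1) pol_diff[OF *(2) \<open>pol n g\<close>] by blast
qed

lemma lead_mult: "lead n f \<Longrightarrow> invertible M \<Longrightarrow> lead n (\<lambda>x. f x ** M)"
proof -
  assume "lead n f" "invertible M"
  then obtain L r where *: "invertible L" "pol n r" "f = (\<lambda>x. cscale (of_real x ^ n) L + r x)"
    unfolding lead_def by blast
  have "(\<lambda>x. f x ** M) = (\<lambda>x. cscale (of_real x ^ n) (L ** M) + r x ** M)" unfolding *(3)
    by (simp add: matrix_add_rdistrib cscale_mult_left)
  then show ?thesis unfolding lead_def
    using invertible_mult[OF *(1) \<open>invertible M\<close>] pol_mult[OF *(2)] by blast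
qed

lemma pol_cont: "pol n f \<Longrightarrow> cont f"
  unfolding pol_def by (auto intro!: continuous_intros)

lemma lead_cont: "lead n f \<Longrightarrow> cont f"
  using lead_imp_pol pol_cont by blast

lemma lead_matrix_poly:
  assumes "lead n f" "M \<noteq> 0"
  shows "\<exists>P. P \<noteq> 0 \<and> (\<lambda>x. f x ** M) = matrix_poly P"
proof -
  obtain L r where *: "invertible L" "pol n r" "f = (\<lambda>x. cscale (of_real x ^ n) L + r x)"
    using assms(1) unfolding lead_def by blast
  obtain C where r: "r = (\<lambda>x. \<Sum>k<n. cscale (of_real x ^ k) (C k))" using *(2) unfolding pol_def by blast
  define P where "P = (\<chi> i j. monom ((L ** M) $ i $ j) n + (\<Sum>k<n. monom ((C k ** M) $ i $ j) k))"
  have "(\<lambda>x. f x ** M) = matrix_poly P"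
  proof
    fix x
    have "f x ** M = cscale (of_real x ^ n) (L ** M) + (\<Sum>k<n. cscale (of_real x ^ k) (C k ** M))"
      unfolding *(3) r by (simp add: matrix_add_rdistrib cscale_mult_left matrix_sum_left)
    then show "f x ** M = matrix_poly P x"
      by (intro matrix_eqI) (simp add: matrix_poly_def P_def poly_monom poly_sum sum_component mult.commute)
  qed
  moreover have "P \<noteq> 0"
  proof
    assume "P = 0"
    have "(L ** M) $ i $ j = 0" for i j
    proof -
      have "coeff (P $ i $ j) n = (L ** M) $ i $ j"
        by (simp add: P_def coeff_sum)
      then show ?thesis using \<open>P = 0\<close> by simp
    qed
    then have "L ** M = 0" by (simp add: vec_eq_iff)
    then have "matrix_inv L ** (L ** M) = 0" by simp
    then show False using assms(2) matrix_inv_mult(2)[OF *(1)] by (simp add: matrix_mul_assoc)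
  qed
  ultimately show ?thesis by blast
qed

section \<open>Orthonormal polynomials and the block Jacobi matrix of a measure\<close>

lemma mult_mat_right: "M ** mat c = cscale c (M :: complex^'n^'m)"
  using cscale_mult_right[of M c "mat 1"] by (simp add: cscale_mat)

locale nontrivial_form = psd_form F N
  for F :: "(real \<Rightarrow> complex^'l^'l) \<Rightarrow> (real \<Rightarrow> complex^'l^'l) \<Rightarrow> complex^'l^'l" and N :: real +
  assumes nontrivial: "\<And>P. P \<noteq> 0 \<Longrightarrow> F (matrix_poly P) (matrix_poly P) \<noteq> 0"
    and normalized: "F (\<lambda>_. mat 1) (\<lambda>_. mat 1) = mat 1"
begin

lemma F_lead_positive:
  fixes v :: "complex^'l"
  assumes "lead n f" "v \<noteq> 0"
  shows "0 < Re (cinner v (F f f *v v))"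
proof -
  \<comment> \<open>Nontriviality speaks of a whole matrix and not of one vector. With every column
    equal to \<open>v\<close>, all entries of \<open>hconj M ** F f f ** M\<close> coincide with the
    quadratic form at \<open>v\<close>.\<close>
  define M :: "complex^'l^'l" where "M = (\<chi> i j. v $ i)"
  have Me: "M *v axis j 1 = v" for j
    unfolding vec_eq_iff mult_axis by (simp add: M_def)
  have "M \<noteq> 0" using assms(2) by (auto simp: M_def vec_eq_iff)
  then obtain P where P: "P \<noteq> 0" "(\<lambda>x. f x ** M) = matrix_poly P"
    using lead_matrix_poly[OF assms(1)] by blast
  have f: "cont f" using lead_cont[OF assms(1)] .
  have fM: "cont (\<lambda>x. f x ** M)" by (intro continuous_intros f)
  have "hconj M ** F f f ** M = F (\<lambda>x. f x ** M) (\<lambda>x. f x ** M)"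
    by (simp add: F_mult_left[OF f fM] F_mult_right[OF f f] matrix_mul_assoc)
  then have nz: "hconj M ** F f f ** M \<noteq> 0" using nontrivial[OF P(1)] P(2) by simp
  have "cinner v (F f f *v v) \<noteq> 0"
  proof
    assume 0: "cinner v (F f f *v v) = 0"
    have "(hconj M ** F f f ** M) $ i $ j = 0" for i j
    proof -
      have "(hconj M ** F f f ** M) $ i $ j = cinner (axis i 1) (hconj M *v (F f f *v (M *v axis j 1)))"
        by (simp add: matrix_vector_mul_assoc matrix_mul_assoc flip: cinner_axis_matrix)
      also have "\<dots> = cinner v (F f f *v v)"
        unfolding cinner_adjoint[of _ "hconj M"] by (simp add: Me)
      finally show ?thesis using 0 by simp
    qed
    then show False using nz by (simp add: vec_eq_iff)
  qed
  then have "Re (cinner v (F f f *v v)) \<noteq> 0"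
    using psd_cinner_real[OF F_psd[OF f], of v] by (metis of_real_0)
  moreover have "0 \<le> Re (cinner v (F f f *v v))" using F_psd[OF f] by (simp add: psd_def)
  ultimately show ?thesis by linarith
qed

text \<open>Three-term recurrence x p_n = p_(n+1) A_n^* + p_n B_n + p_(n-1) A_(n-1), with state
  (p_(n-1), A_(n-1), p_n). The zeros in the initial state absorb the missing term at n = 0.
  \<open>S\<close> normalizes the remainder, so A_n^* is its inverse.\<close>

primrec lanczos :: "nat \<Rightarrow> (real \<Rightarrow> complex^'l^'l) \<times> (complex^'l^'l) \<times> (real \<Rightarrow> complex^'l^'l)" where
  "lanczos 0 = ((\<lambda>_. 0), 0, (\<lambda>_. mat 1))"
| "lanczos (Suc n) =
    (let r = fst (lanczos n); a = fst (snd (lanczos n)); p = snd (snd (lanczos n));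
         q = (\<lambda>x. xmul p x - (p x ** F p (xmul p) + r x ** a));
         S = (SOME S. hconj S ** F q q ** S = mat 1)
     in (p, hconj (matrix_inv S), (\<lambda>x. q x ** S)))"

definition "op n = snd (snd (lanczos n))"
definition "op_pred n = fst (lanczos n)"
definition "op_coeff n = fst (snd (lanczos n))"
definition "op_B n = F (op n) (xmul (op n))"
definition "op_A n = op_coeff (Suc n)"
definition "op_raw n = (\<lambda>x. xmul (op n) x - (op n x ** op_B n + op_pred n x ** op_coeff n))"
definition "op_norm n = (SOME S :: complex^'l^'l. hconj S ** F (op_raw n) (op_raw n) ** S = mat 1)"

lemma op_0: "op 0 = (\<lambda>_. mat 1)" "op_pred 0 = (\<lambda>_. 0)" "op_coeff 0 = 0"
  by (simp_all add: op_def op_pred_def op_coeff_def)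

lemma op_Suc: "op (Suc n) = (\<lambda>x. op_raw n x ** op_norm n)" "op_pred (Suc n) = op n"
  "op_A n = hconj (matrix_inv (op_norm n))" "op_coeff (Suc n) = op_A n"
  by (simp_all add: op_def op_pred_def op_coeff_def op_A_def op_norm_def op_raw_def op_B_def Let_def)

text \<open>Degree and normalization go through one induction: \<open>op_norm\<close> is a choice
  that is meaningful because the remainder has degree n + 1 with invertible leading coefficient, and
  it in turn preserves this property.\<close>

lemma op_lead: "lead n (op n) \<and> pol n (op_pred n) \<and> lead (Suc n) (op_raw n) \<and>
  hconj (op_norm n) ** F (op_raw n) (op_raw n) ** op_norm n = mat 1 \<and> invertible (op_norm n)"
proof (induction n)
  have *: "lead (Suc n) (op_raw n) \<and>
    hconj (op_norm n) ** F (op_raw n) (op_raw n) ** op_norm n = mat 1 \<and> invertible (op_norm n)"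
    if P: "lead n (op n)" "pol n (op_pred n)" for n
  proof -
    have raw: "lead (Suc n) (op_raw n)"
      unfolding op_raw_def
      by (intro lead_diff lead_xmul pol_add pol_mult P lead_imp_pol pol_mono[OF P(2)]) simp
    have "hermitian (F (op_raw n) (op_raw n))"
      using F_psd[OF lead_cont[OF raw]] by (simp add: psd_def)
    then have "\<exists>S :: complex^'l^'l. hconj S ** F (op_raw n) (op_raw n) ** S = mat 1"
      by (rule positive_definite_normalizer) (rule F_lead_positive[OF raw])
    then have S: "hconj (op_norm n) ** F (op_raw n) (op_raw n) ** op_norm n = mat 1"
      unfolding op_norm_def by (rule someI_ex)
    then have "invertible (op_norm n)" using invertible_left_inverse by blast
    then show ?thesis using raw S by blast
  qed
  {
    case 0
    have "lead 0 (\<lambda>_. mat 1 :: complex^'l^'l)"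
      unfolding lead_def
      by (intro exI[of _ "mat 1"] exI[of _ "\<lambda>_. 0"] conjI pol_0)
        (auto simp: invertible_def intro!: exI[of _ "mat 1"])
    then show ?case using *[of 0] by (simp add: op_0 pol_0)
  next
    case (Suc n)
    then have "lead (Suc n) (op (Suc n))" "pol (Suc n) (op_pred (Suc n))"
      by (auto simp: op_Suc intro: lead_mult lead_imp_pol)
    then show ?case using *[of "Suc n"] by blast
  }
qed

lemma op_cont: "cont (op n)" "cont (op_pred n)" "cont (op_raw n)"
  using op_lead lead_cont pol_cont by blast+

lemma op_A_invertible: "invertible (op_A n)"
  unfolding op_Suc(3)
  by (rule invertible_hconj) (metis invertible_def matrix_inv_mult op_lead)

lemma op_raw_eq: "op_raw n x = op (Suc n) x ** hconj (op_A n)"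
proof -
  have "op_norm n ** matrix_inv (op_norm n) = mat 1" using matrix_inv_mult(1) op_lead by blast
  then show ?thesis by (simp add: op_Suc flip: matrix_mul_assoc)
qed

lemma xmul_op: "xmul (op n) = (\<lambda>x. op (Suc n) x ** hconj (op_A n) +
    (op n x ** op_B n + op_pred n x ** op_coeff n))"
  unfolding op_raw_eq[symmetric] by (simp add: op_raw_def)

text \<open>Adjoint of the recurrence: under multiplication by x the coefficients
  \<open>F (op n) g\<close> of a function transform as a vector does under the Jacobi
  matrix.\<close>

lemma F_xmul_op:
  assumes g: "cont g"
  shows "F (xmul (op n)) g = op_A n ** F (op (Suc n)) g + (hconj (op_B n) ** F (op n) g
    + hconj (op_coeff n) ** F (op_pred n) g)"
proof -
  have c: "cont (\<lambda>x. op k x ** M)" "cont (\<lambda>x. op_pred k x ** M)" for k M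
    by (intro continuous_intros op_cont)+
  have c2: "cont (\<lambda>x. op n x ** op_B n + op_pred n x ** op_coeff n)"
    by (intro continuous_intros op_cont)
  show ?thesis
    unfolding xmul_op F_add_left[OF g c(1) c2] F_add_left[OF g c(1) c(2)]
    by (simp add: F_mult_left op_cont g)
qed

text \<open>Two terms are subtracted from x p_n. Against p_k with k < n, symmetry moves x to p_k and
  leaves \<open>op_A k ** F (op (Suc k)) (op n)\<close>. This vanishes unless k + 1 = n, and then
  the term with \<open>op_pred\<close> cancels it.\<close>

lemma op_orthonormal_upto: "k \<le> n \<Longrightarrow> l \<le> n \<Longrightarrow> F (op k) (op l) = (if k = l then mat 1 else 0)"
proof (induction n arbitrary: k l)
  case 0
  then show ?case by (simp add: op_0 normalized)
next
  case (Suc n)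
  note IH = Suc.IH
  have raw: "F (op k) (op_raw n) = 0" if k: "k \<le> n" for k
  proof -
    have c: "cont (\<lambda>x. op n x ** M)" "cont (\<lambda>x. op_pred n x ** M)" for M
      by (intro continuous_intros op_cont)+
    have "F (op k) (op_raw n) = F (op k) (xmul (op n)) -
        (F (op k) (op n) ** op_B n + F (op k) (op_pred n) ** op_coeff n)"
      unfolding op_raw_def
        F_diff_right[OF op_cont(1) continuous_on_xmul[OF op_cont(1)] continuous_on_add[OF c]]
        F_add_right[OF op_cont(1) c]
      by (simp add: F_mult_right op_cont)
    also have "\<dots> = 0"
    proof (cases "k = n")
      case True
      have "F (op n) (op_pred n) ** op_coeff n = 0"
        by (cases n) (simp_all add: op_0 op_Suc(2,4) IH)
      then show ?thesis using True IH[of n n] by (simp add: op_B_def)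
    next
      case False
      then obtain j where n: "n = Suc j" "k \<le> j" using k by (cases n) auto
      have pred: "hconj (op_coeff k) ** F (op_pred k) (op n) = 0"
      proof (cases k)
        case (Suc i)
        then show ?thesis using IH[of i n] n by (simp add: op_Suc)
      qed (simp add: op_0)
      have "F (op k) (xmul (op n)) = F (xmul (op k)) (op n)"
        by (simp add: F_xmul op_cont)
      also have "\<dots> = op_A k ** F (op (Suc k)) (op n)"
        unfolding F_xmul_op[OF op_cont(1)] pred using IH[of k n] n by simp
      finally show ?thesis using IH[of "Suc k" n] IH[of k j] IH[of k n] n by (auto simp: op_Suc)
    qed
    finally show ?thesis .
  qed
  have offdiag: "F (op k) (op (Suc n)) = 0" if "k \<le> n" for k
    unfolding op_Suc F_mult_right[OF op_cont(1,3)] raw[OF that] by simp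
  moreover have offdiag': "F (op (Suc n)) (op k) = 0" if "k \<le> n" for k
    using offdiag[OF that] F_hconj[OF op_cont(1,1), of k "Suc n"] by simp
  moreover have "F (op (Suc n)) (op (Suc n)) = mat 1"
  proof -
    have c: "cont (\<lambda>x. op_raw n x ** op_norm n)" by (intro continuous_intros op_cont)
    show ?thesis unfolding op_Suc F_mult_left[OF op_cont(3) c] F_mult_right[OF op_cont(3,3)]
      using op_lead[of n] by (simp add: matrix_mul_assoc)
  qed
  ultimately show ?case using Suc.prems IH[of k l] by (cases "k = Suc n"; cases "l = Suc n") auto
qed

lemma op_orthonormal: "F (op k) (op l) = (if k = l then mat 1 else 0)"
  by (rule op_orthonormal_upto[of _ "max k l"]) auto

lemma op_B_hermitian: "hermitian (op_B n)"
  unfolding hermitian_def op_B_def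
  using F_hconj[OF op_cont(1) continuous_on_xmul[OF op_cont(1)], of n n]
    F_xmul[OF op_cont(1,1), of n n] by simp

text \<open>Orthonormality expands the form at x p_n into A_n A_n^* plus two further squares, and
  its trace is at most N^2 times the trace of the identity.\<close>

lemma op_coefficients_bound: "(norm (op_A n))\<^sup>2 + (norm (op_B n))\<^sup>2 \<le> N\<^sup>2 * CARD('l)"
proof -
  let ?T = "F (xmul (op n)) (xmul (op n))"
  have c: "cont (xmul (op n))" by (intro continuous_intros op_cont)
  have conj: "F g (xmul (op n)) = hconj (F (xmul (op n)) g)" if "cont g" for g
    using F_hconj[OF c that] by simp
  have A: "F (op (Suc n)) (xmul (op n)) = hconj (op_A n)"
  proof -
    have "hconj (op_coeff n) ** F (op_pred n) (op (Suc n)) = 0"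
      by (cases n) (simp_all add: op_0 op_Suc(2,4) op_orthonormal)
    then show ?thesis unfolding conj[OF op_cont(1)] F_xmul_op[OF op_cont(1)] by (simp add: op_orthonormal)
  qed
  have P: "F (op_pred n) (xmul (op n)) = op_coeff n"
  proof (cases n)
    case 0
    have "F (\<lambda>_. 0) (xmul (op n)) = 0" unfolding conj[OF continuous_on_const] by (simp add: F_zero_right c)
    then show ?thesis using 0 by (simp add: op_0)
  next
    case (Suc j)
    have "hconj (op_coeff n) ** F (op_pred n) (op_pred n) = hconj (op_coeff n)"
      using Suc by (simp add: op_Suc(2,4) op_orthonormal)
    then show ?thesis unfolding conj[OF op_cont(2)] F_xmul_op[OF op_cont(2)]
      using Suc by (simp add: op_Suc(2,4) op_orthonormal)
  qed
  have "?T = op_A n ** hconj (op_A n) + (hconj (op_B n) ** op_B n + hconj (op_coeff n) ** op_coeff n)"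
    unfolding F_xmul_op[OF c] A P op_B_def[symmetric] by simp
  then have "retrace ?T = (norm (op_A n))\<^sup>2 + ((norm (op_B n))\<^sup>2 + (norm (op_coeff n))\<^sup>2)"
    using retrace_hconj_mult[of "hconj (op_A n)"] by (simp add: retrace_add retrace_hconj_mult norm_hconj)
  moreover have "0 \<le> retrace (cscale (of_real (N\<^sup>2)) (F (op n) (op n)) - ?T)"
    by (rule retrace_psd[OF F_xmul_bound[OF op_cont(1)]])
  moreover have "retrace (cscale (of_real (N\<^sup>2)) (F (op n) (op n))) = N\<^sup>2 * CARD('l)"
    by (simp add: op_orthonormal retrace_def mat_def)
  moreover have "0 \<le> (norm (op_coeff n))\<^sup>2" by simp
  ultimately show ?thesis unfolding retrace_diff by linarith
qed

lemma block_jacobi_op: "block_jacobi op_A op_B"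
proof -
  define K where "K = sqrt (N\<^sup>2 * CARD('l))"
  have "norm (op_A n) \<le> K" "norm (op_B n) \<le> K" for n
    using op_coefficients_bound[of n] unfolding K_def
    by (auto intro!: real_le_rsqrt) (smt (verit) zero_le_power2)+
  then show ?thesis unfolding block_jacobi_def bounded_iff
    using op_A_invertible op_B_hermitian by auto
qed

text \<open>Bessel's inequality: \<open>s\<close> is the projection to the first \<open>K\<close>
  polynomials, and the trace of \<open>F d d\<close> is nonnegative. It provides the square
  summability for \<open>resolvent_block_eq\<close>.\<close>

lemma bessel:
  assumes r: "cont r"
  shows "summable (\<lambda>n. (norm (F (op n) r))\<^sup>2)"
proof (rule summableI_nonneg_bounded)
  fix K
  define \<Psi> where "\<Psi> n = F (op n) r" for n
  define s where "s = (\<lambda>x. \<Sum>n<K. op n x ** \<Psi> n)"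
  define d where "d = (\<lambda>x. r x - s x)"
  have c: "cont (\<lambda>x. op n x ** \<Psi> n)" for n by (intro continuous_intros op_cont)
  have s: "cont s" unfolding s_def by (intro continuous_on_sum c)
  have d: "cont d" unfolding d_def by (intro continuous_on_diff r s)
  have Fs: "F f s = (\<Sum>n<K. F f (op n) ** \<Psi> n)" if "cont f" for f
    unfolding s_def using F_sum_right[OF that c] by (simp add: F_mult_right that op_cont)
  have Fd: "F (op n) d = 0" if "n < K" for n
  proof -
    have "F (op n) s = (\<Sum>k<K. if k = n then \<Psi> n else 0)"
      unfolding Fs[OF op_cont(1)] by (intro sum.cong refl) (simp add: op_orthonormal)
    then have "F (op n) s = \<Psi> n" using that by simp
    then show ?thesis unfolding d_def F_diff_right[OF op_cont(1) r s] by (simp add: \<Psi>_def)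
  qed
  have "F d s = 0"
    unfolding Fs[OF d] using Fd F_hconj[OF op_cont(1) d]
    by (intro sum.neutral) (metis hconj_0 lessThan_iff matrix_zero_left)
  moreover have "F r s = (\<Sum>n<K. hconj (\<Psi> n) ** \<Psi> n)"
    unfolding Fs[OF r] \<Psi>_def by (simp add: F_hconj op_cont r)
  moreover have "F d d = F d r - F d s" using F_diff_right[OF d r s] by (simp add: d_def)
  moreover have "F d r = F r r - hconj (F r s)"
    using F_diff_left[OF r r s] F_hconj[OF r s] by (simp add: d_def)
  ultimately have "F d d = F r r - (\<Sum>n<K. hconj (\<Psi> n) ** \<Psi> n)"
    by (simp add: hconj_sum hconj_mult)
  then have "retrace (F d d) = retrace (F r r) - (\<Sum>n<K. (norm (\<Psi> n))\<^sup>2)"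
    by (simp add: retrace_diff retrace_sum retrace_hconj_mult)
  then show "(\<Sum>n<K. (norm (F (op n) r))\<^sup>2) \<le> retrace (F r r)"
    using retrace_psd[OF F_psd[OF d]] by (simp add: \<Psi>_def)
qed simp

text \<open>For r = 1/(x - E) one has x r = 1 + E r, and \<open>op 0\<close> is 1. Hence the
  coefficients of r solve the resolvent equation for the first unit block.\<close>

lemma op_resolvent_block:
  assumes E: "Im E \<noteq> 0"
  shows "resolvent_block op_A op_B E = F (\<lambda>_. mat 1) (\<lambda>x. mat (1 / (of_real x - E)))"
proof -
  define r :: "real \<Rightarrow> complex^'l^'l" where "r = (\<lambda>x. mat (1 / (of_real x - E)))"
  have nz: "complex_of_real x - E \<noteq> 0" for x using E by (auto simp: complex_eq_iff)
  have "cont (\<lambda>x. cscale (1 / (of_real x - E)) (mat 1))"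
    using nz by (intro continuous_intros) auto
  then have r: "cont r" unfolding r_def by (simp add: cscale_mat)
  define \<Psi> where "\<Psi> n = F (op n) r" for n
  have "jacobi_mat op_A op_B \<Psi> n - cscale E (\<Psi> n) = (if n = 0 then mat 1 else 0)" for n
  proof -
    have "F (xmul (op n)) r = jacobi_mat op_A op_B \<Psi> n"
    proof (cases n)
      case 0
      then show ?thesis unfolding F_xmul_op[OF r] using op_B_hermitian[of n]
        by (simp add: jacobi_mat_def \<Psi>_def op_0 hermitian_def add_ac)
    next
      case (Suc j)
      then show ?thesis unfolding F_xmul_op[OF r] using op_B_hermitian[of n]
        by (simp add: jacobi_mat_def \<Psi>_def op_Suc hermitian_def add_ac)
    qed
    moreover have "F (xmul (op n)) r = F (op n) (op 0) + \<Psi> n ** mat E"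
    proof -
      have "xmul r = (\<lambda>x. op 0 x + r x ** mat E)"
      proof
        fix x
        have "of_real x * (1 / (of_real x - E)) = 1 + 1 / (of_real x - E) * E"
          using nz[of x] by (simp add: field_simps)
        then show "xmul r x = op 0 x + r x ** mat E"
          unfolding xmul_def r_def op_0 cscale_mat mult_mat_right
          by (intro matrix_eqI) (simp add: mat_def mult.commute)
      qed
      moreover have "cont (\<lambda>x. r x ** mat E)" by (intro continuous_intros r)
      ultimately show ?thesis
        by (simp add: F_xmul F_add_right F_mult_right op_cont r \<Psi>_def)
    qed
    ultimately have "jacobi_mat op_A op_B \<Psi> n = (if n = 0 then mat 1 else 0) + cscale E (\<Psi> n)"
      by (simp add: op_orthonormal mult_mat_right)
    then show ?thesis by simp
  qed
  then have "resolvent_block op_A op_B E = \<Psi> 0"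
    by (rule resolvent_block_eq[OF block_jacobi_op E]) (use bessel[OF r] in \<open>simp add: \<Psi>_def\<close>)
  then show ?thesis by (simp add: \<Psi>_def r_def op_0)
qed

end

lemma psd_form_form_integral:
  fixes \<mu> :: "real set \<Rightarrow> complex^'l^'l"
  assumes "is_representing_measure \<mu> m"
  shows "\<exists>N. psd_form (form_integral \<mu>) N"
proof -
  obtain a b where \<mu>: "psd_matrix_measure \<mu>" "\<mu> (- {a..b}) = 0"
    using assms unfolding is_representing_measure_def by blast
  \<comment> \<open>The extra 1 makes \<open>b < N\<close> strict.\<close>
  define N where "N = \<bar>a\<bar> + \<bar>b\<bar> + 1"
  have N: "N > 0" "- N \<le> a" "b < N" by (auto simp: N_def)
  have "psd_form (form_integral \<mu>) N"
  proof
    show "\<exists>x W. (\<forall>n i. psd (W n i)) \<and> (\<forall>n i. i \<le> n \<longrightarrow> \<bar>x n i\<bar> \<le> N) \<and>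
      (\<forall>f g. cont f \<longrightarrow> cont g \<longrightarrow>
        (\<lambda>n. \<Sum>i\<le>(n::nat). hconj (f (x n i)) ** W n i ** g (x n i)) \<longlonglongrightarrow> form_integral \<mu> f g)"
    proof (intro exI[of _ "node N"] exI[of _ "\<lambda>n i. \<mu> (cell N n i)"] conjI allI impI)
      show "psd (\<mu> (cell N n i))" for n i
        using \<mu>(1) by (simp add: psd_matrix_measure_def)
      show "\<bar>node N n i\<bar> \<le> N" if "i \<le> n" for n i
        using node_bound[OF _ that] N by simp
    qed (rule form_integral_limit[OF \<mu> N])
  qed
  then show ?thesis by blast
qed

theorem block_jacobi_exists:
  assumes m: "is_representing_measure \<mu> m" and "nontrivial_measure \<mu>"
  shows "\<exists>A B. corresponds A B m"
proof -
  obtain N where "psd_form (form_integral \<mu>) N" using psd_form_form_integral[OF m] by blast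
  then interpret psd_form "form_integral \<mu>" N .
  interpret nontrivial_form "form_integral \<mu>" N
  proof
    show "form_integral \<mu> (matrix_poly P) (matrix_poly P) \<noteq> 0" if "P \<noteq> 0" for P
      using assms(2) that unfolding nontrivial_measure_def by force
    show "form_integral \<mu> (\<lambda>_. mat 1) (\<lambda>_. mat 1) = mat 1"
      using m unfolding is_representing_measure_def by (metis form_integral_const)
  qed
  have "corresponds op_A op_B m"
    unfolding corresponds_def
    using block_jacobi_op op_resolvent_block m by (simp add: is_representing_measure_def)
  then show ?thesis by blast
qed

section \<open>The function $M$ on the unit disk\<close>

text \<open>Two comparisons: the pointwise bound 1/|Im E| for 1/|x - E| controls
  \<open>F r r\<close>, and subtracting from \<open>r\<close> its mean \<open>M\<close> shows that
  the trace of M^* M is at most that of \<open>F r r\<close>. The numerator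
  \<open>sqrt CARD('l)\<close> is the Frobenius norm of the identity.\<close>

lemma (in psd_form) resolvent_bound:
  assumes norm: "F (\<lambda>_. mat 1) (\<lambda>_. mat 1) = mat 1" and E: "Im E \<noteq> 0"
  shows "norm (F (\<lambda>_. mat 1) (\<lambda>x. mat (1 / (of_real x - E)))) \<le> sqrt CARD('l) / \<bar>Im E\<bar>"
proof -
  let ?one = "\<lambda>_. mat 1 :: complex^'l^'l"
  define q where "q x = 1 / (complex_of_real x - E)" for x :: real
  define r :: "real \<Rightarrow> complex^'l^'l" where "r = (\<lambda>x. mat (q x))"
  define M where "M = F ?one r"
  have nz: "complex_of_real x - E \<noteq> 0" for x using E by (auto simp: complex_eq_iff)
  have q: "continuous_on UNIV q" unfolding q_def using nz by (intro continuous_intros) auto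
  have one: "cont ?one" by (rule continuous_on_const)
  have r_eq: "r = (\<lambda>x. cscale (q x) (?one x))" by (simp add: r_def cscale_mat)
  have r: "cont r" unfolding r_eq by (intro continuous_intros q)
  have le: "(cmod (q x))\<^sup>2 \<le> 1 / (Im E)\<^sup>2" for x
  proof -
    have "(Im E)\<^sup>2 \<le> (cmod (complex_of_real x - E))\<^sup>2" unfolding cmod_power2 by simp
    then have "1 / (cmod (complex_of_real x - E))\<^sup>2 \<le> 1 / (Im E)\<^sup>2"
      using E by (intro divide_left_mono mult_pos_pos) (auto simp: nz)
    then show ?thesis by (simp add: q_def norm_divide power_divide)
  qed
  \<comment> \<open>Square root of the pointwise defect: the difference of the two forms becomes a
    form \<open>F p p\<close>, hence positive semidefinite.\<close>
  define s where "s x = complex_of_real (sqrt (1 / (Im E)\<^sup>2 - (cmod (q x))\<^sup>2))" for x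
  have s: "continuous_on UNIV s" unfolding s_def by (intro continuous_intros q)
  define p :: "real \<Rightarrow> complex^'l^'l" where "p = (\<lambda>x. cscale (s x) (?one x))"
  have p: "cont p" unfolding p_def by (intro continuous_intros s)
  have Frr: "F r r = F ?one (\<lambda>x. cscale (cnj (q x)) (r x))"
    by (subst (1) r_eq) (rule F_scalar[OF one r q])
  have c: "cont (\<lambda>x. cscale (cnj (q x)) (r x))" "cont (\<lambda>x. ?one x ** mat (1 / (Im E)\<^sup>2))"
    by (intro continuous_intros r q one)+
  have "F p p = F ?one (\<lambda>x. cscale (cnj (s x)) (p x))"
    unfolding p_def by (rule F_scalar[OF one p[unfolded p_def] s])
  also have "(\<lambda>x. cscale (cnj (s x)) (p x)) =
      (\<lambda>x. ?one x ** mat (1 / (Im E)\<^sup>2) - cscale (cnj (q x)) (r x))"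
  proof
    fix x
    have "cnj (s x) * s x = of_real ((sqrt (1 / (Im E)\<^sup>2 - (cmod (q x))\<^sup>2))\<^sup>2)"
      by (simp only: s_def complex_cnj_complex_of_real power2_eq_square of_real_mult)
    also have "\<dots> = of_real (1 / (Im E)\<^sup>2 - (cmod (q x))\<^sup>2)" using le[of x] by simp
    also have "\<dots> = 1 / (Im E)\<^sup>2 - cnj (q x) * q x"
      using complex_norm_square[of "q x"] by (simp add: mult.commute)
    finally show "cscale (cnj (s x)) (p x) = ?one x ** mat (1 / (Im E)\<^sup>2) - cscale (cnj (q x)) (r x)"
      unfolding p_def r_eq by (simp add: cscale_mat) (simp add: vec_eq_iff mat_def)
  qed
  also have "F ?one \<dots> = mat (1 / (Im E)\<^sup>2) - F r r"
    unfolding F_diff_right[OF one c(2,1)] F_mult_right[OF one one] norm Frr by simp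
  finally have "retrace (F r r) \<le> retrace (mat (1 / (Im E)\<^sup>2) :: complex^'l^'l)"
    using retrace_psd[OF F_psd[OF p]] by (simp add: retrace_diff)
  also have "\<dots> = CARD('l) / (Im E)\<^sup>2"
  proof -
    have "Re (1 / (complex_of_real (Im E))\<^sup>2) = 1 / (Im E)\<^sup>2"
      by (metis Re_complex_of_real of_real_1 of_real_divide of_real_power)
    then show ?thesis unfolding retrace_def mat_def by simp
  qed
  finally have rr: "retrace (F r r) \<le> CARD('l) / (Im E)\<^sup>2" .
  define d where "d = (\<lambda>x. r x - ?one x ** M)"
  have c3: "cont (\<lambda>x. ?one x ** M)" by (intro continuous_intros one)
  have d: "cont d" unfolding d_def by (intro continuous_on_diff r c3)
  have F1d: "F ?one d = 0"
    unfolding d_def F_diff_right[OF one r c3] F_mult_right[OF one one] norm by (simp add: M_def)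
  have "F d d = F r d - hconj M ** F ?one d"
    using F_diff_left[OF d r c3] F_mult_left[OF one d, of M] by (simp add: d_def)
  also have "\<dots> = F r r - F r ?one ** M"
    unfolding F1d using F_diff_right[OF r r c3] F_mult_right[OF r one, of M] by (simp add: d_def)
  also have "F r ?one = hconj M" using F_hconj[OF one r] by (simp add: M_def)
  finally have "(norm M)\<^sup>2 \<le> retrace (F r r)"
    using retrace_psd[OF F_psd[OF d]] by (simp add: retrace_diff retrace_hconj_mult)
  then have "(norm M)\<^sup>2 \<le> CARD('l) / (Im E)\<^sup>2" using rr by linarith
  then have "norm M \<le> sqrt (CARD('l) / (Im E)\<^sup>2)" by (rule real_le_rsqrt)
  then show ?thesis by (simp add: M_def r_def q_def real_sqrt_divide)
qed

lemma m_function_bound: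
  fixes m :: "complex \<Rightarrow> complex^'l^'l"
  assumes m: "is_representing_measure \<mu> m" and E: "Im E \<noteq> 0"
  shows "norm (m E) \<le> sqrt CARD('l) / \<bar>Im E\<bar>"
proof -
  obtain N where "psd_form (form_integral \<mu>) N" using psd_form_form_integral[OF m] by blast
  then interpret psd_form "form_integral \<mu>" N .
  have "form_integral \<mu> (\<lambda>_. mat 1) (\<lambda>_. mat 1) = mat 1"
    using m unfolding is_representing_measure_def by (metis form_integral_const)
  then show ?thesis using resolvent_bound[OF _ E] m E by (simp add: is_representing_measure_def)
qed

lemma m_function_symmetric:
  assumes "discrete_m_function m" "Im E \<noteq> 0"
  shows "hconj (m (cnj E)) = m E"
proof -
  have *: "m z = hconj (m (cnj z))" if "Im z < 0" for z
    using assms(1) that unfolding discrete_m_function_def herglotz_def by blast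
  show ?thesis
  proof (cases "Im E < 0")
    case True
    then show ?thesis using * by simp
  next
    case False
    then have "m (cnj E) = hconj (m (cnj (cnj E)))" using assms(2) by (intro *) simp
    then show ?thesis by simp
  qed
qed

lemma m_function_continuous:
  assumes "discrete_m_function m" "Im E \<noteq> 0"
  shows "isCont m E"
proof -
  obtain a b :: real where hol: "matrix_holomorphic_on m (- (complex_of_real ` {a..b}))"
    using assms(1) unfolding discrete_m_function_def by blast
  have "compact (complex_of_real ` {a..b})"
    by (intro compact_continuous_image continuous_on_of_real_id) simp
  then have op: "open (- (complex_of_real ` {a..b}))" by (simp add: compact_imp_closed open_Compl)
  have "E \<in> - (complex_of_real ` {a..b})" using assms(2) by auto
  then have "isCont (\<lambda>z. m z $ i $ j) E" for i j
    using hol op unfolding matrix_holomorphic_on_def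
    by (meson continuous_on_eq_continuous_at holomorphic_on_imp_continuous_on)
  then show ?thesis unfolding isCont_def tendsto_matrix_iff by blast
qed

section \<open>The map z + 1/z and the poles of the rational extension in the disk\<close>

definition joukowski :: "complex \<Rightarrow> complex" where
  "joukowski z = z + inverse z"

lemma Im_joukowski: "Im (joukowski z) = Im z * (1 - 1 / (cmod z)\<^sup>2)"
  by (simp add: joukowski_def cmod_power2 algebra_simps)

lemma joukowski_cnj: "joukowski (cnj z) = cnj (joukowski z)"
  by (simp add: joukowski_def)

lemma joukowski_inverse: "joukowski (inverse z) = joukowski z"
  by (simp add: joukowski_def add.commute)

lemma joukowski_nonreal: "cmod z < 1 \<Longrightarrow> Im z \<noteq> 0 \<Longrightarrow> Im (joukowski z) \<noteq> 0"
  unfolding Im_joukowski using power_strict_mono[of "cmod z" 1 2] by auto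

text \<open>Near a real point, vertical approach stays off the real axis, where the formula for
  \<open>R\<close> is available.\<close>

lemma frequently_at_vertical:
  assumes "d > 0" "\<And>t. 0 < t \<Longrightarrow> t < d \<Longrightarrow> P (a + \<i> * of_real t)"
  shows "\<exists>\<^sub>F z in at a. P z"
  unfolding frequently_at
proof (intro allI impI)
  fix e :: real assume "e > 0"
  define t where "t = min d e / 2"
  have t: "0 < t" "t < d" "t < e" using assms(1) \<open>e > 0\<close> by (auto simp: t_def)
  show "\<exists>x\<in>UNIV. x \<noteq> a \<and> dist x a < e \<and> P x"
    by (intro bexI[of _ "a + \<i> * of_real t"]) (use t assms(2) in \<open>auto simp: dist_norm norm_mult\<close>)
qed

lemma frequently_at_real_nonreal:
  assumes "Im a = 0" "cmod a < 1"
  shows "\<exists>\<^sub>F z in at a. z \<in> ball 0 1 \<and> Im z \<noteq> 0"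
proof (rule frequently_at_vertical[of "1 - cmod a"])
  fix t :: real assume t: "0 < t" "t < 1 - cmod a"
  have "cmod (a + \<i> * of_real t) \<le> cmod a + t"
    using norm_triangle_ineq[of a "\<i> * of_real t"] t by (simp add: norm_mult)
  then show "a + \<i> * of_real t \<in> ball 0 1 \<and> Im (a + \<i> * of_real t) \<noteq> 0"
    using t assms by simp
qed (use assms in simp)

lemma frequently_nonreal_disk: "\<exists>\<^sub>F z in cofinite. z \<in> ball 0 1 \<and> Im z \<noteq> 0"
  by (rule frequently_at_cofinite[OF frequently_at_real_nonreal[of 0]]) simp_all

text \<open>Both sides agree at the nonreal points of the disk by the symmetry of \<open>m\<close>,
  and rational functions that agree infinitely often agree up to finitely many points.\<close>

lemma rational_extension_symmetric:
  assumes m: "discrete_m_function m" and R: "is_rational_extension R m"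
  shows "\<forall>\<^sub>F z in cofinite. hconj (R (cnj z)) = R z"
proof (rule rmat_eventually_eq)
  show rR: "rmat R" using R rational_matrix_imp_rmat by (auto simp: is_rational_extension_def)
  then show "rmat (\<lambda>z. hconj (R (cnj z)))" by (rule rmat_hconj_cnj)
  show "\<exists>\<^sub>F z in cofinite. hconj (R (cnj z)) = R z"
    using frequently_nonreal_disk
  proof (rule frequently_elim1)
    fix z :: complex assume z: "z \<in> ball 0 1 \<and> Im z \<noteq> 0"
    have Rm: "R y = - m (joukowski y)" if "cmod y < 1" "Im y \<noteq> 0" for y
      using R that by (auto simp: is_rational_extension_def joukowski_def)
    have "R (cnj z) = - m (joukowski (cnj z))" "R z = - m (joukowski z)"
      using z by (intro Rm; simp)+
    then show "hconj (R (cnj z)) = R z"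
      using m_function_symmetric[OF m joukowski_nonreal, of z] z
      by (simp add: joukowski_cnj hconj_minus)
  qed
qed

text \<open>With symmetry under conjugation, reflection in the circle reduces to z -> 1/z and no
  adjoint is left.\<close>

lemma sharp_eq_inverse:
  assumes "\<forall>\<^sub>F z in cofinite. hconj (R (cnj z)) = R z"
  shows "\<forall>\<^sub>F z in cofinite. sharp R z = R (inverse z)"
  using eventually_cofinite_inverse[OF assms]
  by eventually_elim (simp add: sharp_def)

text \<open>Off the real axis \<open>m\<close> is continuous. At a real point w the approach is
  along z = w + i t: there |m| is at most a multiple of 1/|Im E|, and |Im E| is at least a multiple
  of t, so (z - w) R(z) stays bounded.\<close>

lemma rational_extension_pole_in_disk:
  assumes m: "discrete_m_function m" "is_representing_measure \<mu> m" and R: "is_rational_extension R m"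
    and w: "cmod w < 1" "w \<noteq> 0"
  shows "\<not> reg w R \<Longrightarrow> Im w = 0" "reg w (\<lambda>z. cscale (z - w) (R z))"
proof -
  have rR: "rmat R" using R rational_matrix_imp_rmat by (auto simp: is_rational_extension_def)
  have Rm: "R z = - m (joukowski z)" if "cmod z < 1" "Im z \<noteq> 0" for z
    using R that by (auto simp: is_rational_extension_def joukowski_def)
  have regular: "reg w R" if "Im w \<noteq> 0"
  proof -
    have cm: "isCont m (joukowski w)" by (rule m_function_continuous[OF m(1) joukowski_nonreal[OF w(1) that]])
    have cj: "(joukowski \<longlongrightarrow> joukowski w) (at w)"
      unfolding joukowski_def[abs_def] by (intro tendsto_add tendsto_inverse tendsto_ident_at w)
    have "((\<lambda>z. - m (joukowski z)) \<longlongrightarrow> - m (joukowski w)) (at w)"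
      by (rule tendsto_minus[OF isCont_tendsto_compose[OF cm cj]])
    moreover have "\<forall>\<^sub>F z in at w. - m (joukowski z) = R z"
    proof -
      have "open ({z. cmod z < 1} \<inter> {z. Im z \<noteq> 0})"
        by (intro open_Int open_Collect_less open_Collect_neq continuous_intros)
      then have "\<forall>\<^sub>F z in at w. z \<in> {z. cmod z < 1} \<inter> {z. Im z \<noteq> 0}"
        using w(1) that by (intro eventually_at_in_open') auto
      then show ?thesis by eventually_elim (simp add: Rm)
    qed
    ultimately have "(R \<longlongrightarrow> - m (joukowski w)) (at w)" by (rule tendsto_eventually_eq')
    then show ?thesis by (rule regI)
  qed
  then show "\<not> reg w R \<Longrightarrow> Im w = 0" by blast
  show "reg w (\<lambda>z. cscale (z - w) (R z))"
  proof (cases "Im w = 0")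
    case False
    then show ?thesis using regular reg_cscale[OF tendsto_linear_factor] by blast
  next
    case True
    define C where "C = sqrt CARD('a)"
    \<comment> \<open>On |z|^2 \<le> (1 + |w|^2) / 2, which \<open>d\<close> below enforces,
      \<open>c\<close> is a positive lower bound of 1/|z|^2 - 1.\<close>
    define c where "c = 2 / (1 + (cmod w)\<^sup>2) - 1"
    have w2: "(cmod w)\<^sup>2 < 1" using w(1) by (simp add: power_less_one_iff)
    then have c: "c > 0" by (simp add: c_def field_simps add_pos_nonneg)
    show ?thesis
    proof (rule rmat_bounded_imp_reg[OF rmat_times_linear[OF rR]])
      define d where "d = sqrt ((1 - (cmod w)\<^sup>2) / 2)"
      show "\<exists>\<^sub>F z in at w. norm (cscale (z - w) (R z)) \<le> C / c"
      proof (rule frequently_at_vertical[of d])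
        show "d > 0" using w2 by (simp add: d_def)
        fix t assume t: "0 < t" "t < d"
        define z where "z = w + \<i> * of_real t"
        have Imz: "Im z = t" using True by (simp add: z_def)
        have "t\<^sup>2 < d\<^sup>2" using t by (intro power_strict_mono) auto
        then have t2: "t\<^sup>2 < (1 - (cmod w)\<^sup>2) / 2" using w2 by (simp add: d_def)
        have "(cmod z)\<^sup>2 = (cmod w)\<^sup>2 + t\<^sup>2" unfolding cmod_power2 using True by (simp add: z_def)
        then have z2: "(cmod z)\<^sup>2 \<le> (1 + (cmod w)\<^sup>2) / 2" using t2 by (simp add: field_simps)
        then have z1: "cmod z < 1" using w2 power2_less_imp_less[of "cmod z" 1] by simp
        have z0: "z \<noteq> 0" using Imz t by auto
        have "1 / ((1 + (cmod w)\<^sup>2) / 2) \<le> 1 / (cmod z)\<^sup>2"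
          using z2 z0 by (intro divide_left_mono mult_pos_pos) (auto simp: add_pos_nonneg)
        then have "c \<le> 1 / (cmod z)\<^sup>2 - 1" by (simp add: c_def)
        then have "t * c \<le> t * (1 / (cmod z)\<^sup>2 - 1)" using t by (intro mult_left_mono) auto
        also have "\<dots> \<le> \<bar>Im (joukowski z)\<bar>"
          unfolding Im_joukowski Imz using t by (simp add: algebra_simps abs_le_iff)
        finally have tc: "t * c \<le> \<bar>Im (joukowski z)\<bar>" .
        have "norm (R z) \<le> C / \<bar>Im (joukowski z)\<bar>"
          using m_function_bound[OF m(2) joukowski_nonreal[OF z1]] Rm[OF z1] Imz t
          by (simp add: C_def)
        also have "\<dots> \<le> C / (t * c)"
        proof (rule divide_left_mono[OF tc])
          have "0 < t * c" using t c by simp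
          then show "0 < \<bar>Im (joukowski z)\<bar> * (t * c)" using tc t c by (intro mult_pos_pos) linarith+
        qed (simp add: C_def)
        finally have "t * norm (R z) \<le> t * (C / (t * c))" using t by (intro mult_left_mono) auto
        then show "norm (cscale (z - w) (R z)) \<le> C / c"
          using t by (simp add: norm_cscale z_def norm_mult)
      qed
    qed
  qed
qed

text \<open>\<open>L\<close> is the leading Laurent coefficient at a pole of order
  \<open>Suc k\<close>.\<close>

lemma rmat_minimal_pole:
  fixes H :: "complex \<Rightarrow> complex^'n^'m"
  assumes "rmat H" "\<not> reg a H"
  shows "\<exists>k L. L \<noteq> 0 \<and> ((\<lambda>z. cscale ((z - a) ^ Suc k) (H z)) \<longlongrightarrow> L) (at a)"
proof -
  define Q where "Q k \<longleftrightarrow> reg a (\<lambda>z. cscale ((z - a) ^ k) (H z))" for k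
  have "\<exists>k. Q k" using rmat_power_mult_reg[OF assms(1)] unfolding Q_def by blast
  then have Q: "Q (Least Q)" by (rule LeastI_ex)
  have "Least Q \<noteq> 0"
  proof
    assume "Least Q = 0"
    then show False using Q assms(2) by (simp add: Q_def)
  qed
  then obtain k where k: "Least Q = Suc k" using not0_implies_Suc by blast
  obtain L where L: "((\<lambda>z. cscale ((z - a) ^ Suc k) (H z)) \<longlongrightarrow> L) (at a)"
    using Q unfolding k Q_def reg_def by blast
  have "L \<noteq> 0"
  proof
    assume "L = 0"
    have "rmat (\<lambda>z. cscale ((z - a) ^ k) (H z))"
      by (intro rmat_cscale ratfun_power ratfun_diff ratfun_id ratfun_const assms)
    moreover have "((\<lambda>z. cscale (z - a) (cscale ((z - a) ^ k) (H z))) \<longlongrightarrow> 0) (at a)"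
      using L \<open>L = 0\<close> by simp
    ultimately have "Q k" unfolding Q_def by (rule rmat_zero_residue)
    then show False using not_less_Least[of k Q] k by simp
  qed
  then show ?thesis using L by blast
qed

text \<open>A pole of the inverse with leading coefficient \<open>K\<close> would give L K = 0,
  because F times its inverse is the identity; an invertible \<open>L\<close> forbids this.\<close>

lemma reg_matrix_inv:
  fixes F :: "complex \<Rightarrow> complex^'n^'n"
  assumes "rmat F" "\<forall>\<^sub>F z in cofinite. invertible (F z)" "(F \<longlongrightarrow> L) (at a)" "invertible L"
  shows "reg a (\<lambda>z. matrix_inv (F z))"
proof (rule ccontr)
  assume "\<not> ?thesis"
  then obtain k K where K: "K \<noteq> 0" "((\<lambda>z. cscale ((z - a) ^ Suc k) (matrix_inv (F z))) \<longlongrightarrow> K) (at a)"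
    using rmat_minimal_pole[OF rmat_matrix_inv[OF assms(1,2)]] by blast
  have "((\<lambda>z. F z ** cscale ((z - a) ^ Suc k) (matrix_inv (F z))) \<longlongrightarrow> L ** K) (at a)"
    by (intro tendsto_matrix_mult assms K)
  moreover have "\<forall>\<^sub>F z in at a. F z ** cscale ((z - a) ^ Suc k) (matrix_inv (F z)) = mat ((z - a) ^ Suc k)"
    using eventually_cofinite_at[OF assms(2)]
    by eventually_elim (simp add: cscale_mult_right matrix_inv_mult cscale_mat)
  ultimately have "((\<lambda>z. mat ((z - a) ^ Suc k) :: complex^'n^'n) \<longlongrightarrow> L ** K) (at a)"
    by (rule tendsto_eventually_eq')
  moreover have "((\<lambda>z. mat ((z - a) ^ Suc k) :: complex^'n^'n) \<longlongrightarrow> mat (0 ^ Suc k)) (at a)"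
    by (intro tendsto_mat tendsto_power tendsto_linear_factor)
  ultimately have "L ** K = 0" using tendsto_unique[of "at a"] by fastforce
  then have "matrix_inv L ** (L ** K) = 0" by simp
  then show False using K(1) matrix_inv_mult(2)[OF assms(4)] by (simp add: matrix_mul_assoc)
qed

section \<open>Eventually free block Jacobi matrices\<close>

text \<open>A Jost solution \<open>f\<close> enters only through \<open>u = f\<^sub>0\<close> and \<open>v = f\<^sub>-\<^sub>1\<close>, normalized by \<open>A\<^sub>-\<^sub>1 = 1\<close>;
  removing the first block row and column replaces \<open>(u, v)\<close> by \<open>(f\<^sub>1, A\<^sub>0\<^sup>* f\<^sub>0)\<close>. The two algebraic
  identities are Wronskians.\<close>

definition jost_pair ::
  "(nat \<Rightarrow> complex^'l^'l) \<Rightarrow> (nat \<Rightarrow> complex^'l^'l) \<Rightarrow> (complex \<Rightarrow> complex^'l^'l)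
    \<Rightarrow> (complex \<Rightarrow> complex^'l^'l) \<Rightarrow> bool" where
  "jost_pair A B u v \<longleftrightarrow> rmat u \<and> rmat v \<and> (\<forall>a. a \<noteq> 0 \<longrightarrow> reg a u \<and> reg a v) \<and>
    (\<forall>z. z \<noteq> 0 \<longrightarrow> sharp v z ** u z - sharp u z ** v z = mat (z - inverse z)) \<and>
    (\<forall>z. z \<noteq> 0 \<longrightarrow> hconj (v (cnj z)) ** u z - hconj (u (cnj z)) ** v z = 0) \<and>
    (\<forall>z. z \<noteq> 0 \<longrightarrow> cmod z < 1 \<longrightarrow> (\<exists>\<Psi>. \<Psi> 0 = u z \<and> summable (\<lambda>n. (norm (\<Psi> n))\<^sup>2) \<and>
      (\<forall>n. jacobi_mat A B \<Psi> n - cscale (joukowski z) (\<Psi> n) = (if n = 0 then - v z else 0))))"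

text \<open>Constancy of the Wronskian of two solutions. The energies are linked by
  \<open>cnj e' = e\<close>, which covers both reflections in use, in the circle and in the real
  axis.\<close>

lemma wronskian_step:
  fixes A B u v u' v' x y x' y' :: "complex^'l^'l"
  assumes "invertible A" "hermitian B" "cnj e' = e"
    and u: "hconj A ** u = v'" and v: "v = cscale e u - B ** u - A ** u'"
    and x: "hconj A ** x = y'" and y: "y = cscale e' x - B ** x - A ** x'"
  shows "hconj y ** u - hconj x ** v = hconj y' ** u' - hconj x' ** v'"
proof -
  have "hconj y ** u - hconj x ** v =
    hconj x ** (A ** u') - hconj x' ** (hconj A ** u)"
    using assms(2) unfolding v y hermitian_def
    by (simp add: hconj_simps matrix_distribs assms(3) matrix_mul_assoc)
  also have "hconj x ** (A ** u') = hconj y' ** u'"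
    unfolding x[symmetric] by (simp add: hconj_mult matrix_mul_assoc)
  finally show ?thesis unfolding u .
qed

lemma norm_unitary_mult: "U ** hconj U = mat 1 \<Longrightarrow> norm (hconj U ** X) = norm X"
  for U X :: "complex^'l^'l"
proof -
  assume U: "U ** hconj U = mat 1"
  have "hconj (hconj U ** X) ** (hconj U ** X) = hconj X ** (U ** hconj U) ** X"
    by (simp add: hconj_mult matrix_mul_assoc)
  then have "(norm (hconj U ** X))\<^sup>2 = (norm X)\<^sup>2"
    unfolding retrace_hconj_mult[symmetric] U by simp
  then show ?thesis by simp
qed

lemma mat_diff: "mat (a - b) = mat a - (mat b :: complex^'n^'n)"
  by (rule matrix_eqI) (simp add: mat_def)

lemma reg_ident_inverse: "a \<noteq> 0 \<Longrightarrow> reg a (\<lambda>z. mat (inverse z))"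
  by (rule reg_mat[OF tendsto_inverse[OF tendsto_ident_at]])

lemma jost_pair_free:
  fixes A B :: "nat \<Rightarrow> complex^'l^'l"
  assumes free: "\<And>n. B n = 0" "\<And>n. A n ** hconj (A n) = mat 1"
  shows "jost_pair A B (\<lambda>_. mat 1) (\<lambda>z. mat (inverse z))"
proof -
  \<comment> \<open>The unitary products \<open>U n\<close> absorb the coefficients, so that z^n U_n
    solves the recurrence just as z^n solves the scalar free one.\<close>
  define U where "U = rec_nat (mat 1) (\<lambda>n X. hconj (A n) ** X)"
  have U: "U 0 = mat 1" "U (Suc n) = hconj (A n) ** U n" for n by (simp_all add: U_def)
  have AU: "A n ** U (Suc n) = U n" for n
    by (simp add: U free matrix_mul_assoc)
  have normU: "norm (U n) = norm (mat 1 :: complex^'l^'l)" for n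
    by (induction n) (simp_all add: U norm_unitary_mult free)
  have "\<exists>\<Psi>. \<Psi> 0 = mat 1 \<and> summable (\<lambda>n. (norm (\<Psi> n))\<^sup>2) \<and>
      (\<forall>n. jacobi_mat A B \<Psi> n - cscale (joukowski z) (\<Psi> n) = (if n = 0 then - mat (inverse z) else 0))"
    if z: "z \<noteq> 0" "cmod z < 1" for z
  proof (intro exI[of _ "\<lambda>n. cscale (z ^ n) (U n)"] conjI allI)
    show "cscale (z ^ 0) (U 0) = mat 1" by (simp add: U)
    have "summable (\<lambda>n. ((cmod z)\<^sup>2) ^ n * (norm (mat 1 :: complex^'l^'l))\<^sup>2)"
      by (intro summable_mult2 summable_geometric) (use z in \<open>simp add: power_less_one_iff\<close>)
    then show "summable (\<lambda>n. (norm (cscale (z ^ n) (U n)))\<^sup>2)"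
      by (simp add: norm_cscale normU norm_power power_mult_distrib power_even_eq[symmetric] mult.commute
          flip: power_mult)
    fix n
    show "jacobi_mat A B (\<lambda>n. cscale (z ^ n) (U n)) n - cscale (joukowski z) (cscale (z ^ n) (U n)) =
      (if n = 0 then - mat (inverse z) else 0)"
    proof (cases n)
      case 0
      then show ?thesis using AU[of 0]
        by (simp add: jacobi_mat_def free cscale_mult_right U cscale_mat joukowski_def)
          (simp add: vec_eq_iff mat_def)
    next
      case (Suc k)
      have "jacobi_mat A B (\<lambda>n. cscale (z ^ n) (U n)) n = cscale (z ^ k) (U (Suc k)) + cscale (z ^ Suc (Suc k)) (U (Suc k))"
        using Suc AU[of "Suc k"] by (simp add: jacobi_mat_def free cscale_mult_right U(2)[of k, symmetric])
      also have "\<dots> = cscale (z ^ k + z ^ Suc (Suc k)) (U (Suc k))" by (simp add: cscale_add_left)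
      also have "z ^ k + z ^ Suc (Suc k) = joukowski z * z ^ Suc k"
        using z by (simp add: joukowski_def field_simps)
      finally show ?thesis using Suc by simp
    qed
  qed
  then show ?thesis
    unfolding jost_pair_def
    by (simp add: sharp_def rmat_mat ratfun_inverse reg_ident_inverse mat_diff)
qed

lemma jost_pair_step:
  fixes A B :: "nat \<Rightarrow> complex^'l^'l"
  assumes inv: "invertible (A 0)" and herm: "hermitian (B 0)"
    and pair: "jost_pair (\<lambda>n. A (Suc n)) (\<lambda>n. B (Suc n)) u' v'"
  shows "\<exists>u v. jost_pair A B u v"
proof -
  \<comment> \<open>Attaching a block row in front: \<open>u\<close> is forced by the relation
    between the two pairs, \<open>v\<close> by row 0 of the recurrence.\<close>
  define u where "u z = matrix_inv (hconj (A 0)) ** v' z" for z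
  define v where "v z = cscale (joukowski z) (u z) - B 0 ** u z - A 0 ** u' z" for z
  have Au: "hconj (A 0) ** u z = v' z" for z
    using matrix_inv_mult(1)[OF invertible_hconj[OF inv]] by (simp add: u_def matrix_mul_assoc)
  have r: "rmat u'" "rmat v'" using pair by (simp_all add: jost_pair_def)
  have rg: "reg a u'" "reg a v'" if "a \<noteq> 0" for a using pair that by (simp_all add: jost_pair_def)
  have ru: "rmat u" unfolding u_def by (intro rmat_mult rmat_const r)
  have rj: "ratfun joukowski" unfolding joukowski_def[abs_def]
    by (intro ratfun_add ratfun_id ratfun_inverse)
  have rv: "rmat v" unfolding v_def by (intro rmat_diff rmat_mult rmat_cscale rmat_const r ru rj)
  have gu: "reg a u" if "a \<noteq> 0" for a unfolding u_def by (intro reg_mult reg_const rg that)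
  have gv: "reg a v" if "a \<noteq> 0" for a
  proof -
    have "(joukowski \<longlongrightarrow> joukowski a) (at a)"
      unfolding joukowski_def[abs_def] by (intro tendsto_add tendsto_inverse tendsto_ident_at that)
    then show ?thesis unfolding v_def
      by (intro reg_diff reg_mult reg_const rg gu that reg_cscale[of joukowski])
  qed
  have w1: "sharp v z ** u z - sharp u z ** v z = mat (z - inverse z)" if "z \<noteq> 0" for z
  proof -
    have "cnj (joukowski (inverse (cnj z))) = joukowski z"
      by (metis joukowski_inverse joukowski_cnj complex_cnj_cnj)
    then have "sharp v z ** u z - sharp u z ** v z = sharp v' z ** u' z - sharp u' z ** v' z"
      unfolding sharp_def by (rule wronskian_step[OF inv herm _ Au v_def Au v_def])
    then show ?thesis using pair that by (simp add: jost_pair_def)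
  qed
  have w2: "hconj (v (cnj z)) ** u z - hconj (u (cnj z)) ** v z = 0" if "z \<noteq> 0" for z
  proof -
    have "cnj (joukowski (cnj z)) = joukowski z" by (simp add: joukowski_cnj)
    then have "hconj (v (cnj z)) ** u z - hconj (u (cnj z)) ** v z
      = hconj (v' (cnj z)) ** u' z - hconj (u' (cnj z)) ** v' z"
      by (rule wronskian_step[OF inv herm _ Au v_def Au v_def])
    then show ?thesis using pair that by (simp add: jost_pair_def)
  qed
  have sol: "\<exists>\<Psi>. \<Psi> 0 = u z \<and> summable (\<lambda>n. (norm (\<Psi> n))\<^sup>2) \<and>
      (\<forall>n. jacobi_mat A B \<Psi> n - cscale (joukowski z) (\<Psi> n) = (if n = 0 then - v z else 0))"
    if z: "z \<noteq> 0" "cmod z < 1" for z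
  proof -
    obtain \<Psi>' where \<Psi>': "\<Psi>' 0 = u' z" "summable (\<lambda>n. (norm (\<Psi>' n))\<^sup>2)"
      "\<And>n. jacobi_mat (\<lambda>n. A (Suc n)) (\<lambda>n. B (Suc n)) \<Psi>' n - cscale (joukowski z) (\<Psi>' n)
        = (if n = 0 then - v' z else 0)"
      using pair z unfolding jost_pair_def by blast
    define \<Psi> where "\<Psi> n = (case n of 0 \<Rightarrow> u z | Suc k \<Rightarrow> \<Psi>' k)" for n
    have \<Psi>: "\<Psi> 0 = u z" "\<Psi> (Suc k) = \<Psi>' k" for k by (simp_all add: \<Psi>_def)
    have "summable (\<lambda>n. (norm (\<Psi> (Suc n)))\<^sup>2)" using \<Psi>'(2) by (simp add: \<Psi>)
    then have "summable (\<lambda>n. (norm (\<Psi> n))\<^sup>2)" by (subst (asm) summable_Suc_iff)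
    moreover have "jacobi_mat A B \<Psi> n - cscale (joukowski z) (\<Psi> n) = (if n = 0 then - v z else 0)" for n
    proof (cases n)
      case 0
      then show ?thesis by (simp add: jacobi_mat_def \<Psi> \<Psi>'(1) v_def)
    next
      case (Suc k)
      show ?thesis
      proof (cases k)
        case 0
        then show ?thesis using Suc \<Psi>'(3)[of 0]
          by (simp add: jacobi_mat_def \<Psi> Au) (simp add: algebra_simps)
      next
        case (Suc j)
        then show ?thesis using \<open>n = Suc k\<close> \<Psi>'(3)[of k] by (simp add: jacobi_mat_def \<Psi>)
      qed
    qed
    ultimately show ?thesis using \<Psi>(1) by blast
  qed
  show ?thesis
    by (intro exI[of _ u] exI[of _ v]) (simp add: jost_pair_def ru rv gu gv w1 w2 sol)
qed

text \<open>Induction on the length of the perturbed part, with the coefficient sequences arbitrary: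
  the free tail is solved explicitly and block rows are put back in front of it.\<close>

lemma jost_pair_exists:
  fixes A B :: "nat \<Rightarrow> complex^'l^'l"
  assumes "\<And>n. invertible (A n)" "\<And>n. hermitian (B n)"
    and "\<And>n. n \<ge> N \<Longrightarrow> B n = 0" "\<And>n. n \<ge> N \<Longrightarrow> A n ** hconj (A n) = mat 1"
  shows "\<exists>u v. jost_pair A B u v"
  using assms
proof (induction N arbitrary: A B)
  case 0
  then have "jost_pair A B (\<lambda>_. mat 1) (\<lambda>z. mat (inverse z))" by (intro jost_pair_free) simp_all
  then show ?case by blast
next
  case (Suc N)
  have "\<exists>u v. jost_pair (\<lambda>n. A (Suc n)) (\<lambda>n. B (Suc n)) u v"
    by (rule Suc.IH) (simp_all add: Suc.prems)
  then show ?case using jost_pair_step Suc.prems(1,2) by blast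
qed

lemma sharp_compose: "sharp F = (\<lambda>z. hconj (F (cnj (inverse z))))"
  by (simp add: sharp_def fun_eq_iff)

lemma tendsto_sharp:
  assumes "(F \<longlongrightarrow> L) (at (inverse (cnj a)))" "a \<noteq> 0"
  shows "(sharp F \<longlongrightarrow> hconj L) (at a)"
proof -
  have "(F \<longlongrightarrow> L) (at (cnj (inverse a)))" using assms(1) by simp
  then have "((\<lambda>z. hconj (F (cnj z))) \<longlongrightarrow> hconj L) (at (inverse a))"
    by (intro tendsto_hconj tendsto_compose_cnj)
  then show ?thesis unfolding sharp_compose by (rule tendsto_compose_inverse[OF _ assms(2)])
qed

lemma reg_sharp: "reg (inverse (cnj a)) F \<Longrightarrow> a \<noteq> 0 \<Longrightarrow> reg a (sharp F)"
  unfolding reg_def using tendsto_sharp by blast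

lemma eventually_sharp:
  assumes "\<forall>\<^sub>F z in cofinite. P z"
  shows "\<forall>\<^sub>F z in cofinite. P (inverse (cnj z))"
  by (rule eventually_cofinite_involution[OF assms]) simp

lemma minus_inverse_eq_0_iff: "z \<noteq> 0 \<Longrightarrow> z - inverse z = 0 \<longleftrightarrow> z = 1 \<or> z = (-1 :: complex)"
proof -
  assume "z \<noteq> 0"
  then have "z - inverse z = 0 \<longleftrightarrow> z\<^sup>2 = 1" by (simp add: field_simps power2_eq_square)
  then show ?thesis by (simp add: power2_eq_1_iff)
qed

lemma tendsto_inverse_minus_inverse:
  assumes "a \<noteq> 0" "a \<noteq> 1" "a \<noteq> (-1 :: complex)"
  shows "((\<lambda>z. inverse (z - inverse z)) \<longlongrightarrow> inverse (a - inverse a)) (at a)"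
  using assms minus_inverse_eq_0_iff[of a]
  by (intro tendsto_inverse tendsto_diff tendsto_ident_at) auto

lemma eventually_nondegenerate_point: "\<forall>\<^sub>F z in cofinite. z \<noteq> 0 \<and> z - inverse z \<noteq> (0 :: complex)"
  using eventually_neq_cofinite[of 0] eventually_neq_cofinite[of 1] eventually_neq_cofinite[of "-1"]
  by eventually_elim (use minus_inverse_eq_0_iff in blast)

section \<open>Conditions (B), (C) and (D) for the quotient of a Jost pair\<close>

locale jost_extension =
  fixes A B :: "nat \<Rightarrow> complex^'l^'l" and u v R :: "complex \<Rightarrow> complex^'l^'l"
  assumes pair: "jost_pair A B u v"
    and inv: "\<forall>\<^sub>F z in cofinite. invertible (v z)"
    and R: "\<forall>\<^sub>F z in cofinite. R z = u z ** matrix_inv (v z)"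
    and disk_real: "\<And>w. cmod w < 1 \<Longrightarrow> w \<noteq> 0 \<Longrightarrow> \<not> reg w R \<Longrightarrow> Im w = 0"
    and disk_simple: "\<And>w. cmod w < 1 \<Longrightarrow> w \<noteq> 0 \<Longrightarrow> reg w (\<lambda>z. cscale (z - w) (R z))"
begin

lemma rmat_uv: "rmat u" "rmat v" and reg_uv: "a \<noteq> 0 \<Longrightarrow> reg a u" "a \<noteq> 0 \<Longrightarrow> reg a v"
  and w1: "z \<noteq> 0 \<Longrightarrow> sharp v z ** u z - sharp u z ** v z = mat (z - inverse z)"
  and w2: "z \<noteq> 0 \<Longrightarrow> hconj (v (cnj z)) ** u z - hconj (u (cnj z)) ** v z = 0"
  using pair unfolding jost_pair_def by blast+

lemma rmat_v_inv: "rmat (\<lambda>z. matrix_inv (v z))"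
  by (rule rmat_matrix_inv[OF rmat_uv(2) inv])

lemma rmat_R: "rmat R"
proof (rule rmat_cong)
  show "rmat (\<lambda>z. u z ** matrix_inv (v z))" by (rule rmat_mult[OF rmat_uv(1) rmat_v_inv])
  show "\<forall>\<^sub>F z in cofinite. u z ** matrix_inv (v z) = R z" using R by eventually_elim simp
qed

lemma reg_sharp_uv: "a \<noteq> 0 \<Longrightarrow> reg a (sharp u)" "a \<noteq> 0 \<Longrightarrow> reg a (sharp v)"
  by (simp_all add: reg_sharp reg_uv)

text \<open>Everything follows from R = u v^(-1) and the two Wronskians at points where
  \<open>v\<close> and its reflection are invertible. The formulas for \<open>jump_inv\<close>
  contain no inverse of \<open>v\<close> and yield (C) and the values in (D); the two products with
  a factor in front of \<open>R\<close> govern residues in the disk, and the last identity the poles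
  at 1 and -1.\<close>

lemma generic_identities:
  "\<forall>\<^sub>F z in cofinite. invertible (R z - sharp R z) \<and>
    jump_inv R z = cscale (inverse (z - inverse z)) (v z ** sharp v z) \<and>
    jump_inv R z ** R z = cscale (inverse (z - inverse z)) (v z ** sharp u z) + mat 1 \<and>
    hconj (v (cnj z)) ** R z = hconj (u (cnj z)) \<and>
    (u z ** sharp v z - mat (z - inverse z)) ** R z = u z ** sharp u z \<and>
    u z ** matrix_inv (v z) - sharp (\<lambda>z. matrix_inv (v z)) z ** sharp u z =
      cscale (z - inverse z) (sharp (\<lambda>z. matrix_inv (v z)) z ** matrix_inv (v z))"
  using eventually_nondegenerate_point inv eventually_sharp[OF inv] R eventually_sharp[OF R]
proof eventually_elim
  case (elim z)
  define s where "s = z - inverse z"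
  define H where "H = matrix_inv (v z)"
  define K where "K = sharp (\<lambda>z. matrix_inv (v z)) z"
  have s: "s \<noteq> 0" "z \<noteq> 0" using elim(1) by (auto simp: s_def)
  have vH: "v z ** H = mat 1" using elim(2) by (simp add: H_def matrix_inv_mult)
  have vHX: "v z ** (H ** X) = X" for X using vH by (simp add: matrix_mul_assoc)
  have Kv: "K ** sharp v z = mat 1" "sharp v z ** K = mat 1"
    using elim(3) by (simp_all add: K_def sharp_def matrix_inv_mult flip: hconj_mult)
  have vKX: "sharp v z ** (K ** X) = X" "K ** (sharp v z ** X) = X" for X
    using Kv by (simp_all add: matrix_mul_assoc)
  have Rz: "R z = u z ** H" using elim(4) by (simp add: H_def)
  have sR: "sharp R z = K ** sharp u z"
    using elim(5) by (simp add: sharp_def K_def hconj_mult)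
  have svu: "sharp v z ** u z = sharp u z ** v z + mat s"
    using w1[OF s(2)] by (simp add: s_def diff_eq_eq add.commute)
  have svuX: "sharp v z ** (u z ** X) = sharp u z ** (v z ** X) + cscale s X" for X
  proof -
    have "sharp v z ** (u z ** X) = (sharp u z ** v z + mat s) ** X"
      by (simp add: matrix_mul_assoc svu)
    then show ?thesis
      using cscale_mult_left[of s "mat 1" X] by (simp add: matrix_add_rdistrib cscale_mat matrix_mul_assoc)
  qed
  define J where "J = cscale (inverse s) (v z ** sharp v z)"
  have JR: "J ** R z = cscale (inverse s) (v z ** sharp u z) + mat 1"
    using s by (simp add: J_def Rz cscale_mult_left cscale_mult_right cscale_add matrix_add_ldistrib
        svuX vH flip: matrix_mul_assoc)
  have JsR: "J ** sharp R z = cscale (inverse s) (v z ** sharp u z)"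
    by (simp add: J_def sR cscale_mult_left vKX flip: matrix_mul_assoc)
  have J: "J ** (R z - sharp R z) = mat 1" unfolding matrix_sub_ldistrib' JR JsR by simp
  then have inv: "invertible (R z - sharp R z)" using invertible_left_inverse by blast
  have jump: "jump_inv R z = J" unfolding jump_inv_def by (rule matrix_inv_unique[OF J])
  have "hconj (v (cnj z)) ** u z = hconj (u (cnj z)) ** v z" using w2[OF s(2)] by simp
  then have E3: "hconj (v (cnj z)) ** R z = hconj (u (cnj z))"
    unfolding Rz matrix_mul_assoc by (simp add: vH flip: matrix_mul_assoc)
  have E4: "(u z ** sharp v z - mat s) ** R z = u z ** sharp u z"
  proof -
    have "mat s ** R z = cscale s (u z ** H)"
      using cscale_mult_left[of s "mat 1" "R z"] by (simp add: cscale_mat Rz)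
    then show ?thesis
      by (simp add: matrix_sub_rdistrib' Rz svuX vH matrix_add_ldistrib cscale_mult_right flip: matrix_mul_assoc)
  qed
  have "K ** (sharp v z ** (u z ** H)) = K ** (sharp u z ** (v z ** H) + cscale s H)" unfolding svuX ..
  then have E5: "u z ** H - K ** sharp u z = cscale s (K ** H)"
    by (simp add: vKX vH matrix_add_ldistrib cscale_mult_right)
  show ?case
    using inv jump JR E3 E4 E5 unfolding J_def s_def[symmetric] H_def[symmetric] K_def[symmetric] by simp
qed

lemma ident:
  shows invertible_jump: "\<forall>\<^sub>F z in cofinite. invertible (R z - sharp R z)"
    and jump_eq: "\<forall>\<^sub>F z in cofinite. cscale (inverse (z - inverse z)) (v z ** sharp v z) = jump_inv R z"
    and jump_R_eq: "\<forall>\<^sub>F z in cofinite. cscale (inverse (z - inverse z)) (v z ** sharp u z) + mat 1 = jump_inv R z ** R z"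
    and vR_eq: "\<forall>\<^sub>F z in cofinite. hconj (v (cnj z)) ** R z = hconj (u (cnj z))"
    and uvR_eq: "\<forall>\<^sub>F z in cofinite. (u z ** sharp v z - mat (z - inverse z)) ** R z = u z ** sharp u z"
    and H_eq: "\<forall>\<^sub>F z in cofinite. u z ** matrix_inv (v z) - sharp (\<lambda>z. matrix_inv (v z)) z ** sharp u z =
      cscale (z - inverse z) (sharp (\<lambda>z. matrix_inv (v z)) z ** matrix_inv (v z))"
  using generic_identities by (auto elim!: eventually_mono)

lemma rmat_jump: "rmat (jump_inv R)"
proof (rule rmat_cong[OF _ jump_eq])
  show "rmat (\<lambda>z. cscale (inverse (z - inverse z)) (v z ** sharp v z))"
    by (intro rmat_cscale rmat_mult rmat_uv rmat_sharp ratfun_inverse ratfun_diff ratfun_id)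
qed

text \<open>On the circle the reflection of a function converges to the adjoint of its own limit, so
  the Wronskian becomes V^* U - U^* V = a - 1/a. A kernel vector x of \<open>V\<close> would give (a
  - 1/a) |x|^2 = 0.\<close>

lemma reg_sphere:
  assumes "cmod a = 1" "a \<noteq> 1" "a \<noteq> -1"
  shows "reg a R"
proof -
  have "cnj a * a = 1" using complex_norm_square[of a] assms(1) by (simp add: mult.commute)
  then have a: "a \<noteq> 0" "inverse (cnj a) = a" by (auto intro: inverse_unique)
  obtain U V where U: "(u \<longlongrightarrow> U) (at a)" and V: "(v \<longlongrightarrow> V) (at a)"
    using reg_uv[OF a(1)] unfolding reg_def by blast
  have sU: "(sharp u \<longlongrightarrow> hconj U) (at a)" and sV: "(sharp v \<longlongrightarrow> hconj V) (at a)"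
    using tendsto_sharp[of u U a] tendsto_sharp[of v V a] U V a by auto
  have "((\<lambda>z. sharp v z ** u z - sharp u z ** v z) \<longlongrightarrow> hconj V ** U - hconj U ** V) (at a)"
    by (intro tendsto_intros U V sU sV)
  moreover have "\<forall>\<^sub>F z in at a. sharp v z ** u z - sharp u z ** v z = mat (z - inverse z)"
    using eventually_cofinite_at[OF eventually_neq_cofinite[of 0]] by eventually_elim (rule w1)
  ultimately have "((\<lambda>z. mat (z - inverse z)) \<longlongrightarrow> hconj V ** U - hconj U ** V) (at a)"
    by (rule tendsto_eventually_eq')
  moreover have "((\<lambda>z. mat (z - inverse z) :: complex^'l^'l) \<longlongrightarrow> mat (a - inverse a)) (at a)"
    by (intro tendsto_mat tendsto_diff tendsto_inverse tendsto_ident_at a)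
  ultimately have W: "hconj V ** U - hconj U ** V = mat (a - inverse a)"
    using tendsto_unique[of "at a"] by fastforce
  have "invertible V"
  proof (rule ccontr)
    assume "\<not> invertible V"
    then obtain x where x: "x \<noteq> 0" "V *v x = 0" using not_invertible_vec by blast
    have "cinner x (mat (a - inverse a) *v x) = cinner x (hconj V *v (U *v x)) - cinner x (hconj U *v (V *v x))"
      unfolding W[symmetric] by (simp add: matrix_vector_mult_diff_rdistrib cinner_diff_right matrix_vector_mul_assoc)
    also have "\<dots> = 0" unfolding cinner_adjoint[of x "hconj V"] using x by simp
    finally have "cinner x (mat (a - inverse a) *v x) = 0" .
    moreover have "mat (a - inverse a) *v x = (a - inverse a) *s x"
      using cscale_vec[of "a - inverse a" "mat 1" x]
      by (simp only: cscale_mat mult_1_right matrix_vector_mul_lid)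
    ultimately have "(a - inverse a) * cinner x x = 0" by (simp only: cinner_scale_right)
    then show False using x(1) minus_inverse_eq_0_iff[OF a(1)] assms(2,3) cinner_self_eq_0[of x] by simp
  qed
  then have "reg a (\<lambda>z. u z ** matrix_inv (v z))"
    by (intro reg_mult reg_uv a reg_matrix_inv[OF rmat_uv(2) inv V])
  then show ?thesis by (rule reg_cong_cofinite) (use R in \<open>auto elim: eventually_mono\<close>)
qed

text \<open>Let v^(-1) have a pole of order k + 1 with leading coefficient L. The left side of
  \<open>H_eq\<close> has order at most k + 1, the right side order 2 k + 1 with leading coefficient
  a nonzero multiple of L^* L. For k > 0 this forces L^* L = 0.\<close>

lemma simple_pole_at_edge:
  assumes a: "a = 1 \<or> a = -1"
  shows "reg a (\<lambda>z. cscale (z - a) (R z))"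
proof -
  define H where "H = (\<lambda>z. matrix_inv (v z))"
  have rH: "rmat H" unfolding H_def by (rule rmat_v_inv)
  have a0: "a \<noteq> 0" "inverse (cnj a) = a" "cnj a = a" "a * a = 1" using a by auto
  have "reg a (\<lambda>z. cscale (z - a) (H z))"
  proof (cases "reg a H")
    case True
    then show ?thesis using reg_cscale[OF tendsto_linear_factor] by blast
  next
    case False
    then obtain k L where L: "L \<noteq> 0" "((\<lambda>z. cscale ((z - a) ^ Suc k) (H z)) \<longlongrightarrow> L) (at a)"
      using rmat_minimal_pole[OF rH] by blast
    define K where "K = (\<lambda>z. cscale ((z - a) ^ Suc k) (H z))"
    have K: "(K \<longlongrightarrow> L) (at a)" using L(2) by (simp add: K_def)
    have sK: "(sharp K \<longlongrightarrow> hconj L) (at a)" using tendsto_sharp[of K L a] K a0 by simp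
    have "k = 0"
    proof (rule ccontr)
      assume "k \<noteq> 0"
      obtain U where U: "(u \<longlongrightarrow> U) (at a)" using reg_uv(1)[OF a0(1)] unfolding reg_def by blast
      have sU: "(sharp u \<longlongrightarrow> hconj U) (at a)" using tendsto_sharp[of u U a] U a0 by simp
      \<comment> \<open>The left side of \<open>H_eq\<close> times (z - a)^(2 k + 1), up to a power
        of -a/z. That factor stems from 1/z - a = -(a/z) (z - a), where a^2 = 1 enters.\<close>
      define X where "X z = cscale ((z - a) ^ k) (cscale ((- (a / z)) ^ Suc k) (u z ** K z) - sharp K z ** sharp u z)" for z
      have "(X \<longlongrightarrow> cscale (0 ^ k) (cscale ((- (a / a)) ^ Suc k) (U ** L) - hconj L ** hconj U)) (at a)"
        unfolding X_def
        by (intro tendsto_cscale tendsto_power tendsto_linear_factor tendsto_diff tendsto_matrix_mult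
            tendsto_minus tendsto_divide tendsto_const tendsto_ident_at U K sK sU a0)
      then have X0: "(X \<longlongrightarrow> 0) (at a)" using \<open>k \<noteq> 0\<close> by (simp add: power_0_left)
      have "\<forall>\<^sub>F z in cofinite. X z = cscale ((z + a) / z) (sharp K z ** K z)"
        using H_eq eventually_neq_cofinite[of 0] eventually_neq_cofinite[of a]
      proof eventually_elim
        case (elim z)
        define q where "q = (inverse z - a) ^ Suc k"
        have sKz: "sharp K z = cscale q (sharp H z)"
          unfolding sharp_def K_def q_def by (simp add: hconj_cscale a0(3))
        have HI: "u z ** H z - sharp H z ** sharp u z = cscale (z - inverse z) (sharp H z ** H z)"
          using elim(1) unfolding H_def .
        have Kz: "K z = cscale ((z - a) ^ Suc k) (H z)" by (simp add: K_def)
        have "inverse z - a = - (a / z) * (z - a)" using elim(2) a0(4) by (simp add: field_simps)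
        then have q: "q = (- (a / z)) ^ Suc k * (z - a) ^ Suc k" unfolding q_def by (simp only: power_mult_distrib)
        have s: "z - inverse z = (z - a) * ((z + a) / z)" using elim(2) a0(4) by (simp add: field_simps)
        have "cscale (z - a) (X z) = cscale (q * (z - a) ^ Suc k) (u z ** H z - sharp H z ** sharp u z)"
          unfolding X_def sKz Kz cscale_cscale cscale_mult_right cscale_mult_left cscale_diff
          by (simp add: q algebra_simps)
        also have "\<dots> = cscale (z - a) (cscale ((z + a) / z) (sharp K z ** K z))"
          unfolding HI sKz Kz cscale_mult_right cscale_mult_left cscale_cscale s by (simp only: mult_ac)
        finally have "cscale (inverse (z - a)) (cscale (z - a) (X z)) =
          cscale (inverse (z - a)) (cscale (z - a) (cscale ((z + a) / z) (sharp K z ** K z)))" by simp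
        moreover have "inverse (z - a) * (z - a) = 1" using elim(3) by simp
        ultimately show ?case by (simp only: cscale_cscale mult.assoc[symmetric] mult_1_left cscale_1)
      qed
      then have ev: "\<forall>\<^sub>F z in at a. X z = cscale ((z + a) / z) (sharp K z ** K z)"
        by (rule eventually_cofinite_at)
      have "((\<lambda>z. cscale ((z + a) / z) (sharp K z ** K z)) \<longlongrightarrow> cscale ((a + a) / a) (hconj L ** L)) (at a)"
        by (intro tendsto_cscale tendsto_divide tendsto_add tendsto_const tendsto_ident_at tendsto_matrix_mult K sK a0)
      then have "cscale ((a + a) / a) (hconj L ** L) = 0"
        using tendsto_unique[OF _ _ tendsto_eventually_eq'[OF X0 ev]] by simp
      then have "hconj L ** L = 0" using a0(1) by (simp add: cscale_eq_0_iff)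
      then have "(norm L)\<^sup>2 = 0" by (simp add: retrace_def flip: retrace_hconj_mult)
      then show False using L(1) by simp
    qed
    then show ?thesis using K unfolding K_def by (simp add: regI)
  qed
  then have "reg a (\<lambda>z. u z ** cscale (z - a) (H z))" by (intro reg_mult reg_uv a0)
  then show ?thesis
    by (rule reg_cong_cofinite) (use R in \<open>auto elim!: eventually_mono simp: H_def cscale_mult_right\<close>)
qed

lemma cond_B: "cond_B R"
  unfolding cond_B_def
proof (intro conjI ballI)
  show "\<not> is_pole R z" if "z \<in> sphere 0 1 - {1, -1}" for z
    using reg_sphere[of z] that rmat_pole_iff[OF rmat_R] by auto
  show "at_most_simple_pole R 1" "at_most_simple_pole R (-1)"
    by (rule iffD2[OF at_most_simple_pole_iff[OF rmat_R] simple_pole_at_edge], simp)+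
qed

lemma cond_C: "cond_C R"
  unfolding cond_C_def
proof (intro conjI allI impI)
  have "\<forall>\<^sub>F z in cofinite. det (R z - sharp R z) \<noteq> 0"
    using invertible_jump by eventually_elim (simp add: invertible_det_nz)
  then have "\<exists>\<^sub>F z in cofinite. det (R z - sharp R z) \<noteq> 0"
    by (rule eventually_frequently[rotated]) (simp add: infinite_UNIV_char_0)
  then show "jump_nondegenerate R" unfolding jump_nondegenerate_def by (simp add: frequently_cofinite)
  show "\<not> is_pole (jump_inv R) z" if "z \<notin> {0, 1, -1}" for z
    unfolding rmat_pole_iff[OF rmat_jump] not_not
    by (rule reg_cong_cofinite[OF _ jump_eq], rule reg_cscale[OF tendsto_inverse_minus_inverse])
      (use that in \<open>auto intro!: reg_mult reg_uv reg_sharp_uv\<close>)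
  have edge: "at_most_simple_pole (jump_inv R) a" if a: "a = 1 \<or> a = -1" for a
    unfolding at_most_simple_pole_iff[OF rmat_jump]
  proof (rule reg_cong_cofinite)
    have a0: "a \<noteq> 0" "a + a \<noteq> 0" "a * a = 1" using a by auto
    \<comment> \<open>(z - a) / (z - 1/z) simplifies to z / (z + a), which is finite at
      \<open>a\<close>.\<close>
    have "((\<lambda>z. z / (z + a)) \<longlongrightarrow> a / (a + a)) (at a)"
      by (intro tendsto_divide tendsto_add tendsto_const tendsto_ident_at a0)
    then show "reg a (\<lambda>z. cscale (z / (z + a)) (v z ** sharp v z))"
      by (rule reg_cscale) (intro reg_mult reg_uv reg_sharp_uv a0)
    show "\<forall>\<^sub>F z in cofinite. cscale (z / (z + a)) (v z ** sharp v z) = cscale (z - a) (jump_inv R z)"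
      using jump_eq eventually_neq_cofinite[of a] eventually_nondegenerate_point
    proof eventually_elim
      case (elim z)
      have "z - inverse z = (z - a) * ((z + a) / z)" using elim(3) a0(3) by (simp add: field_simps)
      then have "(z - a) * inverse (z - inverse z) = z / (z + a)" using elim(2) by simp
      then show ?case unfolding elim(1)[symmetric] by simp
    qed
  qed
  show "at_most_simple_pole (jump_inv R) 1" "at_most_simple_pole (jump_inv R) (-1)"
    by (rule edge, simp)+
qed

text \<open>Poles in the disk are real, so conjugation fixes \<open>w\<close>. With the limits
  \<open>U\<close>, \<open>V\<close> at w and \<open>V1\<close> at 1/w, and t = 1/w - w, the two
  values in (D) are V1 V^* / t and V1 U^* / t + 1. The inclusions become the residue equations V^* P
  = 0 and (U V1^* + t) P = 0.\<close>

lemma cond_D: "cond_D R"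
  unfolding cond_D_def
proof (intro ballI impI conjI)
  fix w assume w: "w \<in> ball 0 1 - {0}" and "is_pole R w" "is_pole R (inverse w)"
  have w0: "w \<noteq> 0" "cmod w < 1" using w by auto
  have "\<not> reg w R" using \<open>is_pole R w\<close> rmat_pole_iff[OF rmat_R] by blast
  then have "Im w = 0" using disk_real w0 by blast
  then have cw: "cnj w = w" by (simp add: complex_eq_iff)
  obtain P where P: "((\<lambda>z. cscale (z - w) (R z)) \<longlongrightarrow> P) (at w)"
    using disk_simple[OF w0(2,1)] unfolding reg_def by blast
  have res: "matrix_residue R w = P" by (rule rmat_residue[OF rmat_R P])
  have w1': "w \<noteq> 1" "w \<noteq> -1" using w0 by auto
  have iw: "inverse w \<noteq> 0" "inverse w \<noteq> 1" "inverse w \<noteq> -1"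
    using w0 w1' by (auto simp: inverse_eq_iff_eq[of w "-1", simplified])
  obtain U V where U: "(u \<longlongrightarrow> U) (at w)" and V: "(v \<longlongrightarrow> V) (at w)"
    using reg_uv[OF w0(1)] unfolding reg_def by blast
  obtain V1 where V1: "(v \<longlongrightarrow> V1) (at (inverse w))"
    using reg_uv(2)[OF iw(1)] unfolding reg_def by blast
  have sV: "(sharp v \<longlongrightarrow> hconj V) (at (inverse w))" and sU: "(sharp u \<longlongrightarrow> hconj U) (at (inverse w))"
    using tendsto_sharp[of v V "inverse w"] tendsto_sharp[of u U "inverse w"] U V iw cw by auto
  have sV1: "(sharp v \<longlongrightarrow> hconj V1) (at w)"
    using tendsto_sharp[of v V1 w] V1 w0 cw by auto
  define t where "t = inverse w - w"
  have cinv: "((\<lambda>z. inverse (z - inverse z)) \<longlongrightarrow> inverse t) (at (inverse w))"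
    using tendsto_inverse_minus_inverse[OF iw] by (simp add: t_def)
  have t: "t \<noteq> 0" using minus_inverse_eq_0_iff[OF iw(1)] iw by (simp add: t_def)
  have ct: "cnj t = t" using cw by (simp add: t_def)
  have VP: "hconj V ** P = 0"
  proof (rule iffD1[OF reg_mult_residue_iff])
    show "rmat (\<lambda>z. hconj (v (cnj z)))" by (rule rmat_hconj_cnj[OF rmat_uv(2)])
    show "((\<lambda>z. hconj (v (cnj z))) \<longlongrightarrow> hconj V) (at w)"
      using V cw by (intro tendsto_hconj tendsto_compose_cnj) simp
    have "reg w (\<lambda>z. hconj (u (cnj z)))" using reg_uv(1)[OF w0(1)] cw by (intro reg_hconj_cnj) simp
    then show "reg w (\<lambda>z. hconj (v (cnj z)) ** R z)"
      by (rule reg_cong_cofinite) (use vR_eq in \<open>auto elim: eventually_mono\<close>)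
  qed (rule rmat_R, rule P)
  have "(jump_inv R \<longlongrightarrow> cscale (inverse t) (V1 ** hconj V)) (at (inverse w))"
    by (rule tendsto_eventually_eq'[OF _ eventually_cofinite_at[OF jump_eq]])
      (intro tendsto_cscale cinv tendsto_matrix_mult V1 sV)
  then have val1: "mero_value (jump_inv R) (inverse w) = cscale (inverse t) (V1 ** hconj V)"
    by (rule mero_value_eq)
  show "matrix_ran (matrix_residue R w) \<subseteq> matrix_ker (mero_value (jump_inv R) (inverse w))"
    unfolding val1 res matrix_ran_def matrix_ker_def
    by (auto simp: cscale_vec matrix_vector_mul_assoc VP cscale_mult_left simp flip: matrix_mul_assoc)
  have UP: "(U ** hconj V1 + mat t) ** P = 0"
  proof (rule iffD1[OF reg_mult_residue_iff])
    show "rmat (\<lambda>z. u z ** sharp v z - mat (z - inverse z))"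
      by (intro rmat_diff rmat_mult rmat_mat rmat_uv rmat_sharp ratfun_diff ratfun_id ratfun_inverse)
    have "((\<lambda>z. u z ** sharp v z - mat (z - inverse z)) \<longlongrightarrow> U ** hconj V1 - mat (w - inverse w)) (at w)"
      by (intro tendsto_diff tendsto_matrix_mult tendsto_mat tendsto_inverse tendsto_ident_at U sV1 w0)
    moreover have "mat (w - inverse w) = - (mat t :: complex^'l^'l)"
      by (simp add: t_def mat_diff)
    ultimately show "((\<lambda>z. u z ** sharp v z - mat (z - inverse z)) \<longlongrightarrow> U ** hconj V1 + mat t) (at w)"
      by simp
    have "reg w (\<lambda>z. u z ** sharp u z)" by (intro reg_mult reg_uv reg_sharp_uv w0)
    then show "reg w (\<lambda>z. (u z ** sharp v z - mat (z - inverse z)) ** R z)"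
      by (rule reg_cong_cofinite) (use uvR_eq in \<open>auto elim: eventually_mono\<close>)
  qed (rule rmat_R, rule P)
  define T where "T = cscale (inverse t) (V1 ** hconj U) + mat 1"
  have "((\<lambda>z. jump_inv R z ** R z) \<longlongrightarrow> T) (at (inverse w))"
    unfolding T_def
    by (rule tendsto_eventually_eq'[OF _ eventually_cofinite_at[OF jump_R_eq]])
      (intro tendsto_add tendsto_const tendsto_cscale cinv tendsto_matrix_mult V1 sU)
  then have val2: "mero_value (\<lambda>z. jump_inv R z ** R z) (inverse w) = T" by (rule mero_value_eq)
  have "hconj T = cscale (inverse t) (U ** hconj V1 + mat t)"
    using t ct by (simp add: T_def hconj_simps cscale_add cscale_mat)
  then have TP: "hconj T ** P = 0" using UP by (simp add: cscale_mult_left)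
  show "matrix_ran (matrix_residue R w) \<subseteq>
      cperp (matrix_ran (mero_value (\<lambda>z. jump_inv R z ** R z) (inverse w)))"
    unfolding val2 res matrix_ran_def cperp_def
  proof clarify
    fix x y
    have "cinner (T *v x) (P *v y) = cinner x (hconj T *v (P *v y))"
      unfolding cinner_adjoint[of x] by simp
    then show "cinner (T *v x) (P *v y) = 0" by (simp add: matrix_vector_mul_assoc TP)
  qed
qed

end

theorem eventually_free_imp_conditions:
  fixes m :: "complex \<Rightarrow> complex^'l^'l"
  assumes m: "discrete_m_function m" "is_representing_measure \<mu> m" and corr: "corresponds A B m"
    and free: "\<forall>\<^sub>F n in sequentially. norm (B n) + norm (mat 1 - A n ** hconj (A n)) = 0"
  shows "\<exists>R. is_rational_extension R m \<and> cond_B R \<and> cond_C R \<and> cond_D R"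
proof -
  have J: "block_jacobi A B" and res: "\<And>E. Im E \<noteq> 0 \<Longrightarrow> m E = resolvent_block A B E"
    using corr unfolding corresponds_def by blast+
  obtain N where N: "\<And>n. n \<ge> N \<Longrightarrow> norm (B n) + norm (mat 1 - A n ** hconj (A n)) = 0"
    using free unfolding eventually_sequentially by blast
  have "\<exists>u v. jost_pair A B u v"
  proof (rule jost_pair_exists[of A B N])
    show "invertible (A n)" "hermitian (B n)" for n using J unfolding block_jacobi_def by blast+
    show "B n = 0" if "n \<ge> N" for n using N[OF that] by (simp add: add_nonneg_eq_0_iff)
    show "A n ** hconj (A n) = mat 1" if "n \<ge> N" for n
      using N[OF that] by (simp add: add_nonneg_eq_0_iff)
  qed
  then obtain u v where pair: "jost_pair A B u v" by blast
  have ru: "rmat u" "rmat v" using pair unfolding jost_pair_def by blast+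
  have sol: "invertible (v z) \<and> u z ** matrix_inv (v z) = - m (joukowski z)" if z: "cmod z < 1" "Im z \<noteq> 0" for z
  proof -
    have z0: "z \<noteq> 0" using z(2) by auto
    obtain \<Psi> where \<Psi>: "\<Psi> 0 = u z" "summable (\<lambda>n. (norm (\<Psi> n))\<^sup>2)"
      "\<And>n. jacobi_mat A B \<Psi> n - cscale (joukowski z) (\<Psi> n) = (if n = 0 then - v z else 0)"
      using pair z0 z(1) unfolding jost_pair_def by blast
    have E: "Im (joukowski z) \<noteq> 0" by (rule joukowski_nonreal[OF z])
    \<comment> \<open>A kernel vector x of \<open>v z\<close> would make \<Psi> x a square summable
      solution at a nonreal energy, so u x = 0 as well, and the Wronskian then forces x = 0.\<close>
    have inv: "invertible (v z)"
    proof (rule ccontr)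
      assume "\<not> invertible (v z)"
      then obtain x where x: "x \<noteq> 0" "v z *v x = 0" using not_invertible_vec by blast
      have "\<Psi> n *v x = 0" for n
      proof (rule jacobi_no_nonreal_eigenvalue[OF J E])
        fix n
        have "jacobi_op A B (\<lambda>n. \<Psi> n *v x) n - joukowski z *s (\<Psi> n *v x) =
          (jacobi_mat A B \<Psi> n - cscale (joukowski z) (\<Psi> n)) *v x"
          unfolding jacobi_op_columns by (simp add: matrix_vector_mult_diff_rdistrib cscale_vec)
        also have "\<dots> = 0"
        proof (cases "n = 0")
          case True
          have "(- v z) *v x = - (v z *v x)"
            using matrix_vector_mult_diff_rdistrib[of 0 "v z" x] by simp
          then show ?thesis unfolding \<Psi>(3) using True x(2) by simp
        qed (simp add: \<Psi>(3))
        finally show "jacobi_op A B (\<lambda>n. \<Psi> n *v x) n = joukowski z *s (\<Psi> n *v x)" by simp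
        show "summable (\<lambda>n. (norm (\<Psi> n *v x))\<^sup>2)"
        proof (rule summable_comparison_test'[OF summable_mult2[OF \<Psi>(2), of "(norm x)\<^sup>2"]])
          show "norm ((norm (\<Psi> n *v x))\<^sup>2) \<le> (norm (\<Psi> n))\<^sup>2 * (norm x)\<^sup>2" for n
            using power_mono[OF norm_mult_vec_le[of "\<Psi> n" x], of 2] by (simp add: power_mult_distrib)
        qed
      qed
      then have "u z *v x = 0" using \<Psi>(1) by metis
      moreover have "sharp v z ** u z - sharp u z ** v z = mat (z - inverse z)"
        using pair z0 unfolding jost_pair_def by blast
      ultimately have "mat (z - inverse z) *v x = 0"
        using x(2) by (metis diff_self matrix_vector_mul_assoc matrix_vector_mult_0_right matrix_vector_mult_diff_rdistrib)
      then have "(z - inverse z) *s x = 0"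
        using cscale_vec[of "z - inverse z" "mat 1" x] by (simp add: cscale_mat)
      then have "z - inverse z = 0" using x(1) by simp
      then show False using minus_inverse_eq_0_iff[OF z0] z(2) by auto
    qed
    \<comment> \<open>Normalizes the source term \<open>- v z\<close> in row 0 to the
      identity.\<close>
    define W where "W = - matrix_inv (v z)"
    have "resolvent_block A B (joukowski z) = \<Psi> 0 ** W"
    proof (rule resolvent_block_eq[OF J E])
      fix n
      have "jacobi_mat A B (\<lambda>n. \<Psi> n ** W) n - cscale (joukowski z) (\<Psi> n ** W) =
        (jacobi_mat A B \<Psi> n - cscale (joukowski z) (\<Psi> n)) ** W"
        by (simp add: jacobi_mat_def matrix_distribs matrix_mul_assoc)
      also have "\<dots> = (if n = 0 then mat 1 else 0)"
        unfolding \<Psi>(3) W_def using inv by (simp add: matrix_neg_left matrix_neg_right matrix_inv_mult)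
      finally show "jacobi_mat A B (\<lambda>n. \<Psi> n ** W) n - cscale (joukowski z) (\<Psi> n ** W) =
        (if n = 0 then mat 1 else 0)" .
      show "summable (\<lambda>n. (norm (\<Psi> n ** W))\<^sup>2)"
      proof (rule summable_comparison_test'[OF summable_mult2[OF \<Psi>(2), of "(norm W)\<^sup>2"]])
        show "norm ((norm (\<Psi> n ** W))\<^sup>2) \<le> (norm (\<Psi> n))\<^sup>2 * (norm W)\<^sup>2" for n
          using power_mono[OF norm_matrix_mult_le[of "\<Psi> n" W], of 2] by (simp add: power_mult_distrib)
      qed
    qed
    then show ?thesis using inv res[OF E] by (simp add: \<Psi>(1) W_def matrix_neg_right)
  qed
  have inv: "\<forall>\<^sub>F z in cofinite. invertible (v z)"
    by (rule rmat_eventually_invertible[OF ru(2) frequently_elim1[OF frequently_nonreal_disk]])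
      (use sol in auto)
  obtain R where R: "rational_matrix R" "\<forall>\<^sub>F z in cofinite. u z ** matrix_inv (v z) = R z"
    "\<And>a L. ((\<lambda>z. u z ** matrix_inv (v z)) \<longlongrightarrow> L) (at a) \<Longrightarrow> R a = L"
    using rmat_representative[OF rmat_mult[OF ru(1) rmat_matrix_inv[OF ru(2) inv]]] by blast
  have ext: "is_rational_extension R m"
    unfolding is_rational_extension_def
  proof (intro conjI ballI impI R(1))
    fix z :: complex assume z: "z \<in> ball 0 1" "Im z \<noteq> 0"
    have z1: "cmod z < 1" "z \<noteq> 0" using z by auto
    have cm: "isCont m (joukowski z)" by (rule m_function_continuous[OF m(1) joukowski_nonreal[OF z1(1) z(2)]])
    have cj: "(joukowski \<longlongrightarrow> joukowski z) (at z)"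
      unfolding joukowski_def[abs_def] by (intro tendsto_add tendsto_inverse tendsto_ident_at z1)
    have lim: "((\<lambda>z. - m (joukowski z)) \<longlongrightarrow> - m (joukowski z)) (at z)"
      by (rule tendsto_minus[OF isCont_tendsto_compose[OF cm cj]])
    have "open ({z. cmod z < 1} \<inter> {z. Im z \<noteq> 0})"
      by (intro open_Int open_Collect_less open_Collect_neq continuous_intros)
    then have "\<forall>\<^sub>F y in at z. y \<in> {z. cmod z < 1} \<inter> {z. Im z \<noteq> 0}"
      using z z1 by (intro eventually_at_in_open') auto
    then have "\<forall>\<^sub>F y in at z. - m (joukowski y) = u y ** matrix_inv (v y)"
      by eventually_elim (use sol in auto)
    then have "R z = - m (joukowski z)" by (intro R(3) tendsto_eventually_eq'[OF lim])
    then show "R z = - m (z + inverse z)" by (simp add: joukowski_def)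
  qed
  interpret jost_extension A B u v R
  proof
    show "jost_pair A B u v" by fact
    show "\<forall>\<^sub>F z in cofinite. invertible (v z)" by fact
    show "\<forall>\<^sub>F z in cofinite. R z = u z ** matrix_inv (v z)" using R(2) by eventually_elim simp
  qed (use rational_extension_pole_in_disk[OF m ext] in blast)+
  show ?thesis using ext cond_B cond_C cond_D by blast
qed

section \<open>Regularity away from the origin\<close>

lemma matrix_inv_hconj:
  fixes M :: "complex^'n^'n"
  assumes "invertible M"
  shows "matrix_inv (hconj M) = hconj (matrix_inv M)"
  using matrix_inv_mult(1)[OF assms] by (intro matrix_inv_unique) (simp flip: hconj_mult)

lemma matrix_inv_minus:
  fixes M :: "complex^'n^'n"
  assumes "invertible M"
  shows "matrix_inv (- M) = - matrix_inv M"
  using matrix_inv_mult(2)[OF assms]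
  by (intro matrix_inv_unique) (simp add: matrix_neg_left matrix_neg_right)

text \<open>Under z -> 1/z the residue at 1 or -1 changes sign, because 1/z - a = -(a/z) (z - a).
  The difference thus has residue 2 L, and its regularity forces L = 0.\<close>

lemma odd_residue_reg:
  assumes X: "rmat X" and a: "a = 1 \<or> a = (-1 :: complex)"
    and simple: "reg a (\<lambda>z. cscale (z - a) (X z))"
    and diff: "reg a (\<lambda>z. X z - X (inverse z))"
  shows "reg a X"
proof -
  have a0: "a \<noteq> 0" "inverse a = a" "a * a = 1" using a by auto
  obtain L where L: "((\<lambda>z. cscale (z - a) (X z)) \<longlongrightarrow> L) (at a)"
    using simple unfolding reg_def by blast
  have "((\<lambda>z. cscale (inverse z - a) (X (inverse z))) \<longlongrightarrow> L) (at a)"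
    using tendsto_compose_inverse[of "\<lambda>z. cscale (z - a) (X z)" L a] L a0 by simp
  then have "((\<lambda>z. cscale (- (a * z)) (cscale (inverse z - a) (X (inverse z)))) \<longlongrightarrow> cscale (- (a * a)) L) (at a)"
    by (intro tendsto_cscale tendsto_minus tendsto_mult tendsto_const tendsto_ident_at)
  then have "((\<lambda>z. cscale (z - a) (X (inverse z))) \<longlongrightarrow> cscale (- (a * a)) L) (at a)"
  proof (rule tendsto_eventually_eq')
    show "\<forall>\<^sub>F z in at a. cscale (- (a * z)) (cscale (inverse z - a) (X (inverse z))) = cscale (z - a) (X (inverse z))"
      using eventually_cofinite_at[OF eventually_neq_cofinite[of 0]]
    proof eventually_elim
      case (elim z)
      have "- (a * z) * (inverse z - a) = (a * a) * z - a" using elim by (simp add: algebra_simps)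
      then show ?case by (simp add: a0)
    qed
  qed
  then have "((\<lambda>z. cscale (z - a) (X z) - cscale (z - a) (X (inverse z))) \<longlongrightarrow> L - cscale (- (a * a)) L) (at a)"
    by (intro tendsto_diff L)
  moreover have "L - cscale (- (a * a)) L = cscale 2 L"
    unfolding a0(3) by (rule matrix_eqI) simp
  moreover have "((\<lambda>z. cscale (z - a) (X z) - cscale (z - a) (X (inverse z))) \<longlongrightarrow> 0) (at a)"
    using reg_residue_zero[OF diff] by (simp add: cscale_diff)
  ultimately have "cscale 2 L = 0" using tendsto_unique[of "at a"] by fastforce
  then have "L = 0" by (simp add: cscale_eq_0_iff)
  then show ?thesis using rmat_zero_residue[OF X] L by blast
qed

locale jump_conditions =
  fixes R :: "complex \<Rightarrow> complex^'l^'l"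
  assumes rmat_R: "rmat R"
    and sym: "\<forall>\<^sub>F z in cofinite. hconj (R (cnj z)) = R z"
    and disk_real: "\<And>w. cmod w < 1 \<Longrightarrow> w \<noteq> 0 \<Longrightarrow> \<not> reg w R \<Longrightarrow> Im w = 0"
    and disk_simple: "\<And>w. cmod w < 1 \<Longrightarrow> w \<noteq> 0 \<Longrightarrow> reg w (\<lambda>z. cscale (z - w) (R z))"
    and B: "cond_B R" and C: "cond_C R" and D: "cond_D R"
begin

abbreviation sv :: "complex \<Rightarrow> complex" where "sv z \<equiv> z - inverse z"

text \<open>Agrees with \<open>sharp R\<close> up to finitely many points, by
  \<open>sharp_eq_inverse\<close>.\<close>

definition "Rs z = R (inverse z)"
definition "DD z = R z - Rs z"
text \<open>Both factors are odd under z -> 1/z, so \<open>Q\<close> is even.\<close>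

definition "Q z = cscale (sv z) (matrix_inv (DD z))"

lemma rmat_Rs: "rmat Rs"
  unfolding Rs_def[abs_def] by (rule rmat_compose_inverse[OF rmat_R])

lemma rmat_DD: "rmat DD"
  unfolding DD_def[abs_def] by (intro rmat_diff rmat_R rmat_Rs)

lemma ratfun_sv: "ratfun (\<lambda>z. sv z)"
  by (intro ratfun_diff ratfun_id ratfun_inverse)

lemma tendsto_sv: "a \<noteq> 0 \<Longrightarrow> ((\<lambda>z. sv z) \<longlongrightarrow> sv a) (at a)"
  by (intro tendsto_diff tendsto_ident_at tendsto_inverse)

lemma sharp_Rs: "\<forall>\<^sub>F z in cofinite. sharp R z = Rs z"
  unfolding Rs_def by (rule sharp_eq_inverse[OF sym])

lemma jump_invertible: "\<forall>\<^sub>F z in cofinite. invertible (R z - sharp R z)"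
proof (rule rmat_eventually_invertible)
  show "rmat (\<lambda>z. R z - sharp R z)" by (intro rmat_diff rmat_sharp rmat_R)
  have "jump_nondegenerate R" using C by (simp add: cond_C_def)
  then show "\<exists>\<^sub>F z in cofinite. invertible (R z - sharp R z)"
    unfolding jump_nondegenerate_def frequently_cofinite invertible_det_nz .
qed

lemma rmat_jump: "rmat (jump_inv R)"
  unfolding jump_inv_def[abs_def]
  by (intro rmat_matrix_inv jump_invertible rmat_diff rmat_sharp rmat_R)

lemma DD_invertible: "\<forall>\<^sub>F z in cofinite. invertible (DD z)"
  using jump_invertible sharp_Rs by eventually_elim (simp add: DD_def)

lemma rmat_Q: "rmat Q"
  unfolding Q_def[abs_def] by (intro rmat_cscale ratfun_sv rmat_matrix_inv rmat_DD DD_invertible)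

lemma Q_identities:
  "\<forall>\<^sub>F z in cofinite. Q z ** DD z = mat (sv z) \<and> DD z ** Q z = mat (sv z) \<and> Q (inverse z) = Q z \<and>
    hconj (Q (cnj z)) = Q z \<and> hconj (R (cnj z)) = R z \<and> cscale (sv z) (jump_inv R z) = Q z"
  using DD_invertible sym eventually_cofinite_inverse[OF sym] sharp_Rs
proof eventually_elim
  case (elim z)
  have "DD (inverse z) = - DD z" by (simp add: DD_def Rs_def)
  then have "Q (inverse z) = Q z"
    using matrix_inv_minus[OF elim(1)] by (simp add: Q_def cscale_minus)
  moreover have "hconj (DD z) = DD (cnj z)"
    unfolding DD_def Rs_def hconj_diff
    using elim(2,3) by (metis complex_cnj_inverse hconj_hconj)
  then have "hconj (Q (cnj z)) = Q z"
    using matrix_inv_hconj[OF elim(1)] by (simp add: Q_def hconj_cscale)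
  ultimately show ?case
    using elim by (simp add: Q_def jump_inv_def DD_def matrix_inv_mult cscale_mat cscale_mult_left
        cscale_mult_right)
qed

text \<open>Behind \<open>RQRs\<close>: \<open>Q\<close> times the jump is the same scalar on either
  side, so both products exceed \<open>Rs z ** Q z ** Rs z\<close> by the same multiple of
  \<open>Rs z\<close>.\<close>

lemma Qid:
  shows QR: "\<forall>\<^sub>F z in cofinite. Q z ** Rs z + mat (sv z) = Q z ** R z"
    and Q_inverse: "\<forall>\<^sub>F z in cofinite. Q (inverse z) = Q z"
    and Q_jump: "\<forall>\<^sub>F z in cofinite. cscale (sv z) (jump_inv R z) = Q z"
    and RQ_hconj: "\<forall>\<^sub>F z in cofinite. hconj (Q (cnj z) ** R (cnj z)) = R z ** Q z"
    and RQRs: "\<forall>\<^sub>F z in cofinite. R z ** Q z ** Rs z = Rs z ** Q z ** R z"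
proof -
  show "\<forall>\<^sub>F z in cofinite. Q z ** Rs z + mat (sv z) = Q z ** R z"
    using Q_identities by eventually_elim (auto simp: DD_def matrix_sub_ldistrib' algebra_simps)
  show "\<forall>\<^sub>F z in cofinite. Q (inverse z) = Q z"
    using Q_identities by eventually_elim simp
  show "\<forall>\<^sub>F z in cofinite. cscale (sv z) (jump_inv R z) = Q z"
    using Q_identities by eventually_elim simp
  show "\<forall>\<^sub>F z in cofinite. hconj (Q (cnj z) ** R (cnj z)) = R z ** Q z"
    using Q_identities by eventually_elim (simp add: hconj_mult)
  show "\<forall>\<^sub>F z in cofinite. R z ** Q z ** Rs z = Rs z ** Q z ** R z"
    using Q_identities
  proof eventually_elim
    case (elim z)
    have "R z ** Q z ** Rs z = Rs z ** Q z ** Rs z + (DD z ** Q z) ** Rs z"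
      by (simp add: DD_def matrix_sub_rdistrib')
    also have "(DD z ** Q z) ** Rs z = Rs z ** (Q z ** DD z)"
      using elim cscale_mult_left[of "sv z" "mat 1" "Rs z"] mult_mat_right[of "Rs z" "sv z"]
      by (simp add: cscale_mat)
    also have "Rs z ** Q z ** Rs z + Rs z ** (Q z ** DD z) = Rs z ** Q z ** R z"
      by (simp add: DD_def matrix_sub_ldistrib' matrix_mul_assoc)
    finally show ?case .
  qed
qed

lemma reg_jump: "a \<noteq> 0 \<Longrightarrow> a \<noteq> 1 \<Longrightarrow> a \<noteq> -1 \<Longrightarrow> reg a (jump_inv R)"
  using C rmat_pole_iff[OF rmat_jump] unfolding cond_C_def by auto

lemma reg_Q:
  assumes "a \<noteq> 0" shows "reg a Q"
proof (cases "a = 1 \<or> a = -1")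
  case False
  then have "reg a (\<lambda>z. cscale (sv z) (jump_inv R z))"
    using assms by (intro reg_cscale[OF tendsto_sv] reg_jump) auto
  then show ?thesis by (rule reg_cong_cofinite[OF _ Q_jump])
next
  case True
  have "at_most_simple_pole (jump_inv R) a" using C True unfolding cond_C_def by auto
  then have "reg a (\<lambda>z. cscale (z - a) (jump_inv R z))" using at_most_simple_pole_iff[OF rmat_jump] by blast
  moreover have "((\<lambda>z. (z + a) / z) \<longlongrightarrow> (a + a) / a) (at a)"
    by (intro tendsto_divide tendsto_add tendsto_const tendsto_ident_at assms)
  ultimately have "reg a (\<lambda>z. cscale ((z + a) / z) (cscale (z - a) (jump_inv R z)))"
    by (rule_tac reg_cscale)
  then show ?thesis
  proof (rule reg_cong_cofinite)
    show "\<forall>\<^sub>F z in cofinite. cscale ((z + a) / z) (cscale (z - a) (jump_inv R z)) = Q z"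
      using Q_jump eventually_neq_cofinite[of 0]
    proof eventually_elim
      case (elim z)
      have "(z + a) / z * (z - a) = sv z" using True elim(2) by (auto simp: field_simps)
      then show ?case using elim(1) by simp
    qed
  qed
qed

lemma reg_circle: "cmod a = 1 \<Longrightarrow> a \<noteq> 1 \<Longrightarrow> a \<noteq> -1 \<Longrightarrow> reg a R"
  using B rmat_pole_iff[OF rmat_R] unfolding cond_B_def by auto

lemma simple_edge: "a = 1 \<or> a = -1 \<Longrightarrow> reg a (\<lambda>z. cscale (z - a) (R z))"
  using B at_most_simple_pole_iff[OF rmat_R] unfolding cond_B_def by auto

lemma reg_Rs: "reg (inverse a) R \<Longrightarrow> a \<noteq> 0 \<Longrightarrow> reg a Rs"
  unfolding Rs_def[abs_def] by (rule reg_compose_inverse)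

text \<open>Both inclusions of (D), as equations between limits at a common pole \<open>w\<close> and \<open>1/w\<close>.\<close>

lemma double_pole:
  assumes w: "cmod w < 1" "w \<noteq> 0" and poles: "\<not> reg w R" "\<not> reg (inverse w) R"
  shows "\<exists>P J. ((\<lambda>z. cscale (z - w) (R z)) \<longlongrightarrow> P) (at w) \<and> Im w = 0 \<and>
    (Q \<longlongrightarrow> J) (at w) \<and> J ** P = 0 \<and>
    (\<forall>V. ((\<lambda>z. Q z ** R z) \<longlongrightarrow> V) (at (inverse w)) \<longrightarrow> hconj V ** P = 0)"
proof -
  obtain P where P: "((\<lambda>z. cscale (z - w) (R z)) \<longlongrightarrow> P) (at w)"
    using disk_simple[OF w] unfolding reg_def by blast
  have res: "matrix_residue R w = P" by (rule rmat_residue[OF rmat_R P])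
  have im: "Im w = 0" using disk_real w poles by blast
  define y where "y = inverse w"
  have w1: "w \<noteq> 1" "w \<noteq> -1" using w by auto
  have y: "y \<noteq> 0" "y \<noteq> 1" "y \<noteq> -1"
    using w w1 by (auto simp: y_def inverse_eq_iff_eq[of w "-1", simplified])
  have sy: "sv y \<noteq> 0" using minus_inverse_eq_0_iff[OF y(1)] y by blast
  have "w \<in> ball 0 1 - {0}" "is_pole R w" "is_pole R (inverse w)"
    using w poles rmat_pole_iff[OF rmat_R] by auto
  then have D1: "matrix_ran P \<subseteq> matrix_ker (mero_value (jump_inv R) y)"
    and D2: "matrix_ran P \<subseteq> cperp (matrix_ran (mero_value (\<lambda>z. jump_inv R z ** R z) y))"
    using D unfolding cond_D_def res[symmetric] y_def by blast+
  obtain K where K: "(jump_inv R \<longlongrightarrow> K) (at y)" using reg_jump[OF y] unfolding reg_def by blast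
  have KP: "K ** P = 0"
  proof (rule mat_eq_of_vec)
    fix x
    have "P *v x \<in> matrix_ker K" using D1 unfolding mero_value_eq[OF K] matrix_ran_def by blast
    then show "(K ** P) *v x = 0 *v x" by (simp add: matrix_ker_def matrix_vector_mul_assoc)
  qed
  have "((\<lambda>z. cscale (sv z) (jump_inv R z)) \<longlongrightarrow> cscale (sv y) K) (at y)"
    by (intro tendsto_cscale tendsto_sv y K)
  then have "(Q \<longlongrightarrow> cscale (sv y) K) (at y)"
    by (rule tendsto_eventually_eq'[OF _ eventually_cofinite_at[OF Q_jump]])
  then have "((\<lambda>z. Q (inverse z)) \<longlongrightarrow> cscale (sv y) K) (at w)"
    using tendsto_compose_inverse[of Q "cscale (sv y) K" w] w unfolding y_def by blast
  then have Qw: "(Q \<longlongrightarrow> cscale (sv y) K) (at w)"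
    by (rule tendsto_eventually_eq'[OF _ eventually_cofinite_at[OF Q_inverse]])
  have "hconj V ** P = 0" if V: "((\<lambda>z. Q z ** R z) \<longlongrightarrow> V) (at y)" for V
  proof -
    have "((\<lambda>z. cscale (inverse (sv z)) (Q z ** R z)) \<longlongrightarrow> cscale (inverse (sv y)) V) (at y)"
      by (intro tendsto_cscale tendsto_inverse tendsto_sv y sy V)
    moreover have "\<forall>\<^sub>F z in at y. cscale (inverse (sv z)) (Q z ** R z) = jump_inv R z ** R z"
      using eventually_cofinite_at[OF Q_jump] eventually_cofinite_at[OF eventually_nondegenerate_point]
    proof eventually_elim
      case (elim z)
      then show ?case unfolding elim(1)[symmetric] by (simp add: cscale_mult_left)
    qed
    ultimately have "((\<lambda>z. jump_inv R z ** R z) \<longlongrightarrow> cscale (inverse (sv y)) V) (at y)"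
      by (rule tendsto_eventually_eq')
    note mv = mero_value_eq[OF this]
    define V' where "V' = cscale (inverse (sv y)) V"
    have orth: "cinner (V' *v x) (P *v x') = 0" for x x'
      using D2 unfolding mv V'_def[symmetric] matrix_ran_def cperp_def by blast
    have "hconj V' ** P = 0"
    proof (rule matrix_eqI)
      fix i j
      have "(hconj V' ** P) $ i $ j = cinner (axis i 1) (hconj V' *v (P *v axis j 1))"
        by (simp add: matrix_vector_mul_assoc flip: cinner_axis_matrix)
      also have "\<dots> = 0" unfolding cinner_adjoint[of "axis i 1"] using orth by simp
      finally show "(hconj V' ** P) $ i $ j = 0 $ i $ j" by simp
    qed
    then have "cscale (cnj (inverse (sv y))) (hconj V ** P) = 0"
      by (simp add: V'_def hconj_cscale cscale_mult_left)
    moreover have "cnj (inverse (sv y)) \<noteq> 0"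
      using nonzero_imp_inverse_nonzero[OF sy] by (simp only: complex_cnj_zero_iff not_False_eq_True)
    ultimately show ?thesis unfolding cscale_eq_0_iff by blast
  qed
  moreover have "cscale (sv y) K ** P = 0" by (simp add: cscale_mult_left KP)
  ultimately show ?thesis
    by (intro exI[of _ P] exI[of _ "cscale (sv y) K"]) (simp add: P im Qw flip: y_def)
qed

text \<open>If w is a pole and 1/w is not, Q R = Q R(1/z) + z - 1/z moves the question to 1/w. If
  both are poles, the first inclusion of (D) annihilates the residue.\<close>

lemma reg_QR_disk:
  assumes w: "cmod w < 1" "w \<noteq> 0"
  shows "reg w (\<lambda>z. Q z ** R z)"
proof (cases "reg w R")
  case True
  then show ?thesis by (intro reg_mult reg_Q w)
next
  case pole: False
  show ?thesis
  proof (cases "reg (inverse w) R")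
    case True
    have "reg w (\<lambda>z. Q z ** Rs z + mat (sv z))"
      by (rule reg_add[OF reg_mult[OF reg_Q[OF w(2)] reg_Rs[OF True w(2)]] reg_mat[OF tendsto_sv[OF w(2)]]])
    then show ?thesis by (rule reg_cong_cofinite[OF _ QR])
  next
    case False
    from double_pole[OF w pole False]
    obtain P J where P: "((\<lambda>z. cscale (z - w) (R z)) \<longlongrightarrow> P) (at w)"
      and J: "(Q \<longlongrightarrow> J) (at w)" "J ** P = 0" by (elim exE conjE)
    show ?thesis by (rule iffD2[OF reg_mult_residue_iff[OF rmat_Q rmat_R J(1) P] J(2)])
  qed
qed

lemma QRs_eq: "\<forall>\<^sub>F z in cofinite. Q (inverse z) ** R (inverse z) = Q z ** Rs z"
  using Q_inverse by eventually_elim (simp add: Rs_def)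

text \<open>Evenness of \<open>Q\<close> exchanges R and R(1/z), and their products with
  \<open>Q\<close> differ by z - 1/z. This transports regularity to the outside of the disk, and at
  1 and -1 it makes the odd part regular.\<close>

lemma reg_QR:
  assumes a: "a \<noteq> 0" shows "reg a (\<lambda>z. Q z ** R z)"
proof -
  consider "cmod a < 1" | "cmod a > 1" | "a = 1 \<or> a = -1" | "cmod a = 1" "a \<noteq> 1" "a \<noteq> -1" by linarith
  then show ?thesis
  proof cases
    case 1
    then show ?thesis by (rule reg_QR_disk[OF _ a])
  next
    case 2
    then have "cmod (inverse a) < 1" "inverse a \<noteq> 0" using a by (simp_all add: norm_inverse inverse_less_1_iff)
    then have "reg a (\<lambda>z. Q (inverse z) ** R (inverse z))"
      using reg_compose_inverse[OF reg_QR_disk a] by blast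
    then have "reg a (\<lambda>z. Q z ** Rs z)" by (rule reg_cong_cofinite[OF _ QRs_eq])
    then have "reg a (\<lambda>z. Q z ** Rs z + mat (sv z))" by (intro reg_add reg_mat[OF tendsto_sv] a)
    then show ?thesis by (rule reg_cong_cofinite[OF _ QR])
  next
    case 3
    show ?thesis
    proof (rule odd_residue_reg[OF rmat_mult[OF rmat_Q rmat_R] 3])
      have "reg a (\<lambda>z. Q z ** cscale (z - a) (R z))" by (intro reg_mult reg_Q a simple_edge 3)
      then show "reg a (\<lambda>z. cscale (z - a) (Q z ** R z))" by (simp add: cscale_mult_right)
      have "reg a (\<lambda>z. mat (sv z))" by (rule reg_mat[OF tendsto_sv[OF a]])
      then show "reg a (\<lambda>z. Q z ** R z - Q (inverse z) ** R (inverse z))"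
      proof (rule reg_cong_cofinite)
        show "\<forall>\<^sub>F z in cofinite. mat (sv z) = Q z ** R z - Q (inverse z) ** R (inverse z)"
          using QRs_eq QR by eventually_elim (metis add_diff_cancel_left')
      qed
    qed
  next
    case 4
    then show ?thesis by (intro reg_mult reg_Q a reg_circle)
  qed
qed

lemma reg_QRs:
  assumes a: "a \<noteq> 0" shows "reg a (\<lambda>z. Q z ** Rs z)"
  by (rule reg_cong_cofinite[OF _ QRs_eq]) (use a in \<open>intro reg_compose_inverse reg_QR, auto\<close>)

lemma reg_RQ:
  assumes a: "a \<noteq> 0" shows "reg a (\<lambda>z. R z ** Q z)"
proof (rule reg_cong_cofinite[OF _ RQ_hconj])
  show "reg a (\<lambda>z. hconj (Q (cnj z) ** R (cnj z)))"
    by (rule reg_hconj_cnj[where F = "\<lambda>z. Q z ** R z"], rule reg_QR) (use a in simp)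
qed

definition "T z = R z ** Q z ** Rs z"

lemma rmat_T: "rmat T"
  unfolding T_def[abs_def] by (intro rmat_mult rmat_R rmat_Q rmat_Rs)

lemma T_inverse: "\<forall>\<^sub>F z in cofinite. T (inverse z) = T z"
  using RQRs Q_inverse by eventually_elim (simp add: T_def Rs_def)

text \<open>If w and 1/w are both poles, the second inclusion of (D) enters: by taking adjoints and
  z -> 1/z, the limit of Q R at 1/w becomes the limit of R(1/z) Q at w, and it annihilates the
  residue of R.\<close>

lemma reg_T_disk:
  assumes w: "cmod w < 1" "w \<noteq> 0"
  shows "reg w T"
proof (cases "reg w R")
  case True
  then have "reg w (\<lambda>z. R z ** (Q z ** Rs z))" by (intro reg_mult reg_QRs w)
  then show ?thesis by (simp add: T_def[abs_def] matrix_mul_assoc)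
next
  case pole: False
  show ?thesis
  proof (cases "reg (inverse w) R")
    case True
    then show ?thesis unfolding T_def[abs_def] by (intro reg_mult[OF reg_RQ] reg_Rs w)
  next
    case False
    from double_pole[OF w pole False]
    obtain P where P: "((\<lambda>z. cscale (z - w) (R z)) \<longlongrightarrow> P) (at w)" and im: "Im w = 0"
      and "\<forall>V. ((\<lambda>z. Q z ** R z) \<longlongrightarrow> V) (at (inverse w)) \<longrightarrow> hconj V ** P = 0"
      by (elim exE conjE)
    then have V: "hconj V ** P = 0" if "((\<lambda>z. Q z ** R z) \<longlongrightarrow> V) (at (inverse w))" for V
      using that by blast
    have cw: "cnj (inverse w) = inverse w" using im by (simp add: complex_eq_iff)
    obtain V where V': "((\<lambda>z. Q z ** R z) \<longlongrightarrow> V) (at (inverse w))"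
      using reg_QR[of "inverse w"] w unfolding reg_def by auto
    have "((\<lambda>z. hconj (Q (cnj z) ** R (cnj z))) \<longlongrightarrow> hconj V) (at (inverse w))"
      by (intro tendsto_hconj tendsto_compose_cnj[where F = "\<lambda>z. Q z ** R z"]) (simp only: cw V')
    then have "((\<lambda>z. R z ** Q z) \<longlongrightarrow> hconj V) (at (inverse w))"
      by (rule tendsto_eventually_eq'[OF _ eventually_cofinite_at[OF RQ_hconj]])
    then have "((\<lambda>z. R (inverse z) ** Q (inverse z)) \<longlongrightarrow> hconj V) (at w)"
      by (rule tendsto_compose_inverse[OF _ w(2)])
    moreover have "\<forall>\<^sub>F z in cofinite. R (inverse z) ** Q (inverse z) = Rs z ** Q z"
      using Q_inverse by eventually_elim (simp add: Rs_def)
    then have "\<forall>\<^sub>F z in at w. R (inverse z) ** Q (inverse z) = Rs z ** Q z"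
      by (rule eventually_cofinite_at)
    ultimately have lim: "((\<lambda>z. Rs z ** Q z) \<longlongrightarrow> hconj V) (at w)"
      by (rule tendsto_eventually_eq')
    have "reg w (\<lambda>z. (Rs z ** Q z) ** R z)"
      by (rule iffD2[OF reg_mult_residue_iff[OF rmat_mult[OF rmat_Rs rmat_Q] rmat_R lim P] V[OF V']])
    then show ?thesis
    proof (rule reg_cong_cofinite)
      show "\<forall>\<^sub>F z in cofinite. Rs z ** Q z ** R z = T z"
        using RQRs by eventually_elim (simp add: T_def)
    qed
  qed
qed

lemma reg_T:
  assumes a: "a \<noteq> 0" shows "reg a T"
proof -
  consider "cmod a < 1" | "cmod a > 1" | "a = 1 \<or> a = -1" | "cmod a = 1" "a \<noteq> 1" "a \<noteq> -1" by linarith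
  then show ?thesis
  proof cases
    case 1
    then show ?thesis by (rule reg_T_disk[OF _ a])
  next
    case 2
    then have "cmod (inverse a) < 1" "inverse a \<noteq> 0" using a by (simp_all add: norm_inverse inverse_less_1_iff)
    then have "reg a (\<lambda>z. T (inverse z))"
      using reg_compose_inverse[OF reg_T_disk a] by blast
    then show ?thesis by (rule reg_cong_cofinite[OF _ T_inverse])
  next
    case 3
    show ?thesis
    proof (rule odd_residue_reg[OF rmat_T 3])
      have "reg a (\<lambda>z. cscale (z - a) (R z) ** (Q z ** Rs z))"
        by (intro reg_mult reg_QRs a simple_edge 3)
      then show "reg a (\<lambda>z. cscale (z - a) (T z))"
        by (simp add: T_def cscale_mult_left matrix_mul_assoc)
      show "reg a (\<lambda>z. T z - T (inverse z))"
        by (rule reg_cong_cofinite[OF reg_const[of a 0]])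
          (use T_inverse in \<open>auto elim: eventually_mono\<close>)
    qed
  next
    case 4
    have "cmod (inverse a) = 1" using 4(1) by (simp add: norm_inverse)
    moreover have "inverse a \<noteq> 1" "inverse a \<noteq> -1"
      using 4 by (auto simp: inverse_eq_iff_eq[of a "-1", simplified])
    ultimately show ?thesis unfolding T_def[abs_def]
      by (intro reg_mult reg_Q a reg_Rs reg_circle 4)
  qed
qed

end

section \<open>Weyl solutions\<close>

text \<open>\<open>P\<close> stands for \<open>A\<^sub>-\<^sub>1\<^sup>*\<close> times the entry of index \<open>-1\<close>.\<close>

fun wsol :: "(nat \<Rightarrow> complex^'l^'l) \<Rightarrow> (nat \<Rightarrow> complex^'l^'l) \<Rightarrow> complex \<Rightarrow> complex^'l^'l
    \<Rightarrow> complex^'l^'l \<Rightarrow> nat \<Rightarrow> complex^'l^'l" where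
  "wsol A B e P X 0 = X"
| "wsol A B e P X (Suc 0) = matrix_inv (A 0) ** (cscale e X - B 0 ** X - P)"
| "wsol A B e P X (Suc (Suc n)) = matrix_inv (A (Suc n)) ** (cscale e (wsol A B e P X (Suc n))
    - B (Suc n) ** wsol A B e P X (Suc n) - hconj (A n) ** wsol A B e P X n)"

text \<open>Superposition separates the initial data, which may have poles, from coefficients that
  are polynomials in \<open>e\<close>.\<close>

lemma wsol_linear:
  "wsol A B e P X n = wsol A B e 0 (mat 1) n ** X + wsol A B e (mat 1) 0 n ** P"
proof (induction n rule: induct_nat_012)
  case (ge2 n)
  show ?case unfolding wsol.simps(3) ge2.IH
    by (simp add: matrix_distribs cscale_add flip: matrix_mul_assoc)
qed (simp_all add: matrix_distribs matrix_mul_assoc)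

lemma wsol_unique:
  fixes A B \<Psi> :: "nat \<Rightarrow> complex^'l^'l"
  assumes inv: "\<And>n. invertible (A n)"
    and eq: "\<And>n. jacobi_mat A B \<Psi> n - cscale e (\<Psi> n) = (if n = 0 then - P else 0)"
  shows "\<Psi> n = wsol A B e P (\<Psi> 0) n"
proof (induction n rule: induct_nat_012)
  have solve: "X = matrix_inv (A k) ** Y" if "A k ** X = Y" for k X Y
    using matrix_inv_mult(2)[OF inv[of k]] by (simp add: matrix_mul_assoc flip: that)
  {
    case 1
    have "A 0 ** \<Psi> 1 = cscale e (\<Psi> 0) - B 0 ** \<Psi> 0 - P"
      using eq[of 0] by (simp add: jacobi_mat_def algebra_simps)
    then show ?case using solve[of 0 "\<Psi> 1"] by simp
  next
    case (ge2 n)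
    have "A (Suc n) ** \<Psi> (Suc (Suc n)) = cscale e (\<Psi> (Suc n)) - B (Suc n) ** \<Psi> (Suc n) - hconj (A n) ** \<Psi> n"
      using eq[of "Suc n"] by (simp add: jacobi_mat_def algebra_simps)
    then show ?case using solve[of "Suc n" "\<Psi> (Suc (Suc n))"] ge2.IH by simp
  }
qed simp

locale jacobi_matrices =
  fixes A B :: "nat \<Rightarrow> complex^'l^'l"
  assumes A_inv: "\<And>n. invertible (A n)" and B_herm: "\<And>n. hermitian (B n)"
begin

lemma A_inv_mult: "A n ** (matrix_inv (A n) ** X) = X"
  using matrix_inv_mult(1)[OF A_inv[of n]] by (simp add: matrix_mul_assoc)

lemma wsol_step_0: "A 0 ** wsol A B e P X (Suc 0) = cscale e X - B 0 ** X - P"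
  by (simp add: A_inv_mult)

lemma wsol_step: "A (Suc n) ** wsol A B e P X (Suc (Suc n)) =
    cscale e (wsol A B e P X (Suc n)) - B (Suc n) ** wsol A B e P X (Suc n) - hconj (A n) ** wsol A B e P X n"
  by (simp add: A_inv_mult)

abbreviation "AL e n \<equiv> wsol A B e 0 (mat 1) n"
abbreviation "BE e n \<equiv> wsol A B e (mat 1) 0 n"

text \<open>Wronskian of the two basic solutions at two indices. The energy in the second factor is
  conjugated, so that its adjoint is again polynomial in \<open>e\<close>. It measures the change of
  \<open>X\<close> under z -> 1/z.\<close>

definition "wr e k j = BE e k ** hconj (AL (cnj e) j) - AL e k ** hconj (BE (cnj e) j)"

lemma wr_left: "A (Suc k) ** wr e (Suc (Suc k)) j =
    cscale e (wr e (Suc k) j) - B (Suc k) ** wr e (Suc k) j - hconj (A k) ** wr e k j"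
proof -
  have "A (Suc k) ** wr e (Suc (Suc k)) j = (A (Suc k) ** BE e (Suc (Suc k))) ** hconj (AL (cnj e) j)
    - (A (Suc k) ** AL e (Suc (Suc k))) ** hconj (BE (cnj e) j)"
    unfolding wr_def by (simp only: matrix_sub_ldistrib' matrix_mul_assoc)
  also have "\<dots> = cscale e (wr e (Suc k) j) - B (Suc k) ** wr e (Suc k) j - hconj (A k) ** wr e k j"
    unfolding wsol_step wr_def
    by (simp only: matrix_sub_ldistrib' matrix_sub_rdistrib' matrix_mul_assoc cscale_mult_left cscale_diff)
      (simp add: algebra_simps)
  finally show ?thesis .
qed

lemma hconj_step: "hconj (wsol A B (cnj e) P X (Suc (Suc n))) ** hconj (A (Suc n)) =
    cscale e (hconj (wsol A B (cnj e) P X (Suc n))) - hconj (wsol A B (cnj e) P X (Suc n)) ** B (Suc n)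
    - hconj (wsol A B (cnj e) P X n) ** A n"
  unfolding hconj_mult[symmetric] wsol_step
  using B_herm[of "Suc n"] by (simp add: hconj_simps hermitian_def)

lemma wr_right: "wr e k (Suc (Suc j)) ** hconj (A (Suc j)) =
    cscale e (wr e k (Suc j)) - wr e k (Suc j) ** B (Suc j) - wr e k j ** A j"
proof -
  have "wr e k (Suc (Suc j)) ** hconj (A (Suc j)) =
    BE e k ** (hconj (AL (cnj e) (Suc (Suc j))) ** hconj (A (Suc j)))
    - AL e k ** (hconj (BE (cnj e) (Suc (Suc j))) ** hconj (A (Suc j)))"
    unfolding wr_def by (simp only: matrix_sub_rdistrib' matrix_mul_assoc)
  also have "\<dots> = cscale e (wr e k (Suc j)) - wr e k (Suc j) ** B (Suc j) - wr e k j ** A j"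
    unfolding hconj_step wr_def
    by (simp only: matrix_sub_ldistrib' matrix_sub_rdistrib' matrix_mul_assoc cscale_mult_right cscale_diff)
      (simp add: algebra_simps)
  finally show ?thesis .
qed

lemma congruence_zero: "A n ** X ** hconj (A n) = 0 \<Longrightarrow> X = 0"
proof -
  assume "A n ** X ** hconj (A n) = 0"
  then have "matrix_inv (A n) ** (A n ** X ** hconj (A n)) ** matrix_inv (hconj (A n)) = 0" by simp
  moreover have "matrix_inv (A n) ** (A n ** X ** hconj (A n)) ** matrix_inv (hconj (A n)) =
    (matrix_inv (A n) ** A n) ** X ** (hconj (A n) ** matrix_inv (hconj (A n)))"
    by (simp only: matrix_mul_assoc)
  ultimately show "X = 0"
    using matrix_inv_mult(2)[OF A_inv[of n]] matrix_inv_mult(1)[OF invertible_hconj[OF A_inv[of n]]] by simp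
qed

text \<open>Liouville-Ostrogradsky formulas. Two consecutive diagonal values and the off-diagonal
  values between them support each other through the recurrences in the left and in the right
  index.\<close>

lemma wr_identities: "wr e k k = 0 \<and> wr e (Suc k) (Suc k) = 0 \<and>
  A k ** wr e (Suc k) k = - mat 1 \<and> wr e k (Suc k) ** hconj (A k) = mat 1"
proof (induction k)
  case 0
  have BE1: "A 0 ** BE e (Suc 0) = - mat 1" for e
    unfolding wsol_step_0 by simp
  have AL1: "A 0 ** AL e (Suc 0) = cscale e (mat 1) - B 0" for e
    unfolding wsol_step_0 by simp
  have hBE: "hconj (BE (cnj e) (Suc 0)) ** hconj (A 0) = - mat 1"
    unfolding hconj_mult[symmetric] BE1 by (simp add: hconj_minus)
  have hAL: "hconj (AL (cnj e) (Suc 0)) ** hconj (A 0) = cscale e (mat 1) - B 0"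
    unfolding hconj_mult[symmetric] AL1 using B_herm[of 0] by (simp add: hconj_simps hermitian_def)
  have "A 0 ** wr e (Suc 0) (Suc 0) ** hconj (A 0) =
    (A 0 ** BE e (Suc 0)) ** (hconj (AL (cnj e) (Suc 0)) ** hconj (A 0))
    - (A 0 ** AL e (Suc 0)) ** (hconj (BE (cnj e) (Suc 0)) ** hconj (A 0))"
    unfolding wr_def by (simp only: matrix_sub_ldistrib' matrix_sub_rdistrib' matrix_mul_assoc)
  also have "\<dots> = 0" unfolding BE1 AL1 hBE hAL by (simp add: matrix_neg_left matrix_neg_right)
  finally have "wr e (Suc 0) (Suc 0) = 0" by (rule congruence_zero)
  moreover have "wr e 0 0 = 0" "A 0 ** wr e (Suc 0) 0 = - mat 1"
    using BE1 by (simp_all add: wr_def del: wsol.simps(2))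
  moreover have "wr e 0 (Suc 0) ** hconj (A 0) = mat 1"
    using hBE by (simp add: wr_def matrix_neg_left del: wsol.simps(2))
  ultimately show ?case by blast
next
  case (Suc k)
  then have IH: "wr e k k = 0" "wr e (Suc k) (Suc k) = 0" "A k ** wr e (Suc k) k = - mat 1"
    "wr e k (Suc k) ** hconj (A k) = mat 1" by blast+
  have "hconj (A k) ** wr e k (Suc k) = mat 1" using IH(4) by (rule matrix_mult_1_commute)
  then have 1: "A (Suc k) ** wr e (Suc (Suc k)) (Suc k) = - mat 1"
    unfolding wr_left IH(2) by simp
  have "(- wr e (Suc k) k) ** A k = mat 1"
    by (rule matrix_mult_1_commute) (simp add: matrix_neg_right IH(3))
  then have wA: "wr e (Suc k) k ** A k = - mat 1" by (simp add: matrix_neg_left minus_equation_iff eq_commute)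
  have 2: "wr e (Suc k) (Suc (Suc k)) ** hconj (A (Suc k)) = mat 1"
    unfolding wr_right IH(2) wA by simp
  have 3: "A (Suc k) ** wr e (Suc (Suc k)) k = cscale e (wr e (Suc k) k) - B (Suc k) ** wr e (Suc k) k"
    unfolding wr_left IH(1) by simp
  have "A (Suc k) ** wr e (Suc (Suc k)) (Suc (Suc k)) ** hconj (A (Suc k)) =
    A (Suc k) ** (wr e (Suc (Suc k)) (Suc (Suc k)) ** hconj (A (Suc k)))" by (simp only: matrix_mul_assoc)
  also have "\<dots> = cscale e (A (Suc k) ** wr e (Suc (Suc k)) (Suc k))
      - (A (Suc k) ** wr e (Suc (Suc k)) (Suc k)) ** B (Suc k)
      - (A (Suc k) ** wr e (Suc (Suc k)) k) ** A k"
    unfolding wr_right by (simp only: matrix_sub_ldistrib' cscale_mult_right matrix_mul_assoc)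
  also have "\<dots> = - cscale e (mat 1) + B (Suc k) - (cscale e (wr e (Suc k) k ** A k) - B (Suc k) ** (wr e (Suc k) k ** A k))"
    unfolding 1 3 by (simp add: matrix_sub_rdistrib' cscale_mult_left matrix_neg_left matrix_mul_assoc
        cscale_minus cscale_minus_left)
  also have "\<dots> = 0" unfolding wA by (simp add: matrix_neg_right cscale_minus cscale_minus_left)
  finally have "wr e (Suc (Suc k)) (Suc (Suc k)) = 0" by (rule congruence_zero)
  then show ?case using IH(2) 1 2 by blast
qed

section \<open>The basic solutions as functions of z and their behaviour at the origin\<close>

lemma ratfun_joukowski: "ratfun joukowski"
  unfolding joukowski_def[abs_def] by (intro ratfun_add ratfun_id ratfun_inverse)

lemma tendsto_joukowski: "a \<noteq> 0 \<Longrightarrow> (joukowski \<longlongrightarrow> joukowski a) (at a)"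
  unfolding joukowski_def[abs_def] by (intro tendsto_add tendsto_inverse tendsto_ident_at)

lemma rmat_reg_wsol: "rmat (\<lambda>z. wsol A B (joukowski z) P X n) \<and>
  (\<forall>a. a \<noteq> 0 \<longrightarrow> reg a (\<lambda>z. wsol A B (joukowski z) P X n))"
proof (induction n rule: induct_nat_012)
  case 1
  show ?case
    by (auto intro!: rmat_mult rmat_diff rmat_cscale rmat_const ratfun_joukowski reg_mult reg_diff
        reg_cscale[OF tendsto_joukowski] reg_const)
next
  case (ge2 n)
  then show ?case
    by (auto intro!: rmat_mult rmat_diff rmat_cscale rmat_const ratfun_joukowski reg_mult reg_diff
        reg_cscale[OF tendsto_joukowski] reg_const)
qed auto

text \<open>Leading coefficient of \<open>AL e n\<close> in \<open>e\<close>, that is, the limit of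
  z^n AL at z = 0.\<close>

primrec aL :: "nat \<Rightarrow> complex^'l^'l" where
  "aL 0 = mat 1" | "aL (Suc n) = matrix_inv (A n) ** aL n"

text \<open>Will be the limit of psi_n / z^(n+1) at z = 0.\<close>

primrec LL :: "nat \<Rightarrow> complex^'l^'l" where
  "LL 0 = mat 1" | "LL (Suc n) = hconj (A n) ** LL n"

lemma LL_aL: "LL n ** hconj (aL n) = mat 1" "LL (Suc n) ** hconj (aL n) = hconj (A n)"
proof -
  show 1: "LL n ** hconj (aL n) = mat 1" for n
  proof (induction n)
    case (Suc n)
    have "LL (Suc n) ** hconj (aL (Suc n)) = hconj (A n) ** (LL n ** hconj (aL n)) ** hconj (matrix_inv (A n))"
      by (simp add: hconj_mult matrix_mul_assoc)
    also have "\<dots> = hconj (matrix_inv (A n) ** A n)" unfolding Suc by (simp add: hconj_mult)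
    finally show ?case using matrix_inv_mult(2)[OF A_inv[of n]] by simp
  qed simp
  show "LL (Suc n) ** hconj (aL n) = hconj (A n)"
    using 1[of n] by (simp flip: matrix_mul_assoc)
qed

lemma tendsto_times_joukowski: "((\<lambda>z. z * joukowski z) \<longlongrightarrow> 1) (at 0)"
proof (rule tendsto_eventually_eq')
  have "((\<lambda>z::complex. z * z + 1) \<longlongrightarrow> 0 * 0 + 1) (at 0)"
    by (intro tendsto_add tendsto_mult tendsto_ident_at tendsto_const)
  then show "((\<lambda>z::complex. z * z + 1) \<longlongrightarrow> 1) (at 0)" by simp
  show "\<forall>\<^sub>F z in at 0. z * z + 1 = z * joukowski z"
    using eventually_cofinite_at[OF eventually_neq_cofinite[of 0]]
    by eventually_elim (simp add: joukowski_def field_simps)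
qed

lemma AL_tendsto: "((\<lambda>z. cscale (z ^ n) (AL (joukowski z) n)) \<longlongrightarrow> aL n) (at 0)"
proof (induction n rule: induct_nat_012)
  case 0
  show ?case by simp
next
  case 1
  have "((\<lambda>z. matrix_inv (A 0) ** (cscale (z * joukowski z) (mat 1) - cscale z (B 0))) \<longlongrightarrow>
    matrix_inv (A 0) ** (cscale 1 (mat 1) - cscale 0 (B 0))) (at 0)"
    by (intro tendsto_matrix_mult tendsto_diff tendsto_cscale tendsto_const tendsto_ident_at tendsto_times_joukowski)
  then show ?case by (simp add: cscale_mult_right[symmetric] cscale_diff)
next
  case (ge2 n)
  let ?y = "\<lambda>k z. cscale (z ^ k) (AL (joukowski z) k)"
  have "((\<lambda>z. matrix_inv (A (Suc n)) ** (cscale (z * joukowski z) (?y (Suc n) z) -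
      cscale z (B (Suc n) ** ?y (Suc n) z) - cscale (z * z) (hconj (A n) ** ?y n z))) \<longlongrightarrow>
    matrix_inv (A (Suc n)) ** (cscale 1 (aL (Suc n)) - cscale 0 (B (Suc n) ** aL (Suc n))
      - cscale (0 * 0) (hconj (A n) ** aL n))) (at 0)"
    by (intro tendsto_matrix_mult tendsto_diff tendsto_cscale tendsto_const tendsto_ident_at
        tendsto_times_joukowski tendsto_mult ge2.IH)
  moreover have "matrix_inv (A (Suc n)) ** (cscale (z * joukowski z) (?y (Suc n) z) -
      cscale z (B (Suc n) ** ?y (Suc n) z) - cscale (z * z) (hconj (A n) ** ?y n z)) = ?y (Suc (Suc n)) z" for z
    by (simp add: cscale_mult_right[symmetric] cscale_diff mult_ac del: wsol.simps(1,2))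
  ultimately show ?case by simp
qed

end

section \<open>Reconstruction of the free tail\<close>

text \<open>\<open>psi n\<close> is the Weyl solution (\<open>psi (-1) = 1\<close>, \<open>psi 0 = R\<close>). In the free case it equals
  \<open>f\<^sub>n f\<^sub>-\<^sub>1\<^sup>-\<^sup>1\<close>, and \<open>X k j = psi k Q psi\<^sub>j\<^sup>#\<close> is \<open>z\<^sup>k\<^sup>-\<^sup>j\<close> times a product of the unitary \<open>A\<^sub>i\<close>. In general,
  regularity off the origin and the decay of \<open>psi\<close> at the origin force \<open>X k k = 1\<close> and
  \<open>X (k+1) k = z A\<^sub>k\<^sup>-\<^sup>1\<close> for large \<open>k\<close> by Liouville's theorem.\<close>

locale reconstruction = jump_conditions R + jacobi_matrices A B
  for R :: "complex \<Rightarrow> complex^'l^'l" and A B :: "nat \<Rightarrow> complex^'l^'l" +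
  assumes growth: "\<And>n. reg 0 (\<lambda>z. cscale (inverse z ^ Suc n)
    (wsol A B (joukowski z) (mat 1) (R z) n))"
begin

definition "al n z = AL (joukowski z) n"
definition "be n z = BE (joukowski z) n"
definition "al' n z = hconj (al n (cnj z))"
definition "be' n z = hconj (be n (cnj z))"
definition "psi n z = wsol A B (joukowski z) (mat 1) (R z) n"
definition "psi' n z = hconj (psi n (cnj z))"

lemma psi_eq: "psi n z = al n z ** R z + be n z"
  unfolding psi_def al_def be_def by (subst wsol_linear) simp

lemma rmat_al: "rmat (al n)" "rmat (be n)" "rmat (al' n)" "rmat (be' n)" "rmat (psi n)"
proof -
  show a: "rmat (al n)" and b: "rmat (be n)"
    unfolding al_def[abs_def] be_def[abs_def] using rmat_reg_wsol by blast+
  show "rmat (al' n)" "rmat (be' n)"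
    unfolding al'_def[abs_def] be'_def[abs_def] by (rule rmat_hconj_cnj, fact)+
  show "rmat (psi n)" unfolding psi_eq[abs_def] by (intro rmat_add rmat_mult a b rmat_R)
qed

lemma reg_al: "a \<noteq> 0 \<Longrightarrow> reg a (al n)" "a \<noteq> 0 \<Longrightarrow> reg a (be n)" "a \<noteq> 0 \<Longrightarrow> reg a (al' n)" "a \<noteq> 0 \<Longrightarrow> reg a (be' n)"
proof -
  have *: "reg a (al n)" "reg a (be n)" if "a \<noteq> 0" for a
    unfolding al_def[abs_def] be_def[abs_def] using rmat_reg_wsol that by blast+
  show "a \<noteq> 0 \<Longrightarrow> reg a (al n)" "a \<noteq> 0 \<Longrightarrow> reg a (be n)" using * by blast+
  show "a \<noteq> 0 \<Longrightarrow> reg a (al' n)" "a \<noteq> 0 \<Longrightarrow> reg a (be' n)"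
    unfolding al'_def[abs_def] be'_def[abs_def] by (rule reg_hconj_cnj, simp add: *)+
qed

lemma al_inverse: "al n (inverse z) = al n z" "be n (inverse z) = be n z"
    "al' n (inverse z) = al' n z" "be' n (inverse z) = be' n z"
  by (simp_all add: al'_def be'_def al_def be_def joukowski_inverse)

lemma wr_al: "be k z ** al' j z - al k z ** be' j z = wr (joukowski z) k j"
  by (simp add: wr_def al'_def be'_def al_def be_def joukowski_cnj)

text \<open>The limits exist by \<open>growth\<close>. In the rescaled recurrence the next term
  carries z^2 and drops out while z E tends to 1, so each limit is determined by the previous
  one.\<close>

lemma psi_tendsto: "((\<lambda>z. cscale (inverse z ^ Suc n) (psi n z)) \<longlongrightarrow> LL n) (at 0)"
proof -
  define y where "y n z = cscale (inverse z ^ Suc n) (psi n z)" for n z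
  have "\<forall>n. \<exists>p. (y n \<longlongrightarrow> p) (at 0)"
    using growth unfolding reg_def y_def[abs_def] psi_def by blast
  then obtain p where p: "\<And>n. (y n \<longlongrightarrow> p n) (at 0)" by metis
  have ev0: "\<forall>\<^sub>F z in at 0. z \<noteq> (0::complex)" by (rule eventually_cofinite_at[OF eventually_neq_cofinite])
  have "p n = LL n"
  proof (induction n)
    case 0
    have "((\<lambda>z. cscale (z * joukowski z) (y 0 z) - cscale z (B 0 ** y 0 z) - cscale (z * z) (A 0 ** y 1 z)) \<longlongrightarrow>
      cscale 1 (p 0) - cscale 0 (B 0 ** p 0) - cscale (0 * 0) (A 0 ** p 1)) (at 0)"
      by (intro tendsto_diff tendsto_cscale tendsto_matrix_mult tendsto_mult tendsto_const tendsto_ident_at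
          tendsto_times_joukowski p)
    moreover have "\<forall>\<^sub>F z in at 0. cscale (z * joukowski z) (y 0 z) - cscale z (B 0 ** y 0 z) - cscale (z * z) (A 0 ** y 1 z) = mat 1"
      using ev0
    proof eventually_elim
      case (elim z)
      have c: "z * joukowski z * inverse z ^ Suc 0 = joukowski z" "z * inverse z ^ Suc 0 = 1"
        "z * z * inverse z ^ Suc 1 = 1" using elim by (simp_all add: field_simps)
      have "cscale (z * joukowski z) (y 0 z) - cscale z (B 0 ** y 0 z) - cscale (z * z) (A 0 ** y 1 z) =
        cscale (joukowski z) (psi 0 z) - B 0 ** psi 0 z - A 0 ** psi (Suc 0) z"
        unfolding y_def cscale_mult_right cscale_cscale c by simp
      also have "\<dots> = mat 1" unfolding psi_def wsol_step_0 by simp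
      finally show ?case .
    qed
    ultimately have "((\<lambda>_::complex. mat 1) \<longlongrightarrow>
      cscale 1 (p 0) - cscale 0 (B 0 ** p 0) - cscale (0 * 0) (A 0 ** p 1)) (at 0)"
      by (rule tendsto_eventually_eq')
    then have "mat 1 = cscale 1 (p 0) - cscale 0 (B 0 ** p 0) - cscale (0 * 0) (A 0 ** p 1)"
      by (rule tendsto_unique[OF _ tendsto_const, rotated]) simp
    then show ?case by simp
  next
    case (Suc n)
    have "((\<lambda>z. cscale (z * joukowski z) (y (Suc n) z) - cscale z (B (Suc n) ** y (Suc n) z)
        - cscale (z * z) (A (Suc n) ** y (Suc (Suc n)) z)) \<longlongrightarrow>
      cscale 1 (p (Suc n)) - cscale 0 (B (Suc n) ** p (Suc n)) - cscale (0 * 0) (A (Suc n) ** p (Suc (Suc n)))) (at 0)"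
      by (intro tendsto_diff tendsto_cscale tendsto_matrix_mult tendsto_mult tendsto_const tendsto_ident_at
          tendsto_times_joukowski p)
    moreover have "\<forall>\<^sub>F z in at 0. cscale (z * joukowski z) (y (Suc n) z) - cscale z (B (Suc n) ** y (Suc n) z)
        - cscale (z * z) (A (Suc n) ** y (Suc (Suc n)) z) = hconj (A n) ** y n z"
      using ev0
    proof eventually_elim
      case (elim z)
      have "A (Suc n) ** psi (Suc (Suc n)) z =
        cscale (joukowski z) (psi (Suc n) z) - B (Suc n) ** psi (Suc n) z - hconj (A n) ** psi n z"
        unfolding psi_def by (rule wsol_step)
      then have *: "hconj (A n) ** psi n z =
        cscale (joukowski z) (psi (Suc n) z) - B (Suc n) ** psi (Suc n) z - A (Suc n) ** psi (Suc (Suc n)) z"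
        by (simp only: diff_diff_eq2) simp
      have c: "z * inverse z ^ Suc (Suc n) = inverse z ^ Suc n" "z * z * inverse z ^ Suc (Suc (Suc n)) = inverse z ^ Suc n"
        using elim by (simp_all add: field_simps)
      have "z * joukowski z * inverse z ^ Suc (Suc n) = joukowski z * (z * inverse z ^ Suc (Suc n))"
        by (simp only: mult_ac)
      then have c0: "z * joukowski z * inverse z ^ Suc (Suc n) = joukowski z * inverse z ^ Suc n"
        unfolding c(1) .
      have "hconj (A n) ** y n z = cscale (inverse z ^ Suc n) (hconj (A n) ** psi n z)"
        by (simp add: y_def cscale_mult_right)
      also have "\<dots> = cscale (joukowski z * inverse z ^ Suc n) (psi (Suc n) z)
        - cscale (inverse z ^ Suc n) (B (Suc n) ** psi (Suc n) z)
        - cscale (inverse z ^ Suc n) (A (Suc n) ** psi (Suc (Suc n)) z)"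
        unfolding * cscale_diff cscale_cscale by (simp only: mult.commute)
      also have "\<dots> = cscale (z * joukowski z) (y (Suc n) z) - cscale z (B (Suc n) ** y (Suc n) z)
        - cscale (z * z) (A (Suc n) ** y (Suc (Suc n)) z)"
        unfolding y_def cscale_mult_right cscale_cscale c0 c ..
      finally show ?case by simp
    qed
    ultimately have "((\<lambda>z. hconj (A n) ** y n z) \<longlongrightarrow> cscale 1 (p (Suc n)) - cscale 0 (B (Suc n) ** p (Suc n)) - cscale (0 * 0) (A (Suc n) ** p (Suc (Suc n)))) (at 0)"
      by (rule tendsto_eventually_eq')
    then have "((\<lambda>z. hconj (A n) ** y n z) \<longlongrightarrow> p (Suc n)) (at 0)" by simp
    moreover have "((\<lambda>z. hconj (A n) ** y n z) \<longlongrightarrow> hconj (A n) ** p n) (at 0)"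
      by (intro tendsto_matrix_mult tendsto_const p)
    ultimately have "p (Suc n) = hconj (A n) ** p n" by (rule tendsto_unique[rotated]) simp
    then show ?case using Suc by simp
  qed
  then show ?thesis using p[of n] unfolding y_def[abs_def] by simp
qed

lemma psi'_tendsto: "((\<lambda>z. cscale (inverse z ^ Suc n) (psi' n z)) \<longlongrightarrow> hconj (LL n)) (at 0)"
proof -
  have "((\<lambda>z. hconj (cscale (inverse (cnj z) ^ Suc n) (psi n (cnj z)))) \<longlongrightarrow> hconj (LL n)) (at 0)"
    by (intro tendsto_hconj tendsto_compose_cnj[where F = "\<lambda>z. cscale (inverse z ^ Suc n) (psi n z)"])
      (simp only: complex_cnj_zero psi_tendsto)
  then show ?thesis by (simp add: hconj_cscale psi'_def)
qed

lemma al'_tendsto: "((\<lambda>z. cscale (z ^ n) (al' n z)) \<longlongrightarrow> hconj (aL n)) (at 0)"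
proof -
  have "((\<lambda>z. hconj (cscale (cnj z ^ n) (al n (cnj z)))) \<longlongrightarrow> hconj (aL n)) (at 0)"
    by (intro tendsto_hconj tendsto_compose_cnj[where F = "\<lambda>z. cscale (z ^ n) (al n z)"])
      (simp only: complex_cnj_zero al_def AL_tendsto)
  then show ?thesis by (simp add: hconj_cscale al'_def)
qed

text \<open>This is Q psi_j^#: there R(1/z) stands where \<open>psi'\<close> has R, and Q R - (z -
  1/z) = Q R(1/z). The form with \<open>psi'\<close> is the one whose behaviour at the origin is
  known.\<close>

definition "Z j z = Q z ** psi' j z - cscale (sv z) (al' j z)"

text \<open>psi_k Q psi_j^# expanded in alpha and beta, so that each of the four middle factors is
  regular off the origin.\<close>

definition "X k j z = al k z ** T z ** al' j z + al k z ** (R z ** Q z) ** be' j z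
    + be k z ** (Q z ** Rs z) ** al' j z + be k z ** Q z ** be' j z"

lemma X_eq: "\<forall>\<^sub>F z in cofinite. X k j z = psi k z ** Z j z"
  using Q_identities QR
proof eventually_elim
  case (elim z)
  have "psi' j z = R z ** al' j z + be' j z"
    using elim by (simp add: psi'_def psi_eq hconj_add hconj_mult al'_def be'_def)
  then have "Z j z = (Q z ** R z) ** al' j z + Q z ** be' j z - mat (sv z) ** al' j z"
    using cscale_mult_left[of "sv z" "mat 1" "al' j z"]
    by (simp add: Z_def matrix_add_ldistrib matrix_mul_assoc cscale_mat)
  also have "\<dots> = Q z ** Rs z ** al' j z + Q z ** be' j z"
    unfolding elim(2)[symmetric] by (simp add: matrix_add_rdistrib)
  finally have "Z j z = Q z ** Rs z ** al' j z + Q z ** be' j z" .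
  then show ?case
    by (simp add: X_def T_def psi_eq matrix_add_ldistrib matrix_add_rdistrib matrix_mul_assoc)
qed

lemma rmat_X: "rmat (X k j)"
  unfolding X_def[abs_def] by (intro rmat_add rmat_mult rmat_al rmat_T rmat_R rmat_Q rmat_Rs)

lemma reg_X: "a \<noteq> 0 \<Longrightarrow> reg a (X k j)"
  unfolding X_def[abs_def]
  by (intro reg_add reg_mult[OF reg_mult[OF _ reg_T]] reg_mult[OF reg_mult[OF _ reg_RQ]]
      reg_mult[OF reg_mult[OF _ reg_QRs]] reg_mult[OF reg_mult[OF _ reg_Q]] reg_al)

text \<open>z -> 1/z fixes \<open>Q\<close>, \<open>T\<close> and all polynomials in E, and alters
  the middle factors of the two mixed terms by z - 1/z with opposite signs; what remains is a
  Wronskian.\<close>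

lemma X_inverse: "\<forall>\<^sub>F z in cofinite. X k j (inverse z) = X k j z + cscale (sv z) (wr (joukowski z) k j)"
  using T_inverse Q_identities QR
proof eventually_elim
  case (elim z)
  have RsQ: "Rs z ** Q z = R z ** Q z - mat (sv z)"
    using elim(2) unfolding DD_def matrix_sub_rdistrib' by (metis diff_diff_eq2 add_diff_cancel_left')
  have m: "M ** mat (sv z) ** N = cscale (sv z) (M ** N)" for M N :: "complex^'l^'l"
    by (simp add: mult_mat_right cscale_mult_left)
  have "X k j (inverse z) = al k z ** T z ** al' j z + al k z ** (Rs z ** Q z) ** be' j z
    + be k z ** (Q z ** R z) ** al' j z + be k z ** Q z ** be' j z"
    unfolding X_def al_inverse using elim by (simp add: Rs_def)
  also have "\<dots> = X k j z + cscale (sv z) (be k z ** al' j z - al k z ** be' j z)"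
    unfolding RsQ elim(3)[symmetric] X_def matrix_add_ldistrib matrix_add_rdistrib matrix_sub_ldistrib'
      matrix_sub_rdistrib' m cscale_diff by (simp add: algebra_simps)
  finally show ?case unfolding wr_al .
qed

text \<open>At the origin psi_(k+i) has order k + i + 1 and Q psi'_k at least k + 1 - q, while (z -
  1/z) alpha'_k is asymptotic to - z^(-k-1) times a constant matrix. For q < 2 k + 2 the term with
  \<open>Q\<close> is negligible.\<close>

lemma X_tendsto:
  assumes q: "reg 0 (\<lambda>z. cscale (z ^ q) (Q z))" and k: "q < 2 * k + 2"
  shows "((\<lambda>z. cscale (inverse z ^ i) (X (k + i) k z)) \<longlongrightarrow> LL (k + i) ** hconj (aL k)) (at 0)"
proof -
  obtain q0 where q0: "((\<lambda>z. cscale (z ^ q) (Q z)) \<longlongrightarrow> q0) (at 0)" using q unfolding reg_def by blast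
  define d where "d = 2 * k + 2 - q"
  have d: "d > 0" "d + q = Suc k + Suc k" using k by (simp_all add: d_def)
  let ?p = "\<lambda>z. cscale (inverse z ^ Suc (k + i)) (psi (k + i) z)"
  let ?p' = "\<lambda>z. cscale (inverse z ^ Suc k) (psi' k z)"
  have "((\<lambda>z. cscale (z ^ d) (?p z ** cscale (z ^ q) (Q z) ** ?p' z)
      + cscale (1 - z * z) (?p z ** cscale (z ^ k) (al' k z))) \<longlongrightarrow>
    cscale (0 ^ d) (LL (k + i) ** q0 ** hconj (LL k)) + cscale (1 - 0 * 0) (LL (k + i) ** hconj (aL k))) (at 0)"
    by (intro tendsto_add tendsto_cscale tendsto_matrix_mult tendsto_power tendsto_diff tendsto_mult
        tendsto_const tendsto_ident_at psi_tendsto psi'_tendsto al'_tendsto q0)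
  then have "((\<lambda>z. cscale (z ^ d) (?p z ** cscale (z ^ q) (Q z) ** ?p' z)
      + cscale (1 - z * z) (?p z ** cscale (z ^ k) (al' k z))) \<longlongrightarrow> LL (k + i) ** hconj (aL k)) (at 0)"
    using d(1) by (simp add: power_0_left)
  moreover have "\<forall>\<^sub>F z in at 0. cscale (z ^ d) (?p z ** cscale (z ^ q) (Q z) ** ?p' z)
      + cscale (1 - z * z) (?p z ** cscale (z ^ k) (al' k z)) = cscale (inverse z ^ i) (X (k + i) k z)"
    using eventually_cofinite_at[OF X_eq[of "k + i" k]] eventually_cofinite_at[OF eventually_neq_cofinite[of 0]]
  proof eventually_elim
    case (elim z)
    have inv: "z ^ n * inverse z ^ n = 1" for n using elim(2) by (simp flip: power_mult_distrib)
    have "z ^ d * (inverse z ^ Suc (k + i) * z ^ q * inverse z ^ Suc k) =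
        (z ^ (d + q) * inverse z ^ (Suc k + Suc k)) * inverse z ^ i"
      by (simp add: power_add mult_ac)
    then have c1: "z ^ d * (inverse z ^ Suc (k + i) * z ^ q * inverse z ^ Suc k) = inverse z ^ i"
      unfolding d(2) inv by simp
    have "(1 - z * z) * (inverse z ^ Suc (k + i) * z ^ k) = (1 - z * z) * inverse z * (z ^ k * inverse z ^ k) * inverse z ^ i"
      by (simp add: power_add mult_ac)
    also have "\<dots> = - (inverse z ^ i * sv z)" unfolding inv using elim(2) by (simp add: field_simps)
    finally have c2: "(1 - z * z) * (inverse z ^ Suc (k + i) * z ^ k) = - (inverse z ^ i * sv z)" .
    have 1: "cscale (z ^ d) (?p z ** cscale (z ^ q) (Q z) ** ?p' z) =
      cscale (z ^ d * (inverse z ^ Suc (k + i) * z ^ q * inverse z ^ Suc k)) (psi (k + i) z ** Q z ** psi' k z)"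
      unfolding cscale_mult_left cscale_mult_right cscale_cscale by (simp only: mult_ac)
    have 2: "cscale (1 - z * z) (?p z ** cscale (z ^ k) (al' k z)) =
      cscale ((1 - z * z) * (inverse z ^ Suc (k + i) * z ^ k)) (psi (k + i) z ** al' k z)"
      unfolding cscale_mult_left cscale_mult_right cscale_cscale by (simp only: mult_ac)
    show ?case unfolding 1 2 c1 c2 elim(1) Z_def
      by (simp add: matrix_sub_ldistrib' cscale_mult_right cscale_diff matrix_mul_assoc cscale_minus_left)
  qed
  ultimately show ?thesis by (rule tendsto_eventually_eq')
qed

text \<open>\<open>wr\<close> vanishes on the diagonal, so the limit 1 at the origin is also the
  limit at infinity.\<close>

lemma X_diagonal:
  assumes q: "reg 0 (\<lambda>z. cscale (z ^ q) (Q z))" and k: "q < 2 * k + 2"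
  shows "\<forall>\<^sub>F z in cofinite. X k k z = mat 1"
proof (rule rmat_liouville[OF rmat_X])
  have lim: "(X k k \<longlongrightarrow> mat 1) (at 0)"
    using X_tendsto[OF q k, of 0] by (simp add: LL_aL(1))
  show "reg a (X k k)" for a
    using reg_X lim regI by (cases "a = 0") auto
  show "((\<lambda>z. X k k (inverse z)) \<longlongrightarrow> mat 1) (at 0)"
  proof (rule tendsto_eventually_eq[OF lim eventually_cofinite_at])
    show "\<forall>\<^sub>F z in cofinite. X k k (inverse z) = X k k z"
      using X_inverse[of k k] by eventually_elim (simp add: wr_identities)
  qed
qed

text \<open>X / z has the limit A_k^* at the origin and, through the Wronskian in
  \<open>X_inverse\<close>, A_k^(-1) at infinity. Being constant, it makes A_k unitary.\<close>

lemma X_offdiagonal: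
  assumes q: "reg 0 (\<lambda>z. cscale (z ^ q) (Q z))" and k: "q < 2 * k + 2"
  shows "A k ** hconj (A k) = mat 1"
    and "\<forall>\<^sub>F z in cofinite. X (Suc k) k z = cscale z (hconj (A k))"
proof -
  define Y where "Y z = cscale (inverse z) (X (Suc k) k z)" for z
  have lim: "(Y \<longlongrightarrow> hconj (A k)) (at 0)"
    using X_tendsto[OF q k, of 1] LL_aL(2)[of k] by (simp add: Y_def[abs_def] del: LL.simps)
  have wr: "wr e (Suc k) k = - matrix_inv (A k)" for e
  proof -
    have "A k ** wr e (Suc k) k = - mat 1" using wr_identities by blast
    then have "matrix_inv (A k) ** (A k ** wr e (Suc k) k) = - matrix_inv (A k)" by (simp add: matrix_neg_right)
    then show ?thesis using matrix_inv_mult(2)[OF A_inv[of k]] by (simp add: matrix_mul_assoc)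
  qed
  have Y: "\<forall>\<^sub>F z in cofinite. Y z = matrix_inv (A k)"
  proof (rule rmat_liouville)
    show "rmat Y" unfolding Y_def[abs_def] by (intro rmat_cscale ratfun_inverse ratfun_id rmat_X)
    show "reg a Y" for a
    proof (cases "a = 0")
      case False
      then show ?thesis unfolding Y_def[abs_def]
        by (intro reg_cscale[OF tendsto_inverse[OF tendsto_ident_at]] reg_X)
    qed (use lim regI in blast)
    have "((\<lambda>z. cscale (z * z) (Y z) + cscale (1 - z * z) (matrix_inv (A k))) \<longlongrightarrow>
      cscale (0 * 0) (hconj (A k)) + cscale (1 - 0 * 0) (matrix_inv (A k))) (at 0)"
      by (intro tendsto_add tendsto_cscale tendsto_diff tendsto_mult tendsto_const tendsto_ident_at lim)
    then have "((\<lambda>z. cscale (z * z) (Y z) + cscale (1 - z * z) (matrix_inv (A k))) \<longlongrightarrow> matrix_inv (A k)) (at 0)"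
      by simp
    then show "((\<lambda>z. Y (inverse z)) \<longlongrightarrow> matrix_inv (A k)) (at 0)"
    proof (rule tendsto_eventually_eq'[OF _ eventually_cofinite_at])
      show "\<forall>\<^sub>F z in cofinite. cscale (z * z) (Y z) + cscale (1 - z * z) (matrix_inv (A k)) = Y (inverse z)"
        using X_inverse[of "Suc k" k] eventually_neq_cofinite[of 0]
      proof eventually_elim
        case (elim z)
        have c: "z * z * inverse z = z" "z * sv z = z * z - 1" using elim(2) by (simp_all add: field_simps)
        have "Y (inverse z) = cscale z (X (Suc k) k z) + cscale (z * sv z) (- matrix_inv (A k))"
          by (simp add: Y_def elim(1) wr cscale_add)
        also have "\<dots> = cscale (z * z) (Y z) + cscale (1 - z * z) (matrix_inv (A k))"
          unfolding c Y_def cscale_cscale cscale_minus by simp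
        finally show ?case by simp
      qed
    qed
  qed
  have "((\<lambda>_::complex. matrix_inv (A k)) \<longlongrightarrow> hconj (A k)) (at 0)"
    by (rule tendsto_eventually_eq'[OF lim eventually_cofinite_at[OF Y]])
  then have eq: "matrix_inv (A k) = hconj (A k)"
    by (rule tendsto_unique[OF _ tendsto_const, rotated]) simp
  then show "A k ** hconj (A k) = mat 1" using matrix_inv_mult(1)[OF A_inv[of k]] by simp
  show "\<forall>\<^sub>F z in cofinite. X (Suc k) k z = cscale z (hconj (A k))"
    using Y eventually_neq_cofinite[of 0]
  proof eventually_elim
    case (elim z)
    have "cscale z (Y z) = X (Suc k) k z" using elim(2) by (simp add: Y_def)
    then show ?case using elim(1) eq by simp
  qed
qed

text \<open>\<open>Z k\<close> inverts \<open>psi k\<close>, so the off-diagonal value of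
  \<open>X\<close> is the quotient of consecutive Weyl solutions.\<close>

lemma psi_free:
  assumes q: "reg 0 (\<lambda>z. cscale (z ^ q) (Q z))" and k: "q < 2 * k + 2"
  shows "\<forall>\<^sub>F z in cofinite. psi (Suc k) z = cscale z (hconj (A k) ** psi k z) \<and> psi k z ** Z k z = mat 1"
  using X_diagonal[OF q k] X_offdiagonal(2)[OF q k] X_eq[of k k] X_eq[of "Suc k" k]
proof eventually_elim
  case (elim z)
  have 1: "psi k z ** Z k z = mat 1" using elim by simp
  then have "Z k z ** psi k z = mat 1" by (rule matrix_mult_1_commute)
  then have "psi (Suc k) z = (psi (Suc k) z ** Z k z) ** psi k z" by (simp flip: matrix_mul_assoc)
  also have "\<dots> = cscale z (hconj (A k) ** psi k z)"
    using elim by (simp add: cscale_mult_left)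
  finally show ?case using 1 by blast
qed

theorem eventually_free: "\<exists>N. \<forall>n\<ge>N. B n = 0 \<and> A n ** hconj (A n) = mat 1"
proof -
  \<comment> \<open>\<open>q\<close> bounds the order of the pole of \<open>Q\<close> at the origin
    and thereby fixes an index from which the tail is free.\<close>
  obtain q where "reg 0 (\<lambda>z. cscale ((z - 0) ^ q) (Q z))"
    using rmat_power_mult_reg[OF rmat_Q, of 0] by blast
  then have q: "reg 0 (\<lambda>z. cscale (z ^ q) (Q z))" by simp
  have "B (Suc k) = 0" if k: "q < 2 * k + 2" for k
  proof -
    \<comment> \<open>Two consecutive free steps are combined, since row k + 1 of the recurrence
      involves the indices k, k + 1 and k + 2.\<close>
    have k1: "q < 2 * Suc k + 2" using k by simp
    have "\<forall>\<^sub>F z in cofinite. z \<noteq> 0 \<and> psi (Suc k) z = cscale z (hconj (A k) ** psi k z) \<and>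
        psi (Suc (Suc k)) z = cscale z (hconj (A (Suc k)) ** psi (Suc k) z) \<and> psi (Suc k) z ** Z (Suc k) z = mat 1"
      using psi_free[OF q k] psi_free[OF q k1] eventually_neq_cofinite[of 0] by eventually_elim blast
    then have "\<exists>z. z \<noteq> 0 \<and> psi (Suc k) z = cscale z (hconj (A k) ** psi k z) \<and>
        psi (Suc (Suc k)) z = cscale z (hconj (A (Suc k)) ** psi (Suc k) z) \<and> psi (Suc k) z ** Z (Suc k) z = mat 1"
      by (rule eventually_happens'[rotated]) (simp add: infinite_UNIV_char_0)
    then obtain z where z: "z \<noteq> 0" "psi (Suc k) z = cscale z (hconj (A k) ** psi k z)"
      "psi (Suc (Suc k)) z = cscale z (hconj (A (Suc k)) ** psi (Suc k) z)" "psi (Suc k) z ** Z (Suc k) z = mat 1"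
      by blast
      have step: "A (Suc k) ** psi (Suc (Suc k)) z =
        cscale (joukowski z) (psi (Suc k) z) - B (Suc k) ** psi (Suc k) z - hconj (A k) ** psi k z"
        unfolding psi_def by (rule wsol_step)
      have "A (Suc k) ** psi (Suc (Suc k)) z = cscale z ((A (Suc k) ** hconj (A (Suc k))) ** psi (Suc k) z)"
        unfolding z(3) by (simp add: cscale_mult_right matrix_mul_assoc)
      then have 1: "A (Suc k) ** psi (Suc (Suc k)) z = cscale z (psi (Suc k) z)"
        using X_offdiagonal(1)[OF q k1] by simp
      have 2: "hconj (A k) ** psi k z = cscale (inverse z) (psi (Suc k) z)"
        using z(1,2) by simp
      have 3: "cscale (joukowski z) (psi (Suc k) z) = cscale z (psi (Suc k) z) + cscale (inverse z) (psi (Suc k) z)"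
        by (simp add: joukowski_def cscale_add_left)
      \<comment> \<open>The neighbouring terms z psi and psi / z exhaust E psi, so B psi = 0;
        \<open>Z\<close> then inverts psi.\<close>
      have "B (Suc k) ** psi (Suc k) z = 0" using step unfolding 1 2 3 by simp
      then have "B (Suc k) ** (psi (Suc k) z ** Z (Suc k) z) = 0" by (simp add: matrix_mul_assoc)
      then show ?thesis using z(4) by simp
  qed
  then have "B n = 0 \<and> A n ** hconj (A n) = mat 1" if "n \<ge> Suc q" for n
    using that X_offdiagonal(1)[OF q, of n] by (cases n) auto
  then show ?thesis by blast
qed

end

text \<open>On z = i t the energy is nonreal and of size about 1/t, so the Neumann series gives the
  resolvent column with an explicit bound. Its first entry is - R(z), and uniqueness for the
  recurrence identifies the column with the Weyl solution up to sign.\<close>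

lemma weyl_solution_growth:
  fixes m :: "complex \<Rightarrow> complex^'l^'l"
  assumes corr: "corresponds A B m" and R: "is_rational_extension R m"
  shows "reg 0 (\<lambda>z. cscale (inverse z ^ Suc n) (wsol A B (joukowski z) (mat 1) (R z) n))"
proof -
  have J: "block_jacobi A B" and res: "\<And>E. Im E \<noteq> 0 \<Longrightarrow> m E = resolvent_block A B E"
    using corr unfolding corresponds_def by blast+
  interpret jacobi_matrices A B
    by unfold_locales (use J in \<open>auto simp: block_jacobi_def\<close>)
  have rR: "rmat R" using R rational_matrix_imp_rmat by (auto simp: is_rational_extension_def)
  have "\<exists>c>0. \<exists>K. \<forall>E. cmod E > c \<longrightarrow> (\<exists>\<Psi>.
    (\<forall>n. jacobi_mat A B \<Psi> n - cscale E (\<Psi> n) = (if n = 0 then mat 1 else 0)) \<and>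
    (\<forall>n. norm (\<Psi> n) \<le> K * (c / cmod E) ^ n / (cmod E - c)))"
    by (rule jacobi_neumann_series[OF J])
  then obtain c K where c: "c > 0" and neumann: "\<And>E. cmod E > c \<Longrightarrow> \<exists>\<Psi>.
    (\<forall>n. jacobi_mat A B \<Psi> n - cscale E (\<Psi> n) = (if n = 0 then mat 1 else 0)) \<and>
    (\<forall>n. norm (\<Psi> n) \<le> K * (c / cmod E) ^ n / (cmod E - c))" by blast
  let ?f = "\<lambda>z. cscale (inverse z ^ Suc n) (wsol A B (joukowski z) (mat 1) (R z) n)"
  have "?f = (\<lambda>z. cscale (inverse z ^ Suc n) (AL (joukowski z) n ** R z + BE (joukowski z) n))"
    by (subst wsol_linear) simp
  moreover have "rmat (\<lambda>z. AL (joukowski z) n)" "rmat (\<lambda>z. BE (joukowski z) n)"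
    using rmat_reg_wsol by blast+
  ultimately have rf: "rmat ?f"
    using rR by (auto intro!: rmat_cscale ratfun_power ratfun_inverse rmat_add rmat_mult)
  show ?thesis
  proof (rule rmat_bounded_imp_reg[OF rf])
    \<comment> \<open>t < 1/2 gives |E| \<ge> 1 / (2 t), and t < 1 / (4 c) gives c < 1 / (4 t);
      together |E| - c \<ge> 1 / (4 t).\<close>
    define d where "d = min (1 / 2) (1 / (4 * c))"
    show "\<exists>\<^sub>F z in at 0. norm (?f z) \<le> 4 * K * (2 * c) ^ n"
    proof (rule frequently_at_vertical[of d])
      show "d > 0" using c by (simp add: d_def)
      fix t assume t: "0 < t" "t < d"
      define z where "z = 0 + \<i> * complex_of_real t"
      define E where "E = joukowski z"
      have zt: "cmod z = t" "Im z = t" "z \<noteq> 0" using t by (auto simp: z_def norm_mult)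
      have t1: "t < 1 / 2" "t < 1 / (4 * c)" using t by (simp_all add: d_def)
      have ImE: "Im E = t - 1 / t" unfolding E_def Im_joukowski zt using t
        by (simp add: field_simps power2_eq_square)
      have "t * t \<le> 1 / 2 * (1 / 2)" using t t1 by (intro mult_mono) auto
      then have "1 / (2 * t) \<le> 1 / t - t" using t by (simp add: field_simps)
      moreover have "\<bar>Im E\<bar> \<le> cmod E" by (rule abs_Im_le_cmod)
      ultimately have E1: "1 / (2 * t) \<le> cmod E" unfolding ImE by linarith
      have c1: "c < 1 / (4 * t)" using t1(2) t c by (simp add: field_simps)
      have half: "1 / (2 * t) = 1 / (4 * t) + 1 / (4 * t)" using t by (simp add: field_simps)
      have a0: "0 < 1 / (4 * t)" using t by simp
      have Ec: "1 / (4 * t) \<le> cmod E - c" "c < cmod E" using E1 c1 half a0 by linarith+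
      have ImE0: "Im E \<noteq> 0"
      proof -
        have "1 / t > 1" using t t1 by simp
        then show ?thesis unfolding ImE using t1 by linarith
      qed
      obtain \<Psi> where \<Psi>: "\<And>n. jacobi_mat A B \<Psi> n - cscale E (\<Psi> n) = (if n = 0 then mat 1 else 0)"
        "\<And>n. norm (\<Psi> n) \<le> K * (c / cmod E) ^ n / (cmod E - c)" using neumann[OF Ec(2)] by blast
      have pos: "cmod E - c > 0" using Ec(2) by simp
      have "0 \<le> norm (\<Psi> 0)" by simp
      also have "\<dots> \<le> K / (cmod E - c)" using \<Psi>(2)[of 0] by simp
      finally have K: "0 \<le> K" using pos by (simp add: zero_le_divide_iff)
      define q where "q = c / cmod E"
      have cE: "cmod E > 0" using c Ec(2) by linarith
      have q: "0 \<le> q" "q < 1" "q \<le> 2 * c * t"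
      proof -
        show "0 \<le> q" "q < 1" using c cE Ec(2) by (simp_all add: q_def)
        have "c / cmod E \<le> c / (1 / (2 * t))" using E1 t c cE by (intro divide_left_mono) auto
        then show "q \<le> 2 * c * t" by (simp add: q_def)
      qed
      have "summable (\<lambda>n. (norm (\<Psi> n))\<^sup>2)"
      proof (rule summable_comparison_test')
        show "summable (\<lambda>n. (K / (cmod E - c))\<^sup>2 * (q\<^sup>2) ^ n)"
          using q by (intro summable_mult summable_geometric) (simp add: power_less_one_iff)
        fix n
        have "(norm (\<Psi> n))\<^sup>2 \<le> (K * q ^ n / (cmod E - c))\<^sup>2"
          using \<Psi>(2)[of n] by (intro power_mono) (simp_all add: q_def)
        then show "norm ((norm (\<Psi> n))\<^sup>2) \<le> (K / (cmod E - c))\<^sup>2 * (q\<^sup>2) ^ n"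
          by (simp add: power_divide power_mult_distrib mult.commute flip: power_mult)
      qed
      then have "resolvent_block A B E = \<Psi> 0" by (rule resolvent_block_eq[OF J ImE0 \<Psi>(1)])
      moreover have "R z = - m E"
        using R zt t t1 by (auto simp: is_rational_extension_def E_def joukowski_def)
      ultimately have Rz: "R z = - \<Psi> 0" using res[OF ImE0] by simp
      have "- \<Psi> n = wsol A B E (mat 1) (- \<Psi> 0) n"
      proof (rule wsol_unique[where \<Psi> = "\<lambda>n. - \<Psi> n"])
        show "invertible (A n)" for n by (rule A_inv)
        fix n
        have "jacobi_mat A B (\<lambda>n. - \<Psi> n) n = - jacobi_mat A B \<Psi> n"
          by (simp add: jacobi_mat_def matrix_neg_right)
        then have "jacobi_mat A B (\<lambda>n. - \<Psi> n) n - cscale E (- \<Psi> n) = - (jacobi_mat A B \<Psi> n - cscale E (\<Psi> n))"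
          by (simp add: cscale_minus cscale_minus_left)
        then show "jacobi_mat A B (\<lambda>n. - \<Psi> n) n - cscale E (- \<Psi> n) = (if n = 0 then - mat 1 else 0)"
          unfolding \<Psi>(1) by simp
      qed
      then have "norm (wsol A B (joukowski z) (mat 1) (R z) n) = norm (\<Psi> n)"
        unfolding Rz E_def by (metis norm_minus_cancel)
      also have "\<dots> \<le> K * q ^ n / (cmod E - c)" using \<Psi>(2)[of n] by (simp add: q_def)
      also have "\<dots> \<le> K * (2 * c * t) ^ n / (1 / (4 * t))"
        using K q c t Ec(1) by (intro frac_le mult_left_mono power_mono mult_nonneg_nonneg) auto
      also have "\<dots> = 4 * K * (2 * c) ^ n * t ^ Suc n" by (simp add: power_mult_distrib)
      finally have "inverse t ^ Suc n * norm (wsol A B (joukowski z) (mat 1) (R z) n) \<le>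
        inverse t ^ Suc n * (4 * K * (2 * c) ^ n * t ^ Suc n)"
        using t by (intro mult_left_mono) auto
      also have "\<dots> = 4 * K * (2 * c) ^ n * (inverse t ^ Suc n * t ^ Suc n)" by (simp only: mult_ac)
      also have "inverse t ^ Suc n * t ^ Suc n = 1"
        unfolding power_mult_distrib[symmetric] using t by simp
      finally have "norm (?f z) \<le> 4 * K * (2 * c) ^ n"
        by (simp del: power_Suc add: norm_cscale norm_mult norm_power norm_inverse zt)
      then show "norm (?f (0 + \<i> * complex_of_real t)) \<le> 4 * K * (2 * c) ^ n" unfolding z_def .
    qed
  qed
qed

theorem conditions_imp_eventually_free:
  fixes m :: "complex \<Rightarrow> complex^'l^'l"
  assumes m: "discrete_m_function m" "is_representing_measure \<mu> m" and corr: "corresponds A B m"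
    and R: "is_rational_extension R m" "cond_B R" "cond_C R" "cond_D R"
  shows "\<forall>\<^sub>F n in sequentially. norm (B n) + norm (mat 1 - A n ** hconj (A n)) = 0"
proof -
  have J: "block_jacobi A B" using corr unfolding corresponds_def by blast
  interpret reconstruction R A B
  proof
    show "rmat R" using R(1) rational_matrix_imp_rmat by (auto simp: is_rational_extension_def)
    show "\<forall>\<^sub>F z in cofinite. hconj (R (cnj z)) = R z" by (rule rational_extension_symmetric[OF m(1) R(1)])
    show "invertible (A n)" "hermitian (B n)" for n using J unfolding block_jacobi_def by blast+
    show "Im w = 0" if "cmod w < 1" "w \<noteq> 0" "\<not> reg w R" for w
      using rational_extension_pole_in_disk(1)[OF m R(1)] that by blast
    show "reg w (\<lambda>z. cscale (z - w) (R z))" if "cmod w < 1" "w \<noteq> 0" for w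
      using rational_extension_pole_in_disk(2)[OF m R(1)] that by blast
  qed (rule R weyl_solution_growth[OF corr R(1)])+
  obtain N where "\<And>n. n \<ge> N \<Longrightarrow> B n = 0 \<and> A n ** hconj (A n) = mat 1" using eventually_free by blast
  then show ?thesis unfolding eventually_sequentially by (intro exI[of _ N]) simp
qed

theorem theorem3p9:
  fixes m :: "complex \<Rightarrow> complex^'l^'l" and \<mu> :: "real set \<Rightarrow> complex^'l^'l"
  assumes "discrete_m_function m"
    and "is_representing_measure \<mu> m"
    and "nontrivial_measure \<mu>"
  shows "(\<forall>A B. corresponds A B m \<longrightarrow>
            (\<forall>\<^sub>F n in sequentially. norm (B n) + norm (mat 1 - A n ** hconj (A n)) = 0))
         \<longleftrightarrow>
         (\<exists>R. is_rational_extension R m \<and> cond_B R \<and> cond_C R \<and> cond_D R)"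
proof
  assume free: "\<forall>A B. corresponds A B m \<longrightarrow>
    (\<forall>\<^sub>F n in sequentially. norm (B n) + norm (mat 1 - A n ** hconj (A n)) = 0)"
  \<comment> \<open>Without a corresponding Jacobi matrix the assumption \<open>free\<close> would
    be vacuous; nontriviality of the measure supplies one.\<close>
  obtain A B where "corresponds A B m" using block_jacobi_exists[OF assms(2,3)] by blast
  then show "\<exists>R. is_rational_extension R m \<and> cond_B R \<and> cond_C R \<and> cond_D R"
    using eventually_free_imp_conditions[OF assms(1,2)] free by blast
next
  assume "\<exists>R. is_rational_extension R m \<and> cond_B R \<and> cond_C R \<and> cond_D R"
  then show "\<forall>A B. corresponds A B m \<longrightarrow>
    (\<forall>\<^sub>F n in sequentially. norm (B n) + norm (mat 1 - A n ** hconj (A n)) = 0)"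
    using conditions_imp_eventually_free[OF assms(1,2)] by blast
qed

end
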